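(* Let $\Gamma$ be a Coxeter graph with finite vertex set $S$, and let $(A,\Sigma)$ be its Artin–Tits system. Assume that, for every $X\in\mathcal S_{<\infty}$, $\Gamma_X$ is of type $K(\pi,1)$ and $A_X$ has a solution to the word problem. Then the group $A$ has a solution to the word problem.
   Context: A Coxeter graph $\Gamma$ with finite vertex set $S$ encodes a Coxeter matrix $(m_{s,t})_{s,t\in S}$, with $m_{s,s}=1$, $m_{s,t}=m_{t,s}\in\{2,3,\dots,\infty\}$ for $s\ne t$. Coxeter group: $W=\langle S\mid s^2=1,\ (st)^{m_{s,t}}=1\ (s\ne t,\ m_{s,t}\ne\infty)\rangle$. Artin–Tits group: $A=\langle \Sigma\mid \sigma_s\sigma_t\sigma_s\cdots=\sigma_t\sigma_s\sigma_t\cdots$ ($m_{s,t}$ factors on each side), $s\ne t$, $m_{s,t}\neq\infty\rangle$, where $\Sigma=\{\sigma_s:s\in S\}$. For $X\subset S$: $A_X=\langle\sigma_s:s\in X\rangle\subset A$, $\Gamma_X$ is the Coxeter graph of $(m_{s,t})_{s,t\in X}$. $\mathcal S_{<\infty}$ is the set of $X\subset S$ such that $\Gamma_X$ is free of infinity, i.e. $m_{s,t}\ne\infty$ for all $s,t\in X$. Type $K(\pi,1)$: let $V$ be the dual of $\bigoplus_{s\in S}\mathbb Re_s$, where $s\in S$ acts on $\bigoplus_s\mathbb Re_s$ by $x\mapsto x-2B(x,e_s)e_s$, $B(e_s,e_t)=-\cos(\pi/m_{s,t})$ ($-1$ if $m_{s,t}=\infty$), and $W$ acts on $V$ contragrediently;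 let $I$ be the interior of $\bigcup_{w\in W}w\{f\in V:f(e_s)\ge0\ \forall s\}$ (Tits cone), $R=\{wsw^{-1}:s\in S, w\in W\}$, $H_r$ the hyperplane fixed by $r\in R$, and $E_\Gamma=(I\times V)\setminus\bigcup_{r\in R}(H_r\times H_r)$. $\Gamma$ is of type $K(\pi,1)$ if $E_\Gamma$ is an Eilenberg–MacLane space $K(\pi_1(E_\Gamma),1)$. A finitely generated group has a solution to the word problem if there is an algorithm which decides whether a given word in a fixed finite generating set (here $\Sigma$, resp. $\Sigma_X=\{\sigma_s:s\in X\}$) and its inverses represents the trivial element. *)

theory Defs
  imports
    "HOL-Analysis.Analysis"
    "HOL-Algebra.Elementary_Groups"
    "HOL-Library.Extended_Nat"
    "HOL-Library.Nat_Bijection"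
begin

section \<open>Groups given by generators and relations\<close>

text \<open>A group word is a list of letters; the letter \<open>(s, True)\<close> stands for \<open>s\<close> and
  \<open>(s, False)\<close> for its formal inverse.\<close>

type_synonym 's gword = "('s \<times> bool) list"

definition gwords :: "'s set \<Rightarrow> 's gword set"
  where "gwords S = lists (S \<times> UNIV)"

inductive pres_eq :: "'s set \<Rightarrow> ('s gword \<times> 's gword) set \<Rightarrow> 's gword \<Rightarrow> 's gword \<Rightarrow> bool"
  for S :: "'s set" and Rel :: "('s gword \<times> 's gword) set"
where
  pres_refl: "u \<in> gwords S \<Longrightarrow> pres_eq S Rel u u"
| pres_sym: "pres_eq S Rel u v \<Longrightarrow> pres_eq S Rel v u"
| pres_trans: "pres_eq S Rel u v \<Longrightarrow> pres_eq S Rel v w \<Longrightarrow> pres_eq S Rel u w"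
| pres_append: "pres_eq S Rel u u' \<Longrightarrow> pres_eq S Rel v v' \<Longrightarrow> pres_eq S Rel (u @ v) (u' @ v')"
| pres_cancel: "s \<in> S \<Longrightarrow> pres_eq S Rel [(s, b), (s, \<not> b)] []"
| pres_rel: "(u, v) \<in> Rel \<Longrightarrow> u \<in> gwords S \<Longrightarrow> v \<in> gwords S \<Longrightarrow> pres_eq S Rel u v"

definition pres_rel_of :: "'s set \<Rightarrow> ('s gword \<times> 's gword) set \<Rightarrow> ('s gword \<times> 's gword) set"
  where "pres_rel_of S Rel = {(u, v). pres_eq S Rel u v}"

definition presented_group ::
    "'s set \<Rightarrow> ('s gword \<times> 's gword) set \<Rightarrow> 's gword set monoid"
  where "presented_group S Rel =
    \<lparr>carrier = gwords S // pres_rel_of S Rel,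
     monoid.mult = (\<lambda>P Q. \<Union>u\<in>P. \<Union>v\<in>Q. pres_rel_of S Rel `` {u @ v}),
     one = pres_rel_of S Rel `` {[]}\<rparr>"

definition pres_gen :: "'s set \<Rightarrow> ('s gword \<times> 's gword) set \<Rightarrow> 's \<Rightarrow> 's gword set"
  where "pres_gen S Rel s = pres_rel_of S Rel `` {[(s, True)]}"

lemma pres_eq_gwords:
  assumes "pres_eq S Rel u v"
  shows "u \<in> gwords S \<and> v \<in> gwords S"
  using assms by induction (auto simp: gwords_def)

lemma equiv_pres_rel_of: "equiv (gwords S) (pres_rel_of S Rel)"
  by (intro equivI)
    (auto simp: pres_rel_of_def refl_on_def sym_def trans_def
        intro: pres_refl pres_sym pres_trans dest: pres_eq_gwords)

lemma presented_group_mult: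
  assumes "u \<in> gwords S" "v \<in> gwords S"
  shows "(pres_rel_of S Rel `` {u}) \<otimes>\<^bsub>presented_group S Rel\<^esub> (pres_rel_of S Rel `` {v})
    = pres_rel_of S Rel `` {u @ v}"
proof -
  have "congruent2 (pres_rel_of S Rel) (pres_rel_of S Rel)
      (\<lambda>u v. pres_rel_of S Rel `` {u @ v})"
    by (intro congruent2I') (auto simp: pres_rel_of_def intro: pres_append pres_sym pres_trans)
  from UN_equiv_class2[OF equiv_pres_rel_of equiv_pres_rel_of this assms]
  show ?thesis by (simp add: presented_group_def)
qed

lemma group_presented_group: "group (presented_group S Rel)"
proof -
  let ?G = "presented_group S Rel" and ?R = "pres_rel_of S Rel"
  have cl: "P \<in> carrier ?G \<longleftrightarrow> (\<exists>u\<in>gwords S. P = ?R `` {u})" for P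
    by (auto simp: presented_group_def quotient_def)
  have nil: "[] \<in> gwords S" and app: "\<And>u v. u \<in> gwords S \<Longrightarrow> v \<in> gwords S \<Longrightarrow> u @ v \<in> gwords S"
    by (auto simp: gwords_def)
  have one: "\<one>\<^bsub>?G\<^esub> = ?R `` {[]}" by (simp add: presented_group_def)
  have inv: "\<exists>v\<in>gwords S. pres_eq S Rel (v @ u) []" if "u \<in> gwords S" for u
    using that
  proof (induction u)
    case Nil
    then show ?case using pres_refl[OF nil] nil by auto
  next
    case (Cons p u)
    obtain s b where p: "p = (s, b)" by force
    from Cons.prems have s: "s \<in> S" and u: "u \<in> gwords S" by (auto simp: gwords_def p)
    from Cons.IH[OF u] obtain v where v: "v \<in> gwords S" "pres_eq S Rel (v @ u) []" by blast
    have "pres_eq S Rel [(s, \<not> b), (s, \<not> \<not> b)] []" by (rule pres_cancel[OF s])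
    then have "pres_eq S Rel (v @ ([(s, \<not> b), (s, b)] @ u)) (v @ ([] @ u))"
      by (intro pres_append pres_refl u v) simp
    with v(2) have "pres_eq S Rel ((v @ [(s, \<not> b)]) @ p # u) []"
      using pres_trans by (fastforce simp: p)
    moreover have "v @ [(s, \<not> b)] \<in> gwords S" using v s by (auto simp: gwords_def)
    ultimately show ?case by blast
  qed
  show ?thesis
  proof (rule groupI)
    fix P assume "P \<in> carrier ?G"
    then obtain u where u: "u \<in> gwords S" "P = ?R `` {u}" by (auto simp: cl)
    obtain v where v: "v \<in> gwords S" "pres_eq S Rel (v @ u) []" using inv[OF u(1)] by blast
    have "(?R `` {v}) \<otimes>\<^bsub>?G\<^esub> P = \<one>\<^bsub>?G\<^esub>"
      unfolding u(2) presented_group_mult[OF v(1) u(1)] one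
      by (intro equiv_class_eq[OF equiv_pres_rel_of]) (use v in \<open>simp add: pres_rel_of_def\<close>)
    with v show "\<exists>Q\<in>carrier ?G. Q \<otimes>\<^bsub>?G\<^esub> P = \<one>\<^bsub>?G\<^esub>" using cl by blast
  qed (auto simp: cl one presented_group_mult nil app)
qed


section \<open>Coxeter groups and Artin--Tits groups\<close>

definition coxeter_matrix :: "'s set \<Rightarrow> ('s \<Rightarrow> 's \<Rightarrow> enat) \<Rightarrow> bool"
  where "coxeter_matrix S m \<longleftrightarrow>
    (\<forall>s\<in>S. m s s = 1) \<and>
    (\<forall>s\<in>S. \<forall>t\<in>S. s \<noteq> t \<longrightarrow> m s t = m t s \<and> 2 \<le> m s t)"

text \<open>A Coxeter graph is given by its vertex set and its Coxeter matrix. The graph \<open>\<Gamma>\<^sub>X\<close>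
  spanned by \<open>X \<subseteq> S\<close> is the pair \<open>(X, m)\<close>: below, only the values of \<open>m\<close> on the given vertex
  set are ever used.\<close>

definition free_of_infinity_subsets :: "'s set \<Rightarrow> ('s \<Rightarrow> 's \<Rightarrow> enat) \<Rightarrow> 's set set"
  where "free_of_infinity_subsets S m = {X. X \<subseteq> S \<and> (\<forall>s\<in>X. \<forall>t\<in>X. m s t \<noteq> \<infinity>)}"

definition coxeter_rels ::
    "'s set \<Rightarrow> ('s \<Rightarrow> 's \<Rightarrow> enat) \<Rightarrow> ('s gword \<times> 's gword) set"
  where "coxeter_rels S m =
    {([(s, True), (s, True)], []) | s. s \<in> S} \<union>
    {(concat (replicate k [(s, True), (t, True)]), []) | s t k.
       s \<in> S \<and> t \<in> S \<and> s \<noteq> t \<and> m s t = enat k}"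

definition coxeter_group :: "'s set \<Rightarrow> ('s \<Rightarrow> 's \<Rightarrow> enat) \<Rightarrow> 's gword set monoid"
  where "coxeter_group S m = presented_group S (coxeter_rels S m)"

definition coxeter_gen :: "'s set \<Rightarrow> ('s \<Rightarrow> 's \<Rightarrow> enat) \<Rightarrow> 's \<Rightarrow> 's gword set"
  where "coxeter_gen S m s = pres_gen S (coxeter_rels S m) s"

text \<open>\<open>alternating k s t\<close> is the positive word \<open>s t s \<dots>\<close> with \<open>k\<close> letters.\<close>

primrec alternating :: "nat \<Rightarrow> 's \<Rightarrow> 's \<Rightarrow> 's gword"
where
  "alternating 0 s t = []"
| "alternating (Suc k) s t = (s, True) # alternating k t s"

definition artin_rels ::
    "'s set \<Rightarrow> ('s \<Rightarrow> 's \<Rightarrow> enat) \<Rightarrow> ('s gword \<times> 's gword) set"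
  where "artin_rels S m =
    {(alternating k s t, alternating k t s) | s t k.
       s \<in> S \<and> t \<in> S \<and> s \<noteq> t \<and> m s t = enat k}"

definition artin_group :: "'s set \<Rightarrow> ('s \<Rightarrow> 's \<Rightarrow> enat) \<Rightarrow> 's gword set monoid"
  where "artin_group S m = presented_group S (artin_rels S m)"

definition artin_gen :: "'s set \<Rightarrow> ('s \<Rightarrow> 's \<Rightarrow> enat) \<Rightarrow> 's \<Rightarrow> 's gword set"
  where "artin_gen S m s = pres_gen S (artin_rels S m) s"


section \<open>The canonical representation and its dual\<close>

text \<open>Vectors of the direct sum of the lines spanned by \<open>e\<^sub>s\<close>, \<open>s \<in> X\<close>, are coordinate functions
  \<open>'s \<Rightarrow> real\<close>, of which only the coordinates in \<open>X\<close> matter.\<close>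

definition simple_root :: "'s \<Rightarrow> 's \<Rightarrow> real"
  where "simple_root s = (\<lambda>t. if t = s then 1 else 0)"

definition cox_coeff :: "enat \<Rightarrow> real"
  where "cox_coeff n = (case n of enat k \<Rightarrow> - cos (pi / real k) | \<infinity> \<Rightarrow> -1)"

definition cox_form ::
    "'s set \<Rightarrow> ('s \<Rightarrow> 's \<Rightarrow> enat) \<Rightarrow> ('s \<Rightarrow> real) \<Rightarrow> ('s \<Rightarrow> real) \<Rightarrow> real"
  where "cox_form X m x y = (\<Sum>s\<in>X. \<Sum>t\<in>X. x s * y t * cox_coeff (m s t))"

definition cox_refl ::
    "'s set \<Rightarrow> ('s \<Rightarrow> 's \<Rightarrow> enat) \<Rightarrow> 's \<Rightarrow> ('s \<Rightarrow> real) \<Rightarrow> ('s \<Rightarrow> real)"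
  where "cox_refl X m s x =
    (\<lambda>t. x t - 2 * cox_form X m x (simple_root s) * simple_root s t)"

text \<open>Since \<open>s\<^sup>2 = 1\<close> in the Coxeter group, the letters \<open>s\<close> and \<open>s\<^sup>-\<^sup>1\<close> act in the same way.\<close>

definition word_act ::
    "'s set \<Rightarrow> ('s \<Rightarrow> 's \<Rightarrow> enat) \<Rightarrow> 's gword \<Rightarrow> ('s \<Rightarrow> real) \<Rightarrow> ('s \<Rightarrow> real)"
  where "word_act X m u x = foldr (\<lambda>(s, _). cox_refl X m s) u x"

text \<open>An element of the Coxeter group is a class of words, all of which act in the same way
  (lemma \<open>cox_act_eq_word_act\<close>).\<close>

definition cox_act ::
    "'s set \<Rightarrow> ('s \<Rightarrow> 's \<Rightarrow> enat) \<Rightarrow> 's gword set \<Rightarrow> ('s \<Rightarrow> real) \<Rightarrow> ('s \<Rightarrow> real)"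
  where "cox_act X m w = the_elem (word_act X m ` w)"

lemma cox_coeff_self: "cox_coeff 1 = 1"
  by (simp add: cox_coeff_def one_enat_def)

lemma cox_form_root:
  assumes "finite X" "s \<in> X"
  shows "cox_form X m x (simple_root s) = (\<Sum>t\<in>X. x t * cox_coeff (m t s))"
  using assms by (auto simp: cox_form_def simple_root_def if_distrib if_distribR
      sum.delta cong: if_cong intro!: sum.cong)

lemma cox_form_add_root:
  assumes "finite X" "s \<in> X" "r \<in> X"
  shows "cox_form X m (\<lambda>t. x t + c * simple_root r t) (simple_root s)
    = cox_form X m x (simple_root s) + c * cox_coeff (m r s)"
proof -
  have "(\<Sum>t\<in>X. c * simple_root r t * cox_coeff (m t s))
      = (\<Sum>t\<in>X. if t = r then c * cox_coeff (m r s) else 0)"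
    by (intro sum.cong) (auto simp: simple_root_def)
  with assms show ?thesis
    by (simp add: cox_form_root distrib_right sum.distrib)
qed

lemma cox_refl_refl:
  assumes "finite X" "coxeter_matrix X m" "s \<in> X"
  shows "cox_refl X m s (cox_refl X m s x) = x"
proof -
  have "m s s = 1" using assms by (simp add: coxeter_matrix_def)
  then have "cox_form X m (cox_refl X m s x) (simple_root s) = - cox_form X m x (simple_root s)"
    using cox_form_add_root[of X s s m x "- 2 * cox_form X m x (simple_root s)"] assms
    by (simp add: cox_refl_def[of X m s x] cox_coeff_self)
  then show ?thesis
    by (subst cox_refl_def, simp, simp add: cox_refl_def)
qed

lemma cox_refl_braid:
  assumes fin: "finite X" and cox: "coxeter_matrix X m"
    and st: "s \<in> X" "t \<in> X" "s \<noteq> t" and k: "m s t = enat k"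
  shows "((\<lambda>x. cox_refl X m s (cox_refl X m t x)) ^^ k) x = x"
proof -
  define \<theta> where "\<theta> = pi / real k"
  define c where "c = cos \<theta>"
  have "enat 2 \<le> m s t"
    using cox st by (simp add: coxeter_matrix_def flip: numeral_eq_enat)
  then have k2: "2 \<le> k" by (simp add: k)
  have \<theta>: "0 < \<theta>" "\<theta> < pi" "real k * \<theta> = pi" using k2 by (auto simp: \<theta>_def field_simps)
  have sin: "sin \<theta> > 0" using \<theta> by (intro sin_gt_zero)
  have msym: "m t s = enat k" "m s s = 1" "m t t = 1"
    using cox st k by (auto simp: coxeter_matrix_def)
  define a where "a = cox_form X m x (simple_root s)"
  define b where "b = cox_form X m x (simple_root t)"
  define v where "v = (\<lambda>p q r. x r + p * simple_root s r + q * simple_root t r)"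
  have co: "cox_coeff (m s t) = - c" "cox_coeff (m t s) = - c"
    "cox_coeff (m s s) = 1" "cox_coeff (m t t) = 1"
    using msym k by (simp_all add: cox_coeff_self) (simp_all add: cox_coeff_def c_def \<theta>_def)
  have Bs: "cox_form X m (v p q) (simple_root s) = a + p - c * q"
    and Bt: "cox_form X m (v p q) (simple_root t) = b - c * p + q" for p q
    unfolding v_def using fin st by (simp_all add: cox_form_add_root co a_def b_def)
  have Rs: "cox_refl X m s (v p q) = v (p - 2 * (a + p - c * q)) q"
    and Rt: "cox_refl X m t (v p q) = v p (q - 2 * (b - c * p + q))" for p q
    by (auto simp: cox_refl_def Bs Bt fun_eq_iff) (auto simp: v_def algebra_simps)
  have d: "1 - c\<^sup>2 = (sin \<theta>)\<^sup>2" by (simp add: c_def sin_squared_eq)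
  have d0: "1 - c\<^sup>2 \<noteq> 0" using sin by (simp add: d)
  define p0 where "p0 = - (a + b * c) / (1 - c\<^sup>2)"
  define q0 where "q0 = - (b + a * c) / (1 - c\<^sup>2)"
  have pq0: "a + p0 - c * q0 = 0" "b - c * p0 + q0 = 0"
    unfolding p0_def q0_def using d0 by (simp_all add: field_simps power2_eq_square)
  define z where "z = (\<lambda>j::nat. (- p0 / sin \<theta>) * sin (real j * \<theta>)
    + (q0 / sin \<theta>) * sin (real j * \<theta> - \<theta>))"
  have zrec: "z (Suc (Suc j)) = 2 * c * z (Suc j) - z j" for j
  proof -
    have "sin (y + \<theta>) = 2 * c * sin y - sin (y - \<theta>)" for y
      by (simp add: sin_add sin_diff c_def)
    from this[of "real (Suc j) * \<theta>"] this[of "real (Suc j) * \<theta> - \<theta>"]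
    have e: "sin (real (Suc (Suc j)) * \<theta>) = 2 * c * sin (real (Suc j) * \<theta>) - sin (real j * \<theta>)"
      "sin (real (Suc (Suc j)) * \<theta> - \<theta>)
        = 2 * c * sin (real (Suc j) * \<theta> - \<theta>) - sin (real j * \<theta> - \<theta>)"
      by (simp_all add: algebra_simps)
    have "h * (2 * c * A1 - A0) + g * (2 * c * B1 - B0)
        = 2 * c * (h * A1 + g * B1) - (h * A0 + g * B0)" for h g A0 A1 B0 B1 :: real
      by (simp add: algebra_simps)
    then show ?thesis unfolding z_def e .
  qed
  have z0: "z 0 = - q0" "z 1 = - p0" using sin by (simp_all add: z_def)
  have iter: "((\<lambda>x. cox_refl X m s (cox_refl X m t x)) ^^ j) x
      = v (p0 + z (2 * j + 1)) (q0 + z (2 * j))" for j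
  proof (induction j)
    case 0
    show ?case using z0 by (simp add: v_def)
  next
    case (Suc j)
    let ?P = "z (2 * j + 1)" and ?Q = "z (2 * j)"
    have z2: "z (2 * Suc j) = 2 * c * ?P - ?Q" using zrec[of "2 * j"] by simp
    have z3: "z (2 * Suc j + 1) = 2 * c * z (2 * Suc j) - ?P" using zrec[of "2 * j + 1"] by simp
    have t: "q0 + ?Q - 2 * (b - c * (p0 + ?P) + (q0 + ?Q)) = q0 + z (2 * Suc j)"
      using pq0(2) unfolding z2 by (simp add: algebra_simps)
    have s: "p0 + ?P - 2 * (a + (p0 + ?P) - c * (q0 + z (2 * Suc j))) = p0 + z (2 * Suc j + 1)"
      using pq0(1) unfolding z3 by (simp add: algebra_simps)
    show ?case by (simp only: funpow.simps comp_apply Suc.IH Rt t Rs s)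
  qed
  have per: "real (2 * k) * \<theta> = 2 * pi" using \<theta>(3) by simp
  have "z (2 * k) = - q0"
    using sin unfolding z_def per by (simp add: sin_diff)
  moreover have "real (2 * k + 1) * \<theta> = \<theta> + 2 * pi" using per by (simp add: algebra_simps)
  then have "z (2 * k + 1) = - p0"
    using sin unfolding z_def by simp
  ultimately show ?thesis by (simp add: iter v_def)
qed

lemma word_act_append: "word_act X m (u @ v) x = word_act X m u (word_act X m v x)"
  by (simp add: word_act_def)

lemma word_act_cong:
  assumes fin: "finite X" and cox: "coxeter_matrix X m"
    and "pres_eq X (coxeter_rels X m) u v"
  shows "word_act X m u = word_act X m v"
  using assms(3)
proof induction
  case (pres_append u u' v v')
  then show ?case by (intro ext) (simp add: word_act_append)
next
  case (pres_cancel s b)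
  then show ?case by (auto simp: word_act_def fun_eq_iff cox_refl_refl[OF fin cox])
next
  case (pres_rel u v)
  from pres_rel(1) consider s where "s \<in> X" "u = [(s, True), (s, True)]" "v = []"
    | s t k where "s \<in> X" "t \<in> X" "s \<noteq> t" "m s t = enat k"
        "u = concat (replicate k [(s, True), (t, True)])" "v = []"
    unfolding coxeter_rels_def by blast
  then show ?case
  proof cases
    case 1
    then show ?thesis by (auto simp: word_act_def fun_eq_iff cox_refl_refl[OF fin cox])
  next
    case 2
    have "word_act X m (concat (replicate j [(s, True), (t, True)])) x
        = ((\<lambda>x. cox_refl X m s (cox_refl X m t x)) ^^ j) x" for j x
      by (induction j) (auto simp: word_act_def)
    with cox_refl_braid[OF fin cox 2(1-4)] show ?thesis
      by (simp add: 2 fun_eq_iff) (simp add: word_act_def)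
  qed
qed auto

lemma cox_act_eq_word_act:
  assumes "finite X" "coxeter_matrix X m" "w \<in> carrier (coxeter_group X m)" "u \<in> w"
  shows "cox_act X m w = word_act X m u"
proof -
  have "w \<in> gwords X // pres_rel_of X (coxeter_rels X m)"
    using assms(3) by (simp add: coxeter_group_def presented_group_def)
  then have "(u, v) \<in> pres_rel_of X (coxeter_rels X m)" if "v \<in> w" for v
    using quotient_eq_iff[OF equiv_pres_rel_of _ _ assms(4) that] by blast
  then have "pres_eq X (coxeter_rels X m) u v" if "v \<in> w" for v
    using that by (simp add: pres_rel_of_def)
  then have "word_act X m v = word_act X m u" if "v \<in> w" for v
    using word_act_cong[OF assms(1,2), of u v] that by simp
  then have "word_act X m ` w = (\<lambda>_. word_act X m u) ` w" by (rule image_cong[OF refl])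
  also have "\<dots> = {word_act X m u}" using assms(4) by (rule image_constant)
  finally have "word_act X m ` w = {word_act X m u}" .
  then show ?thesis by (simp add: cox_act_def)
qed

text \<open>A linear functional \<open>f\<close> on the span of the \<open>e\<^sub>s\<close> is given by its values \<open>f s\<close> at \<open>e\<^sub>s\<close>,
  \<open>s \<in> X\<close>. In this way the dual space \<open>V\<close> is the topological product of copies of the real
  line indexed by \<open>X\<close> (its points are extensional functions on \<open>X\<close>).\<close>

definition dual_space :: "'s set \<Rightarrow> ('s \<Rightarrow> real) topology"
  where "dual_space X = powertop_real X"

definition dual_pairing :: "'s set \<Rightarrow> ('s \<Rightarrow> real) \<Rightarrow> ('s \<Rightarrow> real) \<Rightarrow> real"
  where "dual_pairing X f x = (\<Sum>s\<in>X. f s * x s)"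

definition dual_act ::
    "'s set \<Rightarrow> ('s \<Rightarrow> 's \<Rightarrow> enat) \<Rightarrow> 's gword set \<Rightarrow> ('s \<Rightarrow> real) \<Rightarrow> ('s \<Rightarrow> real)"
  where "dual_act X m w f =
    (\<lambda>s\<in>X. dual_pairing X f (cox_act X m (inv\<^bsub>coxeter_group X m\<^esub> w) (simple_root s)))"

definition fundamental_chamber :: "'s set \<Rightarrow> ('s \<Rightarrow> real) set"
  where "fundamental_chamber X =
    {f \<in> topspace (dual_space X). \<forall>s\<in>X. 0 \<le> dual_pairing X f (simple_root s)}"

definition tits_cone :: "'s set \<Rightarrow> ('s \<Rightarrow> 's \<Rightarrow> enat) \<Rightarrow> ('s \<Rightarrow> real) set"
  where "tits_cone X m =
    (dual_space X) interior_of
      (\<Union>w\<in>carrier (coxeter_group X m). dual_act X m w ` fundamental_chamber X)"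

definition cox_reflections :: "'s set \<Rightarrow> ('s \<Rightarrow> 's \<Rightarrow> enat) \<Rightarrow> 's gword set set"
  where "cox_reflections X m =
    {w \<otimes>\<^bsub>coxeter_group X m\<^esub> coxeter_gen X m s \<otimes>\<^bsub>coxeter_group X m\<^esub> inv\<^bsub>coxeter_group X m\<^esub> w | s w.
       s \<in> X \<and> w \<in> carrier (coxeter_group X m)}"

definition fixed_hyperplane ::
    "'s set \<Rightarrow> ('s \<Rightarrow> 's \<Rightarrow> enat) \<Rightarrow> 's gword set \<Rightarrow> ('s \<Rightarrow> real) set"
  where "fixed_hyperplane X m r = {f \<in> topspace (dual_space X). dual_act X m r f = f}"

definition complement_space ::
    "'s set \<Rightarrow> ('s \<Rightarrow> 's \<Rightarrow> enat) \<Rightarrow> (('s \<Rightarrow> real) \<times> ('s \<Rightarrow> real)) topology"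
  where "complement_space X m =
    subtopology (prod_topology (dual_space X) (dual_space X))
      (tits_cone X m \<times> topspace (dual_space X) -
        (\<Union>r\<in>cox_reflections X m. fixed_hyperplane X m r \<times> fixed_hyperplane X m r))"


section \<open>Eilenberg--MacLane spaces\<close>

definition sphere_base :: "nat \<Rightarrow> real"
  where "sphere_base = (\<lambda>i. if i = 0 then 1 else 0)"

text \<open>The underlying set of the homotopy group \<open>\<pi>\<^sub>n(Y, y)\<close>: pointed maps from the sphere of
  dimension \<open>n\<close> to \<open>Y\<close>, up to pointed homotopy.\<close>

definition pointed_sphere_maps :: "nat \<Rightarrow> 'a topology \<Rightarrow> 'a \<Rightarrow> ((nat \<Rightarrow> real) \<Rightarrow> 'a) set"
  where "pointed_sphere_maps n Y y = {f. continuous_map (nsphere n) Y f \<and> f sphere_base = y}"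

definition homotopy_set :: "nat \<Rightarrow> 'a topology \<Rightarrow> 'a \<Rightarrow> ((nat \<Rightarrow> real) \<Rightarrow> 'a) set set"
  where "homotopy_set n Y y =
    pointed_sphere_maps n Y y //
      {(f, g). homotopic_with (\<lambda>h. h sphere_base = y) (nsphere n) Y f g}"

text \<open>\<open>Y\<close> is a \<open>K(\<pi>\<^sub>1(Y), 1)\<close>: it is path-connected and its higher homotopy groups are
  trivial. There is no condition on \<open>\<pi>\<^sub>1\<close>, as the group is \<open>\<pi>\<^sub>1(Y)\<close> itself.\<close>

definition Eilenberg_MacLane_K1 :: "'a topology \<Rightarrow> bool"
  where "Eilenberg_MacLane_K1 Y \<longleftrightarrow>
    topspace Y \<noteq> {} \<and> path_connected_space Y \<and>
    (\<forall>n\<ge>2. \<forall>y\<in>topspace Y. is_singleton (homotopy_set n Y y))"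

definition type_K_pi_1 :: "'s set \<Rightarrow> ('s \<Rightarrow> 's \<Rightarrow> enat) \<Rightarrow> bool"
  where "type_K_pi_1 X m \<longleftrightarrow> Eilenberg_MacLane_K1 (complement_space X m)"


section \<open>Decidability and the word problem\<close>

text \<open>Total (general) recursive functions of \<open>n\<close> arguments, the arguments being passed as a
  list of length \<open>n\<close>; values on lists of other lengths are irrelevant. Minimization is
  restricted to functions for which the search always succeeds.\<close>

inductive recursive :: "nat \<Rightarrow> (nat list \<Rightarrow> nat) \<Rightarrow> bool"
where
  rec_zero: "recursive n (\<lambda>xs. 0)"
| rec_Suc: "recursive 1 (\<lambda>xs. Suc (xs ! 0))"
| rec_proj: "i < n \<Longrightarrow> recursive n (\<lambda>xs. xs ! i)"
| rec_comp: "recursive (length gs) f \<Longrightarrow> \<forall>g\<in>set gs. recursive n g \<Longrightarrow>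
    recursive n (\<lambda>xs. f (map (\<lambda>g. g xs) gs))"
| rec_primrec: "recursive n g \<Longrightarrow> recursive (Suc (Suc n)) h \<Longrightarrow>
    recursive (Suc n) (\<lambda>xs. rec_nat (g (tl xs)) (\<lambda>k r. h (k # r # tl xs)) (hd xs))"
| rec_minimize: "recursive (Suc n) f \<Longrightarrow> \<forall>xs. length xs = n \<longrightarrow> (\<exists>y. f (y # xs) = 0) \<Longrightarrow>
    recursive n (\<lambda>xs. LEAST y. f (y # xs) = 0)"

text \<open>Words over a finite alphabet are coded by numbers, through some numbering \<open>c\<close> of the
  letters; as the alphabet is finite, the choice of \<open>c\<close> is irrelevant.\<close>

definition decidable_language :: "'l set \<Rightarrow> 'l list set \<Rightarrow> bool"
  where "decidable_language A L \<longleftrightarrow>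
    (\<exists>c f. inj_on c A \<and> recursive 1 f \<and>
      (\<forall>w\<in>lists A. f [list_encode (map c w)] = (if w \<in> L then 1 else 0)))"

definition word_value :: "('g, 'b) monoid_scheme \<Rightarrow> 'g gword \<Rightarrow> 'g"
  where "word_value G w =
    foldr (\<lambda>(x, b) g. (if b then x else inv\<^bsub>G\<^esub> x) \<otimes>\<^bsub>G\<^esub> g) w \<one>\<^bsub>G\<^esub>"

definition solvable_word_problem :: "('g, 'b) monoid_scheme \<Rightarrow> 'g set \<Rightarrow> bool"
  where "solvable_word_problem G T \<longleftrightarrow>
    finite T \<and> T \<subseteq> carrier G \<and> generate G T = carrier G \<and>
    decidable_language (T \<times> UNIV) {w \<in> gwords T. word_value G w = \<one>\<^bsub>G\<^esub>}"

end

theory Submission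
  imports Defs
begin

text \<open>If all \<open>m s t\<close> with \<open>s, t \<in> X\<close> are finite, the word problem for \<open>A\<^sub>X\<close> is solvable by
  hypothesis. If \<open>m a b = \<infinity>\<close> for some \<open>a, b \<in> X\<close>, then \<open>A\<^sub>X\<close> is the amalgamated product of
  \<open>A\<^sub>X\<^sub>-\<^sub>b\<close> and \<open>A\<^sub>X\<^sub>-\<^sub>a\<close> over \<open>A\<^sub>Y\<close>, \<open>Y = X - {a, b}\<close>, and by induction on the size of \<open>X\<close>
  the word problem is solvable in both factors. What is needed in addition to compute normal forms
  in the amalgam is a computable choice of representatives of the cosets of \<open>A\<^sub>Y\<close>. It comes from a
  set-theoretic retraction \<open>\<pi>\<close> of \<open>A\<close> onto \<open>A\<^sub>Y\<close> satisfying \<open>\<pi>(y g) = y \<pi>(g)\<close> for \<open>y \<in> A\<^sub>Y\<close>: the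
  coset of \<open>g\<close> is represented by \<open>\<pi>(g)\<^sup>-\<^sup>1 g\<close>.

  The retraction is computed by a machine reading a word letter by letter. In the geometric
  representation of the Coxeter group, the machine keeps the vectors \<open>w\<^sup>-\<^sup>1 e\<^sub>y\<close>, \<open>y \<in> Y\<close>, where \<open>w\<close>
  is the shortest element of a coset of \<open>W\<^sub>Y\<close>, so that these vectors are positive roots. On a letter
  \<open>s\<close> it outputs \<open>y\<close> if one of the vectors \<open>w\<^sup>-\<^sup>1 e\<^sub>y\<close> equals \<open>e\<^sub>s\<close>, and otherwise it applies the
  reflection \<open>s\<close> to all vectors. Since every root is positive or negative, the output respects the
  braid relations. The existence of \<open>\<pi>\<close> also shows that \<open>A\<^sub>Y\<close> is presented by the relations
  among the generators in \<open>Y\<close>.\<close>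

section \<open>Computable functions on coded data\<close>

text \<open>Left equivariance of \<open>\<pi>\<close> serves twice. It makes the representative
  constant on a coset of \<open>A\<^sub>Y\<close>, and it reduces membership in
  \<open>A\<^sub>Y\<close> to a word problem: g lies in \<open>A\<^sub>Y\<close> exactly when its
  representative is trivial, which the factor containing g can decide. Words are compared throughout
  by equality in the one group A (\<open>eqv\<close>). Normal forms are unique only up to equality
  in A of their components, which suffices because only triviality is tested. The hypothesis, which
  concerns subgroups of A, thus applies directly. The presentation of \<open>A\<^sub>X\<close> by
  its own relations enters where the action on normal forms must respect equality: each of these
  relations lies in a single factor, since m a b is infinite. The tests of the machine compare real
  vectors exactly. No arithmetic of algebraic numbers is set up for this: the rational linear
  relations among finitely many fixed reals are cut out by finitely many integer equations. These
  may be built into the program, since only the existence of a program is claimed.\<close>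

definition rec1 :: "(nat \<Rightarrow> nat) \<Rightarrow> bool"
  where "rec1 F \<longleftrightarrow> recursive 1 (\<lambda>xs. F (xs ! 0))"

definition rec2 :: "(nat \<Rightarrow> nat \<Rightarrow> nat) \<Rightarrow> bool"
  where "rec2 F \<longleftrightarrow> recursive 2 (\<lambda>xs. F (xs ! 0) (xs ! 1))"

lemma recursive_rec1:
  assumes "rec1 F" "recursive n g"
  shows "recursive n (\<lambda>xs. F (g xs))"
  using rec_comp[of "[g]" "\<lambda>xs. F (xs ! 0)" n] assms by (simp add: rec1_def)

lemma recursive_rec2:
  assumes "rec2 F" "recursive n g" "recursive n h"
  shows "recursive n (\<lambda>xs. F (g xs) (h xs))"
  using rec_comp[of "[g, h]" "\<lambda>xs. F (xs ! 0) (xs ! 1)" n] assms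
  by (simp add: rec2_def numeral_2_eq_2)

lemma rec1_recursive: "recursive 1 f \<Longrightarrow> rec1 (\<lambda>n. f [n])"
  using rec_comp[of "[\<lambda>xs. xs ! 0]" f 1] by (simp add: rec1_def rec_proj)

lemma rec1_comp: "rec1 F \<Longrightarrow> rec1 G \<Longrightarrow> rec1 (\<lambda>n. F (G n))"
  using recursive_rec1 by (simp add: rec1_def)

lemma rec1_rec2: "rec2 F \<Longrightarrow> rec1 G \<Longrightarrow> rec1 H \<Longrightarrow> rec1 (\<lambda>n. F (G n) (H n))"
  using recursive_rec2 by (simp add: rec1_def)

lemma rec1_id: "rec1 (\<lambda>n. n)"
  unfolding rec1_def by (rule rec_proj) simp

lemma rec1_Suc: "rec1 Suc"
  unfolding rec1_def by (rule rec_Suc)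

lemma rec1_const: "rec1 (\<lambda>_. k)"
proof (induction k)
  case 0 show ?case unfolding rec1_def by (rule rec_zero)
next
  case (Suc k) show ?case using rec1_comp[OF rec1_Suc Suc] .
qed

lemma rec2_swap: "rec2 F \<Longrightarrow> rec2 (\<lambda>x y. F y x)"
  using recursive_rec2[of F 2 "\<lambda>xs. xs ! 1" "\<lambda>xs. xs ! 0"] by (simp add: rec2_def rec_proj)

lemma rec2_rec_nat:
  assumes "rec1 b" "recursive 3 (\<lambda>xs. h (xs ! 0) (xs ! 1) (xs ! 2))"
  shows "rec2 (\<lambda>k x. rec_nat (b x) (\<lambda>k r. h k r x) k)"
proof -
  let ?f = "\<lambda>xs. rec_nat (b (tl xs ! 0))
      (\<lambda>k r. h ((k # r # tl xs) ! 0) ((k # r # tl xs) ! 1) ((k # r # tl xs) ! 2)) (hd xs)"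
  have "recursive (Suc 1) ?f"
    using rec_primrec[OF assms(1)[unfolded rec1_def], of "\<lambda>xs. h (xs ! 0) (xs ! 1) (xs ! 2)"] assms(2)
    by (simp add: numeral_3_eq_3)
  then have "recursive (length [\<lambda>xs. xs ! 0, \<lambda>xs. xs ! 1]) ?f" by simp
  from rec_comp[OF this, of 2] show ?thesis by (simp add: rec2_def rec_proj)
qed

lemma rec2_funpow:
  assumes "rec1 F"
  shows "rec2 (\<lambda>k x. (F ^^ k) x)"
proof -
  have *: "(F ^^ k) x = rec_nat x (\<lambda>k r. F r) k" for k x
    by (induction k) auto
  show ?thesis
    unfolding * by (intro rec2_rec_nat recursive_rec1[OF assms] rec1_id rec_proj) simp
qed

lemma rec1_funpow:
  "rec1 F \<Longrightarrow> rec1 cnt \<Longrightarrow> rec1 init \<Longrightarrow> rec1 (\<lambda>n. (F ^^ cnt n) (init n))"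
  by (rule rec1_rec2[OF rec2_funpow])

lemma rec2_add: "rec2 (+)"
proof -
  have *: "(Suc ^^ k) x = k + x" for k x by (induction k) auto
  show ?thesis using rec2_funpow[OF rec1_Suc] unfolding * .
qed

lemma rec1_pred: "rec1 (\<lambda>n. n - 1)"
proof -
  have *: "rec_nat 0 (\<lambda>k r. k) n = n - 1" for n :: nat by (cases n) auto
  have "rec2 (\<lambda>k x. rec_nat 0 (\<lambda>k r. k) k)"
    by (intro rec2_rec_nat rec1_const rec_proj) simp
  from rec1_rec2[OF this rec1_id rec1_id] show ?thesis unfolding * .
qed

lemma rec2_diff: "rec2 (-)"
proof -
  have *: "((\<lambda>n. n - 1) ^^ k) x = x - k" for k x :: nat by (induction k) auto
  show ?thesis using rec2_swap[OF rec2_funpow[OF rec1_pred]] unfolding * .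
qed

lemma rec1_triangle: "rec1 triangle"
proof -
  have *: "rec_nat 0 (\<lambda>k r. Suc r + k) n = triangle n" for n by (induction n) auto
  have "rec2 (\<lambda>k x. rec_nat 0 (\<lambda>k r. Suc r + k) k)"
  proof (rule rec2_rec_nat[OF rec1_const])
    show "recursive 3 (\<lambda>xs. Suc (xs ! 1) + xs ! 0)"
      by (rule recursive_rec2[OF rec2_add recursive_rec1[OF rec1_Suc rec_proj] rec_proj]) simp_all
  qed
  from rec1_rec2[OF this rec1_id rec1_id] show ?thesis by (simp only: *)
qed

lemma rec1_prod_encode:
  assumes "rec1 F" "rec1 G"
  shows "rec1 (\<lambda>n. prod_encode (F n, G n))"
  using assms unfolding prod_encode_def prod.case
  by (intro rec1_rec2[OF rec2_add] rec1_comp[OF rec1_triangle])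

text \<open>The diagonal x + y of the pair coded by n is the least d with n <
  \<open>triangle (Suc d)\<close>. Minimization may find it because \<open>triangle\<close> grows at
  least linearly; both components then follow by subtraction.\<close>

lemma
  shows rec1_fst: "rec1 (\<lambda>n. fst (prod_decode n))"
    and rec1_snd: "rec1 (\<lambda>n. snd (prod_decode n))"
proof -
  define diag where "diag n = (LEAST d. Suc n - triangle (Suc d) = 0)" for n
  have "n \<le> triangle n" for n by (induction n) auto
  from this[of "Suc n" for n] have ex: "\<exists>d. Suc n - triangle (Suc d) = 0" for n
    by (metis diff_is_0_eq)
  have "recursive (Suc 1) (\<lambda>xs. Suc (xs ! 1) - triangle (Suc (xs ! 0)))"
    by (intro recursive_rec2[OF rec2_diff] recursive_rec1[OF rec1_triangle]
        recursive_rec1[OF rec1_Suc] rec_proj) auto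
  from rec_minimize[OF this] ex have diag: "rec1 diag"
    by (simp add: rec1_def diag_def[abs_def])
  have sum: "fst (prod_decode n) + snd (prod_decode n) = diag n" (is ?A)
    and fst: "fst (prod_decode n) = n - triangle (diag n)" (is ?B) for n
  proof -
    obtain x y where xy: "prod_decode n = (x, y)" by force
    then have n: "n = triangle (x + y) + x"
      using prod_decode_inverse[of n] by (simp add: prod_encode_def)
    have mono: "triangle i \<le> triangle j" if "i \<le> j" for i j
      using that by (induction rule: dec_induct) auto
    have d: "diag n = x + y"
      unfolding diag_def
    proof (rule Least_equality)
      show "Suc n - triangle (Suc (x + y)) = 0" by (simp add: n)
      fix d assume d: "Suc n - triangle (Suc d) = 0"
      show "x + y \<le> d"
        using mono[of "Suc d" "x + y"] d n by (cases "x + y \<le> d") auto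
    qed
    show ?A ?B unfolding d xy fst_conv snd_conv using n by linarith+
  qed
  show f: "rec1 (\<lambda>n. fst (prod_decode n))"
    unfolding fst by (intro rec1_rec2[OF rec2_diff] rec1_id rec1_comp[OF rec1_triangle] diag)
  have "snd (prod_decode n) = diag n - fst (prod_decode n)" for n
    using sum[of n] by simp
  then show "rec1 (\<lambda>n. snd (prod_decode n))"
    using rec1_rec2[OF rec2_diff diag f] by (simp only:)
qed

text \<open>The step sends a pair (x, y) to (y, y). Iterating it c n times keeps the first component
  if c n = 0 and replaces it by the second otherwise.\<close>

lemma rec1_if:
  assumes "rec1 c" "rec1 F" "rec1 G"
  shows "rec1 (\<lambda>n. if c n = 0 then F n else G n)"
proof -
  let ?step = "\<lambda>p. prod_encode (snd (prod_decode p), snd (prod_decode p))"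
  have step: "(?step ^^ k) (prod_encode (x, y)) = (if k = 0 then prod_encode (x, y) else prod_encode (y, y))"
    for k x y by (induction k) auto
  have "rec1 (\<lambda>n. fst (prod_decode ((?step ^^ c n) (prod_encode (F n, G n)))))"
    by (intro rec1_comp[OF rec1_fst] rec1_funpow rec1_prod_encode rec1_snd assms)
  moreover have "fst (prod_decode ((?step ^^ c n) (prod_encode (F n, G n)))) = (if c n = 0 then F n else G n)" for n
    by (simp only: step) simp
  ultimately show ?thesis by simp
qed


section \<open>Computability relative to codings\<close>

type_synonym 'a coding = "nat \<Rightarrow> 'a \<Rightarrow> bool"

text \<open>A coding relates numbers to the elements they represent; elements without a code are
  irrelevant to computability, so domain restrictions are carried by the coding.\<close>

definition computable :: "'a coding \<Rightarrow> 'b coding \<Rightarrow> ('a \<Rightarrow> 'b) \<Rightarrow> bool"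
  where "computable A B f \<longleftrightarrow> (\<exists>F. rec1 F \<and> (\<forall>n x. A n x \<longrightarrow> B (F n) (f x)))"

definition pair_code :: "'a coding \<Rightarrow> 'b coding \<Rightarrow> ('a \<times> 'b) coding"  (infixr "\<otimes>\<^sub>c" 80)
  where "pair_code A B n p \<longleftrightarrow> (\<exists>i j. n = prod_encode (i, j) \<and> A i (fst p) \<and> B j (snd p))"

definition list_code :: "'a coding \<Rightarrow> 'a list coding"
  where "list_code A n xs \<longleftrightarrow> (\<exists>ns. n = list_encode ns \<and> list_all2 A ns xs)"

definition bool_code :: "bool coding"
  where "bool_code n b \<longleftrightarrow> n = (if b then 1 else 0)"

definition nat_code :: "nat coding"
  where "nat_code n k \<longleftrightarrow> n = k"

definition fin_code :: "('a \<Rightarrow> nat) \<Rightarrow> 'a set \<Rightarrow> 'a coding"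
  where "fin_code c D n x \<longleftrightarrow> x \<in> D \<and> n = c x"

lemma computable_comp:
  assumes "computable B C g" "computable A B f"
  shows "computable A C (\<lambda>x. g (f x))"
proof -
  obtain F G where "rec1 F" "rec1 G" "\<forall>n x. A n x \<longrightarrow> B (F n) (f x)" "\<forall>n x. B n x \<longrightarrow> C (G n) (g x)"
    using assms by (auto simp: computable_def)
  then show ?thesis
    unfolding computable_def by (intro exI[of _ "\<lambda>n. G (F n)"]) (auto intro: rec1_comp)
qed

lemma computable_cong:
  assumes "computable A B f" "\<And>n x. A n x \<Longrightarrow> f x = g x"
  shows "computable A B g"
  using assms unfolding computable_def by metis

lemma computable_id: "computable A A (\<lambda>x. x)"
  unfolding computable_def using rec1_id by blast

lemma computable_const: "B n y \<Longrightarrow> computable A B (\<lambda>_. y)"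
  unfolding computable_def using rec1_const by blast

lemma computable_pair:
  assumes "computable A B f" "computable A C g"
  shows "computable A (B \<otimes>\<^sub>c C) (\<lambda>x. (f x, g x))"
proof -
  obtain F G where "rec1 F" "rec1 G" "\<forall>n x. A n x \<longrightarrow> B (F n) (f x)" "\<forall>n x. A n x \<longrightarrow> C (G n) (g x)"
    using assms by (auto simp: computable_def)
  then show ?thesis
    unfolding computable_def pair_code_def
    by (intro exI[of _ "\<lambda>n. prod_encode (F n, G n)"]) (auto intro: rec1_prod_encode)
qed

lemma computable_fst: "computable A (B \<otimes>\<^sub>c C) f \<Longrightarrow> computable A B (\<lambda>x. fst (f x))"
  by (rule computable_comp) (auto simp: computable_def pair_code_def intro!: exI[of _ "\<lambda>n. fst (prod_decode n)"] rec1_fst)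

lemma computable_snd: "computable A (B \<otimes>\<^sub>c C) f \<Longrightarrow> computable A C (\<lambda>x. snd (f x))"
  by (rule computable_comp) (auto simp: computable_def pair_code_def intro!: exI[of _ "\<lambda>n. snd (prod_decode n)"] rec1_snd)

lemma computable_If:
  assumes "computable A bool_code p" "computable A B f" "computable A B g"
  shows "computable A B (\<lambda>x. if p x then f x else g x)"
proof -
  obtain P F G where "rec1 P" "rec1 F" "rec1 G" "\<forall>n x. A n x \<longrightarrow> bool_code (P n) (p x)"
     "\<forall>n x. A n x \<longrightarrow> B (F n) (f x)" "\<forall>n x. A n x \<longrightarrow> B (G n) (g x)"
    using assms by (auto simp: computable_def)
  then show ?thesis
    unfolding computable_def bool_code_def
    by (intro exI[of _ "\<lambda>n. if P n = 0 then G n else F n"]) (auto intro: rec1_if)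
qed

lemma computable_True: "computable A bool_code (\<lambda>_. True)"
  and computable_False: "computable A bool_code (\<lambda>_. False)"
  by (auto intro!: computable_const simp: bool_code_def)

lemma computable_conj:
  assumes "computable A bool_code p" "computable A bool_code q"
  shows "computable A bool_code (\<lambda>x. p x \<and> q x)"
  by (rule computable_cong[OF computable_If[OF assms computable_False]]) simp

lemma computable_nat_eq:
  assumes "computable A nat_code f" "computable A nat_code g"
  shows "computable A bool_code (\<lambda>x. f x = g x)"
proof -
  obtain F G where "rec1 F" "rec1 G" "\<forall>n x. A n x \<longrightarrow> F n = f x" "\<forall>n x. A n x \<longrightarrow> G n = g x"
    using assms by (auto simp: computable_def nat_code_def)
  moreover from this have "rec1 (\<lambda>n. if (F n - G n) + (G n - F n) = 0 then 1 else 0)"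
    by (intro rec1_if rec1_rec2[OF rec2_add] rec1_rec2[OF rec2_diff] rec1_const)
  ultimately show ?thesis
    unfolding computable_def bool_code_def by fastforce
qed

lemma computable_add:
  assumes "computable A nat_code f" "computable A nat_code g"
  shows "computable A nat_code (\<lambda>x. f x + g x)"
proof -
  obtain F G where "rec1 F" "rec1 G" "\<forall>n x. A n x \<longrightarrow> F n = f x" "\<forall>n x. A n x \<longrightarrow> G n = g x"
    using assms by (auto simp: computable_def nat_code_def)
  then show ?thesis
    unfolding computable_def nat_code_def
    by (intro exI[of _ "\<lambda>n. F n + G n"]) (auto intro: rec1_rec2[OF rec2_add])
qed

lemma computable_nat_const: "computable A nat_code (\<lambda>_. k)"
  by (rule computable_const) (simp add: nat_code_def)

lemma computable_sum:
  "(\<And>i. i \<in> I \<Longrightarrow> computable A nat_code (f i)) \<Longrightarrow> computable A nat_code (\<lambda>x. \<Sum>i\<in>I. f i x)"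
  by (induction I rule: infinite_finite_induct) (auto intro: computable_add computable_nat_const)

lemma computable_mult_const:
  assumes "computable A nat_code f" shows "computable A nat_code (\<lambda>x. k * f x)"
  by (induction k) (auto intro: computable_add computable_nat_const assms)

lemma computable_Ball:
  assumes "finite I" "\<And>i. i \<in> I \<Longrightarrow> computable A bool_code (p i)"
  shows "computable A bool_code (\<lambda>x. \<forall>i\<in>I. p i x)"
  using assms by (induction I rule: finite_induct) (auto intro: computable_conj computable_True)

text \<open>The programs for the finitely many a are spliced together by testing the code against
  each \<open>c a\<close> in turn. They may be unrelated to each other: nothing uniform in a is
  asked of f.\<close>

lemma computable_finite_case:
  assumes "finite D" "inj_on c D" "\<And>a. a \<in> D \<Longrightarrow> computable E B (f a)"
  shows "computable (fin_code c D \<otimes>\<^sub>c E) B (\<lambda>p. f (fst p) (snd p))"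
proof -
  have "\<exists>F. rec1 F \<and> (\<forall>a\<in>D'. \<forall>n x. E n x \<longrightarrow> B (F (prod_encode (c a, n))) (f a x))" if "D' \<subseteq> D" for D'
    using finite_subset[OF that assms(1)] that
  proof (induction D' rule: finite_induct)
    case empty
    then show ?case using rec1_id by blast
  next
    case (insert a D')
    then obtain F where F: "rec1 F" "\<forall>a\<in>D'. \<forall>n x. E n x \<longrightarrow> B (F (prod_encode (c a, n))) (f a x)"
      by auto
    obtain G where G: "rec1 G" "\<forall>n x. E n x \<longrightarrow> B (G n) (f a x)"
      using assms(3)[of a] insert by (auto simp: computable_def)
    let ?t = "\<lambda>n. (fst (prod_decode n) - c a) + (c a - fst (prod_decode n))"
    have "rec1 (\<lambda>n. if ?t n = 0 then G (snd (prod_decode n)) else F n)"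
      by (intro rec1_if rec1_rec2[OF rec2_add] rec1_rec2[OF rec2_diff] rec1_fst rec1_const
          rec1_comp[OF G(1) rec1_snd] F(1))
    moreover have "c b \<noteq> c a" if "b \<in> D'" for b
      using inj_onD[OF assms(2), of b a] insert that by auto
    ultimately show ?case
      using F(2) G(2) by (intro exI[of _ "\<lambda>n. if ?t n = 0 then G (snd (prod_decode n)) else F n"]) auto
  qed
  from this[OF subset_refl] show ?thesis
    unfolding computable_def pair_code_def fin_code_def by fastforce
qed

lemma computable_fin_code:
  assumes "finite D" "inj_on c D" "\<And>a. a \<in> D \<Longrightarrow> \<exists>n. B n (f a)"
  shows "computable (fin_code c D) B f"
proof -
  have "computable (fin_code c D) B (\<lambda>x. f (fst (x, x)))"
    by (rule computable_comp[OF computable_finite_case[where f = "\<lambda>a _. f a"] computable_pair])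
      (use assms in \<open>auto intro: computable_id computable_const\<close>)
  then show ?thesis by simp
qed

section \<open>Lists and iteration over lists\<close>

lemma computable_Nil: "computable E (list_code A) (\<lambda>_. [])"
  by (rule computable_const[of _ 0]) (simp add: list_code_def)

lemma computable_Cons:
  assumes "computable E A f" "computable E (list_code A) g"
  shows "computable E (list_code A) (\<lambda>x. f x # g x)"
proof -
  obtain F G where FG: "rec1 F" "rec1 G" "\<And>n x. E n x \<Longrightarrow> A (F n) (f x)"
      "\<And>n x. E n x \<Longrightarrow> list_code A (G n) (g x)"
    using assms by (auto simp: computable_def)
  have "rec1 (\<lambda>n. Suc (prod_encode (F n, G n)))"
    by (intro rec1_comp[OF rec1_Suc] rec1_prod_encode FG)
  moreover have "list_code A (Suc (prod_encode (F n, G n))) (f x # g x)" if "E n x" for n x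
    using FG(4)[OF that] FG(3)[OF that] unfolding list_code_def
    by (metis list_all2_Cons list_encode.simps(2))
  ultimately show ?thesis unfolding computable_def by blast
qed

text \<open>\<open>list_encode\<close> maps the empty list to 0 and any other list to the successor
  of a pair, so a zero test and a predecessor take a list apart.\<close>

lemma computable_case_list:
  assumes l: "computable E (list_code A) l" and f: "computable E B f"
    and g: "computable (E \<otimes>\<^sub>c (A \<otimes>\<^sub>c list_code A)) B (\<lambda>p. g (fst p) (fst (snd p)) (snd (snd p)))"
  shows "computable E B (\<lambda>x. case l x of [] \<Rightarrow> f x | y # ys \<Rightarrow> g x y ys)"
proof -
  obtain L F G where L: "rec1 L" "\<And>n x. E n x \<Longrightarrow> list_code A (L n) (l x)"
    and F: "rec1 F" "\<And>n x. E n x \<Longrightarrow> B (F n) (f x)"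
    and G: "rec1 G" "\<And>n x. (E \<otimes>\<^sub>c (A \<otimes>\<^sub>c list_code A)) n x \<Longrightarrow> B (G n) (g (fst x) (fst (snd x)) (snd (snd x)))"
    using l f g unfolding computable_def by metis
  let ?H = "\<lambda>n. if L n = 0 then F n else G (prod_encode (n, L n - 1))"
  have "rec1 ?H"
    by (intro rec1_if L F rec1_comp[OF G(1)] rec1_prod_encode rec1_id rec1_comp[OF rec1_pred])
  moreover have "B (?H n) (case l x of [] \<Rightarrow> f x | y # ys \<Rightarrow> g x y ys)" if E: "E n x" for n x
  proof (cases "l x")
    case Nil
    then have "L n = 0" using L(2)[OF E] by (simp add: list_code_def)
    with Nil F(2)[OF E] show ?thesis by simp
  next
    case (Cons y ys)
    then obtain k ks where k: "L n = Suc (prod_encode (k, list_encode ks))" "A k y" "list_all2 A ks ys"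
      using L(2)[OF E] by (auto simp: list_code_def list_all2_Cons2)
    then have "(E \<otimes>\<^sub>c (A \<otimes>\<^sub>c list_code A)) (prod_encode (n, L n - 1)) (x, y, ys)"
      using E by (auto simp: pair_code_def list_code_def)
    from G(2)[OF this] Cons k(1) show ?thesis by simp
  qed
  ultimately show ?thesis unfolding computable_def by blast
qed

text \<open>The number of iterations may depend on the code n and not just on the element coded,
  which is why F is exhibited here instead of a computable function of x.\<close>

lemma computable_funpow:
  assumes "computable A A f" "computable E A init" "rec1 cnt"
  shows "\<exists>F. rec1 F \<and> (\<forall>n x. E n x \<longrightarrow> A (F n) ((f ^^ cnt n) (init x)))"
proof -
  obtain F I where F: "rec1 F" "\<And>n x. A n x \<Longrightarrow> A (F n) (f x)"
    and I: "rec1 I" "\<And>n x. E n x \<Longrightarrow> A (I n) (init x)"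
    using assms by (auto simp: computable_def)
  have "A ((F ^^ k) n) ((f ^^ k) x)" if "A n x" for k n x
    using that by (induction k) (auto intro: F)
  with I F(1) assms(3) show ?thesis
    by (intro exI[of _ "\<lambda>n. (F ^^ cnt n) (I n)"]) (auto intro: rec1_funpow)
qed

lemma length_le_list_encode: "length ns \<le> list_encode ns"
proof (induction ns)
  case (Cons n ns)
  then show ?case using le_prod_encode_2[of "list_encode ns" n] by simp
qed simp

text \<open>The loop consumes one entry per round and idles on the empty list. The code of a list
  bounds its length, so it can serve as the number of rounds. The state carries x along because g
  depends on it.\<close>

lemma computable_fold:
  assumes l: "computable E (list_code A) l" and i: "computable E B init"
    and g: "computable (E \<otimes>\<^sub>c (A \<otimes>\<^sub>c B)) B (\<lambda>p. g (fst p) (fst (snd p)) (snd (snd p)))"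
  shows "computable E B (\<lambda>x. fold (g x) (l x) (init x))"
proof -
  let ?S = "E \<otimes>\<^sub>c (list_code A \<otimes>\<^sub>c B)"
  define step where "step = (\<lambda>p. case fst (snd p) of [] \<Rightarrow> p
    | y # ys \<Rightarrow> (fst p, ys, g (fst p) y (snd (snd p))))"
  have step: "computable ?S ?S step"
    unfolding step_def
  proof (rule computable_case_list[where A = A and l = "\<lambda>p. fst (snd p)" and f = "\<lambda>p. p"
        and g = "\<lambda>p y ys. (fst p, ys, g (fst p) y (snd (snd p)))"])
    let ?T = "?S \<otimes>\<^sub>c (A \<otimes>\<^sub>c list_code A)"
    have e: "computable ?T E (\<lambda>p. fst (fst p))"
      by (rule computable_fst computable_snd computable_id)+
    have a: "computable ?T A (\<lambda>p. fst (snd p))"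
      by (rule computable_fst computable_snd computable_id)+
    have b: "computable ?T B (\<lambda>p. snd (snd (fst p)))"
      by (rule computable_fst computable_snd computable_id)+
    have "computable ?T B (\<lambda>p. g (fst (fst p)) (fst (snd p)) (snd (snd (fst p))))"
      using computable_comp[OF g computable_pair[OF e computable_pair[OF a b]]] by simp
    moreover have "computable ?T (list_code A) (\<lambda>p. snd (snd p))"
      by (rule computable_fst computable_snd computable_id)+
    ultimately show "computable ?T ?S (\<lambda>p. (fst (fst p), snd (snd p),
        g (fst (fst p)) (fst (snd p)) (snd (snd (fst p)))))"
      using computable_pair[OF e] computable_pair by blast
  next
    show "computable ?S (list_code A) (\<lambda>p. fst (snd p))"
      by (rule computable_fst computable_snd computable_id)+
  qed (rule computable_id)
  obtain L where L: "rec1 L" "\<And>n x. E n x \<Longrightarrow> list_code A (L n) (l x)"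
    using l by (auto simp: computable_def)
  have idle: "(step ^^ k) (x, [], b) = (x, [], b)" for k x b
    by (induction k) (auto simp: step_def)
  have run: "(step ^^ k) (x, ys, b) = (x, [], fold (g x) ys b)" if "length ys \<le> k" for k x ys b
    using that
  proof (induction ys arbitrary: k b)
    case (Cons y ys)
    then obtain k' where k: "k = Suc k'" "length ys \<le> k'" by (cases k) auto
    have "(step ^^ k) (x, y # ys, b) = (step ^^ k') (step (x, y # ys, b))"
      by (simp add: k funpow_swap1)
    then show ?case using Cons.IH[OF k(2)] by (simp add: step_def)
  qed (simp add: idle)
  have "\<exists>F. rec1 F \<and> (\<forall>n x. E n x \<longrightarrow> ?S (F n) ((step ^^ L n) (x, l x, init x)))"
    by (intro computable_funpow step L(1) computable_pair l i computable_id)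
  moreover have "(step ^^ L n) (x, l x, init x) = (x, [], fold (g x) (l x) (init x))" if "E n x" for n x
    using L(2)[OF that] by (intro run) (metis list_code_def list_all2_lengthD length_le_list_encode)
  ultimately have "computable E ?S (\<lambda>x. (x, [], fold (g x) (l x) (init x)))"
    unfolding computable_def by metis
  from computable_snd[OF computable_snd[OF this]] show ?thesis by simp
qed

lemma computable_Cons_step:
  assumes "computable A B f"
  shows "computable (E \<otimes>\<^sub>c (A \<otimes>\<^sub>c list_code B)) (list_code B) (\<lambda>p. f (fst (snd p)) # snd (snd p))"
proof (rule computable_Cons)
  show "computable (E \<otimes>\<^sub>c (A \<otimes>\<^sub>c list_code B)) B (\<lambda>p. f (fst (snd p)))"
    by (rule computable_comp[OF assms], (rule computable_fst computable_snd computable_id)+)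
  show "computable (E \<otimes>\<^sub>c (A \<otimes>\<^sub>c list_code B)) (list_code B) (\<lambda>p. snd (snd p))"
    by (rule computable_snd computable_id)+
qed

lemma computable_rev:
  assumes "computable E (list_code A) l"
  shows "computable E (list_code A) (\<lambda>x. rev (l x))"
  unfolding rev_conv_fold
  by (rule computable_fold[OF assms computable_Nil computable_Cons_step[OF computable_id]])

lemma computable_foldr:
  assumes l: "computable E (list_code A) l" and i: "computable E B init"
    and g: "computable (E \<otimes>\<^sub>c (A \<otimes>\<^sub>c B)) B (\<lambda>p. g (fst p) (fst (snd p)) (snd (snd p)))"
  shows "computable E B (\<lambda>x. foldr (g x) (l x) (init x))"
  using computable_fold[OF computable_rev[OF l] i g] by (simp add: foldr_conv_fold)

lemma append_conv_foldr: "xs @ ys = foldr Cons xs ys"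
  by (induction xs) auto

lemma computable_append:
  assumes "computable E (list_code A) f" "computable E (list_code A) g"
  shows "computable E (list_code A) (\<lambda>x. f x @ g x)"
  unfolding append_conv_foldr
  by (rule computable_foldr[OF assms computable_Cons_step[OF computable_id]])

lemma computable_map:
  assumes "computable E (list_code A) l" "computable A B f"
  shows "computable E (list_code B) (\<lambda>x. map f (l x))"
proof -
  have "map f xs = foldr (\<lambda>a. Cons (f a)) xs []" for xs by (induction xs) auto
  then show ?thesis
    using computable_foldr[OF assms(1) computable_Nil computable_Cons_step[OF assms(2)]] by simp
qed

section \<open>Positive and negative roots\<close>

locale coxeter_system =
  fixes S :: "'s set" and m :: "'s \<Rightarrow> 's \<Rightarrow> enat"
  assumes finite_S: "finite S" and coxeter: "coxeter_matrix S m"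
begin

abbreviation refl_by :: "'s \<Rightarrow> ('s \<Rightarrow> real) \<Rightarrow> 's \<Rightarrow> real"
  where "refl_by \<equiv> cox_refl S m"

abbreviation act :: "'s gword \<Rightarrow> ('s \<Rightarrow> real) \<Rightarrow> 's \<Rightarrow> real"
  where "act \<equiv> word_act S m"

abbreviation B :: "('s \<Rightarrow> real) \<Rightarrow> ('s \<Rightarrow> real) \<Rightarrow> real"
  where "B \<equiv> cox_form S m"

lemma m_sym: "s \<in> S \<Longrightarrow> t \<in> S \<Longrightarrow> m s t = m t s"
  using coxeter unfolding coxeter_matrix_def by (cases "s = t") auto

lemma m_self: "s \<in> S \<Longrightarrow> m s s = 1"
  using coxeter by (auto simp: coxeter_matrix_def)

lemma m_ge_2: "s \<in> S \<Longrightarrow> t \<in> S \<Longrightarrow> s \<noteq> t \<Longrightarrow> m s t = enat k \<Longrightarrow> 2 \<le> k"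
  using coxeter by (auto simp: coxeter_matrix_def numeral_eq_enat) (metis enat_ord_simps(1) numeral_eq_enat)

lemma gwords_simps [simp]:
  "[] \<in> gwords X"
  "p # u \<in> gwords X \<longleftrightarrow> fst p \<in> X \<and> u \<in> gwords X"
  "u @ v \<in> gwords X \<longleftrightarrow> u \<in> gwords X \<and> v \<in> gwords X"
  "rev u \<in> gwords X \<longleftrightarrow> u \<in> gwords X"
  by (cases p; auto simp: gwords_def)+

lemma act_Nil [simp]: "act [] x = x"
  and act_Cons [simp]: "act (p # u) x = refl_by (fst p) (act u x)"
  and act_append [simp]: "act (u @ v) x = act u (act v x)"
  by (simp_all add: word_act_def split: prod.split)

lemma refl_refl [simp]: "s \<in> S \<Longrightarrow> refl_by s (refl_by s x) = x"
  using cox_refl_refl[OF finite_S coxeter] .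

lemma act_rev_act: "u \<in> gwords S \<Longrightarrow> act (rev u) (act u x) = x"
  by (induction u) auto

lemma act_inj: "u \<in> gwords S \<Longrightarrow> act u x = act u y \<Longrightarrow> x = y"
  using act_rev_act by metis

lemma B_sym: "B x y = B y x"
  unfolding cox_form_def
  by (subst sum.swap) (auto intro!: sum.cong simp: m_sym)

lemma B_comb: "B (\<lambda>t. a * x t + b * y t) z = a * B x z + b * B y z"
  by (simp add: cox_form_def algebra_simps sum.distrib sum_distrib_left)

lemma B_comb': "B z (\<lambda>t. a * x t + b * y t) = a * B z x + b * B z y"
  using B_comb B_sym by metis

lemma B_simple: "s \<in> S \<Longrightarrow> t \<in> S \<Longrightarrow> B (simple_root s) (simple_root t) = cox_coeff (m s t)"
  using cox_form_add_root[OF finite_S, of t s m "\<lambda>_. 0" 1]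
  by (simp add: cox_form_def)

lemma B_simple_self: "s \<in> S \<Longrightarrow> B (simple_root s) (simple_root s) = 1"
  by (simp add: B_simple m_self cox_coeff_self)

lemma refl_alt: "refl_by s x = (\<lambda>t. 1 * x t + (- 2 * B x (simple_root s)) * simple_root s t)"
  by (simp add: cox_refl_def)

lemma refl_comb: "refl_by s (\<lambda>t. a * x t + b * y t) = (\<lambda>t. a * refl_by s x t + b * refl_by s y t)"
  by (simp add: cox_refl_def B_comb algebra_simps)

lemma act_comb: "act u (\<lambda>t. a * x t + b * y t) = (\<lambda>t. a * act u x t + b * act u y t)"
  by (induction u) (simp_all add: refl_comb)

lemma B_refl: "s \<in> S \<Longrightarrow> B (refl_by s x) (refl_by s y) = B x y"
  unfolding refl_alt B_comb B_comb' B_simple_self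
  by (simp add: B_sym[of "simple_root s"] algebra_simps)

lemma B_act: "u \<in> gwords S \<Longrightarrow> B (act u x) (act u y) = B x y"
  by (induction u) (auto simp: B_refl)

lemma refl_other: "t \<noteq> s \<Longrightarrow> refl_by s x t = x t"
  by (simp add: cox_refl_def simple_root_def)

lemma refl_simple: "s \<in> S \<Longrightarrow> refl_by s (simple_root s) = (\<lambda>t. - simple_root s t)"
  by (simp add: cox_refl_def B_simple_self fun_eq_iff)

section \<open>The plane of two simple roots\<close>

definition span2 :: "'s \<Rightarrow> 's \<Rightarrow> real \<Rightarrow> real \<Rightarrow> 's \<Rightarrow> real"
  where "span2 s t a b = (\<lambda>u. a * simple_root s u + b * simple_root t u)"

lemma span2_swap: "span2 s t a b = span2 t s b a"
  by (simp add: span2_def add.commute)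

lemma refl_span2:
  assumes "s \<in> S" "t \<in> S" "s \<noteq> t"
  shows "refl_by s (span2 s t a b) = span2 s t (- 2 * cox_coeff (m s t) * b - a) b"
proof -
  have "refl_by s (simple_root t) = (\<lambda>u. 1 * simple_root t u + (- 2 * cox_coeff (m s t)) * simple_root s u)"
    using assms unfolding refl_alt by (simp add: B_simple m_sym)
  then show ?thesis
    unfolding span2_def refl_comb refl_simple[OF assms(1)] by (simp add: algebra_simps)
qed

lemma alternating_gwords [simp]: "s \<in> X \<Longrightarrow> t \<in> X \<Longrightarrow> alternating k s t \<in> gwords X"
  by (induction k arbitrary: s t) auto

lemma length_alternating [simp]: "length (alternating k s t) = k"
  by (induction k arbitrary: s t) auto

lemma rev_alternating_Suc:
  "rev (alternating (Suc k) s t) = (if even k then s else t, True) # rev (alternating k s t)"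
proof (induction k arbitrary: s t)
  case (Suc k)
  have "rev (alternating (Suc (Suc k)) s t) = rev (alternating (Suc k) t s) @ [(s, True)]" by simp
  also have "\<dots> = (if even k then t else s, True) # rev (alternating k t s) @ [(s, True)]"
    unfolding Suc by simp
  finally show ?case by simp
qed simp

text \<open>The alternating word of length 2k acts trivially. Moving its letters to the other side
  one by one identifies the words of lengths i and 2k - i; i = k is the claim. Words are reversed so
  that s is the first letter to act.\<close>

lemma act_rev_alternating_braid:
  assumes st: "s \<in> S" "t \<in> S" "s \<noteq> t" and k: "m s t = enat k"
  shows "act (rev (alternating k s t)) x = act (rev (alternating k t s)) x"
proof -
  have "act (rev (alternating (2 * j) t s)) x = ((\<lambda>x. refl_by s (refl_by t x)) ^^ j) x" for j x
    by (induction j arbitrary: x) (auto simp: funpow_Suc_right simp del: funpow.simps(2))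
  then have full: "act (rev (alternating (2 * k) t s)) x = x"
    using cox_refl_braid[OF finite_S coxeter st k] by simp
  have "act (rev (alternating i s t)) x = act (rev (alternating (2 * k - i) t s)) x" if "i \<le> 2 * k" for i
    using that
  proof (induction i)
    case 0
    then show ?case using full by simp
  next
    case (Suc i)
    then obtain n where n: "2 * k - i = Suc n" "2 * k - Suc i = n" by (metis Suc_diff_Suc Suc_le_lessD)
    then have par: "even n \<longleftrightarrow> odd i" using Suc.prems by presburger
    let ?L = "if even i then s else t"
    have "act (rev (alternating (Suc i) s t)) x = refl_by ?L (act (rev (alternating i s t)) x)"
      unfolding rev_alternating_Suc by simp
    also have "act (rev (alternating i s t)) x = act (rev (alternating (Suc n) t s)) x"
      using Suc n by simp
    also have "refl_by ?L \<dots> = act (rev (alternating n t s)) x"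
      unfolding rev_alternating_Suc using par st by (cases "even i") auto
    finally show ?case using n by simp
  qed
  from this[of k] show ?thesis by simp
qed

text \<open>If the coefficients are consecutive terms of a solution of the recurrence, a reflection
  just shifts the solution by one place and exchanges the roles of s and t.\<close>

lemma act_rev_alternating_span2:
  assumes st: "s \<in> S" "t \<in> S" "s \<noteq> t"
    and f: "\<And>i. f (i + 1) + f (i - 1) = - 2 * cox_coeff (m s t) * f i"
  shows "act (rev (alternating k s t)) (span2 s t (f (i + 1)) (f i)) =
    (if even k then span2 s t (f (i - int k + 1)) (f (i - int k))
     else span2 t s (f (i - int k + 1)) (f (i - int k)))"
  using st f
proof (induction k arbitrary: s t i)
  case (Suc k)
  have ft: "f (i + 1) + f (i - 1) = - 2 * cox_coeff (m t s) * f i" for i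
    using Suc.prems m_sym by simp
  have "- 2 * cox_coeff (m s t) * f i - f (i + 1) = f (i - 1)"
    using Suc.prems(4)[of i] by simp
  then have "refl_by s (span2 s t (f (i + 1)) (f i)) = span2 t s (f (i - 1 + 1)) (f (i - 1))"
    using Suc.prems refl_span2[of s t] by (simp add: span2_swap[of s t])
  with Suc.IH[of t s "i - 1"] Suc.prems ft show ?case
    by (simp add: algebra_simps)
qed simp

lemma sin_rec: "sin (real_of_int (i + 1) * \<theta>) + sin (real_of_int (i - 1) * \<theta>) = 2 * cos \<theta> * sin (real_of_int i * \<theta>)"
  by (simp add: algebra_simps sin_add sin_diff)

text \<open>The coefficients are values of a solution \<open>f\<close> of the recurrence satisfied by \<open>sin (i \<theta>)\<close>,
  \<open>\<theta> = \<pi> / m s t\<close>, which degenerates to an affine function of \<open>i\<close> for \<open>m s t = \<infinity>\<close>.\<close>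

lemma dihedral_nonneg:
  assumes st: "s \<in> S" "t \<in> S" "s \<noteq> t" and k: "enat k < m s t"
  shows "\<exists>a b. 0 \<le> a \<and> 0 \<le> b \<and> act (rev (alternating k t s)) (simple_root s) = span2 s t a b"
proof -
  have "\<exists>f i. (\<forall>i. f (i + 1) + f (i - 1) = - 2 * cox_coeff (m t s) * f i) \<and> f (i + 1) = 0 \<and> f i = 1 \<and>
      0 \<le> f (i - int k + 1) \<and> 0 \<le> f (i - int k)"
  proof (cases "m t s")
    case (enat n)
    define \<theta> where "\<theta> = pi / real n"
    have kn: "k < n" "2 \<le> n" using k enat m_sym[of s t] m_ge_2[of t s] st by auto
    then have \<theta>: "0 < \<theta>" "\<theta> < pi" "real n * \<theta> = pi" by (auto simp: \<theta>_def field_simps)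
    then have sin: "sin \<theta> > 0" by (intro sin_gt_zero)
    have nn: "0 \<le> sin (real_of_int j * \<theta>)" if "0 \<le> j" "j \<le> int n" for j
    proof (rule sin_ge_zero)
      show "0 \<le> real_of_int j * \<theta>" using that \<theta> by simp
      have "real_of_int j * \<theta> \<le> real n * \<theta>" using that \<theta> by (intro mult_right_mono) auto
      then show "real_of_int j * \<theta> \<le> pi" using \<theta> by simp
    qed
    have n1: "real_of_int (int n - 1) * \<theta> = pi - \<theta>" using \<theta> by (simp add: algebra_simps)
    \<comment> \<open>Starting at i = n - 1 gives the coefficients 0 and 1. As k < n, descending by
      k places keeps all angles between 0 and \<pi>, where the sine is nonnegative.\<close>
    define f where "f j = sin (real_of_int j * \<theta>) / sin \<theta>" for j
    have "f (i + 1) + f (i - 1) = - 2 * cox_coeff (m t s) * f i" for i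
      using sin_rec[of i \<theta>] unfolding f_def enat cox_coeff_def add_divide_distrib[symmetric] by (simp add: \<theta>_def)
    moreover have "f (int n - 1 + 1) = 0" "f (int n - 1) = 1"
      unfolding f_def n1 using \<theta> sin by auto
    moreover have "0 \<le> f (int n - 1 - int k + 1)" "0 \<le> f (int n - 1 - int k)"
      unfolding f_def by (intro divide_nonneg_pos nn; use kn sin in linarith)+
    ultimately show ?thesis by blast
  next
    case infinity
    \<comment> \<open>The values at 0 and -1 are 0 and 1, and they grow as the index descends, so no
      bound on k is required.\<close>
    then show ?thesis
      by (intro exI[of _ "\<lambda>j. - real_of_int j"] exI[of _ "-1"]) (simp add: cox_coeff_def)
  qed
  then obtain f i where f: "\<And>i. f (i + 1) + f (i - 1) = - 2 * cox_coeff (m t s) * f i"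
    "f (i + 1) = 0" "f i = 1" "0 \<le> f (i - int k + 1)" "0 \<le> f (i - int k)" by blast
  have "span2 t s (f (i + 1)) (f i) = simple_root s" by (simp add: f span2_def)
  then have "act (rev (alternating k t s)) (simple_root s) =
    (if even k then span2 t s (f (i - int k + 1)) (f (i - int k))
     else span2 s t (f (i - int k + 1)) (f (i - int k)))"
    using act_rev_alternating_span2[of t s f, OF st(2,1) st(3)[symmetric] f(1), of k i] by simp
  then show ?thesis using f span2_swap[of t s] by (cases "even k") auto
qed

text \<open>A letter added on the right either prolongs an alternating word or cancels against its
  last letter.\<close>

lemma dihedral_word:
  assumes st: "s \<in> S" "t \<in> S" and "y \<in> gwords {s, t}"
  shows "\<exists>k\<le>length y. act y = act (rev (alternating k s t)) \<or> act y = act (rev (alternating k t s))"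
  using assms(3)
proof (induction y rule: rev_induct)
  case Nil
  then show ?case by auto
next
  case (snoc p y)
  have "y \<in> gwords {s, t}" using snoc.prems by simp
  from snoc.IH[OF this] obtain k where k: "k \<le> length y"
    "act y = act (rev (alternating k s t)) \<or> act y = act (rev (alternating k t s))"
    by (elim exE conjE) (rule that)
  have step: "\<exists>k'\<le>Suc k. act (y @ [p]) = act (rev (alternating k' a b)) \<or> act (y @ [p]) = act (rev (alternating k' b a))"
    if ab: "fst p = a" "a \<in> S" "act y = act (rev (alternating k a b)) \<or> act y = act (rev (alternating k b a))" for a b
    using ab(3)
  proof
    assume *: "act y = act (rev (alternating k b a))"
    then have "act (y @ [p]) = act (rev (alternating (Suc k) a b))"
      by (intro ext) (simp add: ab(1))
    then show ?thesis by (intro exI[of _ "Suc k"] conjI disjI1) simp_all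
  next
    assume *: "act y = act (rev (alternating k a b))"
    show ?thesis
    proof (cases k)
      case 0
      then have "act (y @ [p]) = act (rev (alternating (Suc 0) a b))"
        by (intro ext) (simp add: ab(1) *)
      then show ?thesis using 0 by (intro exI[of _ "Suc 0"] conjI disjI1) simp_all
    next
      case (Suc j)
      then have "act (y @ [p]) = act (rev (alternating j b a))"
        using * by (intro ext) (simp add: ab(1,2))
      then show ?thesis using Suc by (intro exI[of _ j] conjI disjI2) simp_all
    qed
  qed
  have "fst p \<in> {s, t}" using snoc.prems by simp
  moreover have "act y = act (rev (alternating k t s)) \<or> act y = act (rev (alternating k s t))"
    by (rule disjE[OF k(2)]; rule disjI1 disjI2; assumption)
  ultimately have "\<exists>k'\<le>Suc k. act (y @ [p]) = act (rev (alternating k' s t)) \<or> act (y @ [p]) = act (rev (alternating k' t s))"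
    using step[of s t, OF _ st(1) k(2)] step[of t s, OF _ st(2)] 
    by (simp only: disj_commute insert_iff empty_iff) blast
  moreover have "Suc k \<le> length (y @ [p])" using k(1) by simp
  ultimately show ?case using le_trans by blast
qed

section \<open>Length, and the sign of a root\<close>

definition len :: "'s gword \<Rightarrow> nat"
  where "len u = (LEAST n. \<exists>v\<in>gwords S. length v = n \<and> act v = act u)"

lemma len_reduced: "u \<in> gwords S \<Longrightarrow> \<exists>v\<in>gwords S. length v = len u \<and> act v = act u"
  unfolding len_def by (rule LeastI_ex) blast

lemma len_le: "v \<in> gwords S \<Longrightarrow> act v = act u \<Longrightarrow> len u \<le> length v"
  unfolding len_def by (rule Least_le) blast

lemma len_append:
  assumes "u \<in> gwords S" "v \<in> gwords S" shows "len (u @ v) \<le> len u + length v"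
proof -
  obtain u' where "u' \<in> gwords S" "length u' = len u" "act u' = act u"
    using len_reduced[OF assms(1)] by blast
  then show ?thesis using len_le[of "u' @ v" "u @ v"] assms by (auto simp: fun_eq_iff)
qed

lemma len_cong: "act u = act v \<Longrightarrow> len u = len v"
  by (simp add: len_def)

text \<open>Deodhar's argument: factor a reduced word as \<open>x y\<close> with \<open>y\<close> in the dihedral subgroup of \<open>s\<close>
  and of the last letter \<open>t\<close>, and with \<open>x\<close> as short as possible. Length is measured in the image of
  the geometric representation, which makes the faithfulness of the latter unnecessary.\<close>

lemma root_nonneg:
  assumes "u \<in> gwords S" "s \<in> S" "len u \<le> len (u @ [(s, True)])"
  shows "0 \<le> act u (simple_root s) r"
  using assms
proof (induction "len u" arbitrary: u s r rule: less_induct)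
  case less
  obtain v where v: "v \<in> gwords S" "length v = len u" "act v = act u"
    using len_reduced[OF less.prems(1)] by blast
  show ?case
  proof (cases v rule: rev_cases)
    case Nil
    then have "act u = (\<lambda>x. x)" using v(3) by (auto simp: fun_eq_iff)
    then show ?thesis by (simp add: simple_root_def)
  next
    case (snoc v' p)
    define t where "t = fst p"
    have v': "v' \<in> gwords S" "t \<in> S" "length v' < len u" using v snoc by (auto simp: t_def)
    have "t \<noteq> s"
    proof
      assume "t = s"
      then have "act (u @ [(s, True)]) = act v'"
        using v(3) v' by (intro ext) (simp add: snoc t_def flip: v(3))
      then show False using len_le[of v' "u @ [(s, True)]"] v' less.prems by auto
    qed
    define P where "P n x \<longleftrightarrow> x \<in> gwords S \<and> len x = n \<and>
      (\<exists>y\<in>gwords {s, t}. act (x @ y) = act u \<and> n + length y = len u)" for n x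
    have "len v' + 1 = len u"
      using len_le[of v' v'] v' len_append[of v' "[p]"] snoc v len_cong[OF v(3)] by auto
    then have "P (len v') v'"
      unfolding P_def using v' v snoc t_def by (auto intro!: bexI[of _ "[p]"])
    then have ex: "\<exists>n x. P n x" by blast
    define n where "n = (LEAST n. \<exists>x. P n x)"
    have "\<exists>x. P n x" unfolding n_def by (rule LeastI_ex) (rule ex)
    then obtain x where "P n x" by blast
    then obtain y where x: "x \<in> gwords S" "len x = n" and y: "y \<in> gwords {s, t}" "act (x @ y) = act u"
      "n + length y = len u" by (auto simp: P_def)
    have yS: "y \<in> gwords S" using y(1) less.prems(2) v'(2) by (auto simp: gwords_def)
    have n_le: "n \<le> n'" if "P n' x'" for n' x' unfolding n_def using that by (intro Least_le) blast
    have "n \<le> len v'" using n_le[OF \<open>P (len v') v'\<close>] .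
    then have less_n: "len x < len u" using \<open>len v' + 1 = len u\<close> x by simp
    \<comment> \<open>If a shortened x, moving that letter into y would give a factorization with a
      shorter x.\<close>
    have up: "len x \<le> len (x @ [(a, True)])" if a: "a \<in> {s, t}" for a
    proof (rule ccontr)
      assume contra: "\<not> ?thesis"
      have aS: "a \<in> S" using a less.prems(2) v'(2) by auto
      let ?x = "x @ [(a, True)]" and ?y = "(a, True) # y"
      have act: "act (?x @ ?y) = act u" using y(2) aS by (intro ext) (simp flip: y(2))
      have "len u \<le> len ?x + length ?y"
        using len_append[of ?x ?y] len_cong[OF act] x yS aS by simp
      then have "P (len ?x) ?x"
        unfolding P_def using x y act a aS contra by (auto intro!: bexI[of _ ?y])
      then show False using n_le contra x(2) by auto
    qed
    have pos: "0 \<le> act x (simple_root a) r" if "a \<in> {s, t}" for a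
      using less.hyps[OF less_n x(1) _ up] that less.prems(2) v'(2) by auto
    have min1: "length y \<le> length z" if "z \<in> gwords S" "act z = act y" for z
    proof -
      have "len u = len (x @ z)" using y(2) that(2) by (intro len_cong ext) (simp flip: y(2))
      then show ?thesis using len_append[OF x(1) that(1)] y(3) x(2) by simp
    qed
    \<comment> \<open>A shorter expression for y followed by s would make u followed by s shorter
      than u, against the assumption. Hence y cannot end in s.\<close>
    have min2: "length y \<le> length z" if "z \<in> gwords S" "act z = act (y @ [(s, True)])" for z
    proof -
      have "len (u @ [(s, True)]) = len (x @ z)"
        using y(2) that(2) by (intro len_cong ext) (simp flip: y(2))
      then show ?thesis using len_append[OF x(1) that(1)] y(3) x(2) less.prems(3) by simp
    qed
    let ?n = "length y"
    note alt = alternating_gwords[OF less.prems(2) v'(2)] alternating_gwords[OF v'(2) less.prems(2)]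
    have not_s: False if z: "\<And>x. act y x = act (z @ [(s, True)]) x" "z \<in> gwords S" "length z < ?n" for z
      using min2[of z] z less.prems(2) by (auto simp: fun_eq_iff)
    obtain k where k: "k \<le> ?n" "act y = act (rev (alternating k s t)) \<or> act y = act (rev (alternating k t s))"
      using dihedral_word[OF less.prems(2) v'(2) y(1)] by blast
    then have "k = ?n"
      using min1[of "rev (alternating k s t)"] min1[of "rev (alternating k t s)"] alt by auto
    have y_eq: "act y = act (rev (alternating ?n t s))"
    proof (cases ?n)
      case (Suc j)
      have "act y \<noteq> act (rev (alternating ?n s t))"
        using not_s[of "rev (alternating j t s)"] alt Suc by (auto simp: fun_eq_iff)
      with k \<open>k = ?n\<close> show ?thesis by blast
    qed (auto simp: fun_eq_iff)
    \<comment> \<open>Otherwise a braid relation at the right end of the alternating word for y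
      makes it end in s.\<close>
    have "enat ?n < m s t"
    proof (rule ccontr)
      assume "\<not> ?thesis"
      then obtain q where q: "m s t = enat q" "q \<le> ?n" by (cases "m s t") auto
      have "2 \<le> q" using m_ge_2[of s t q] q less.prems(2) v'(2) \<open>t \<noteq> s\<close> by auto
      have split: "\<exists>w\<in>gwords {a, b}. length w = i \<and> rev (alternating (i + j) a b) = w @ rev (alternating j a b)" for i j and a b :: 's
        by (induction i) (auto simp: rev_alternating_Suc simp del: alternating.simps(2))
      obtain w where w: "w \<in> gwords {t, s}" "length w = ?n - q"
        "rev (alternating (?n - q + q) t s) = w @ rev (alternating q t s)"
        using split[of t s "?n - q" q] by blast
      obtain q' where q': "q = Suc q'" using \<open>2 \<le> q\<close> by (cases q) auto
      have "act y x = act ((w @ rev (alternating q' t s)) @ [(s, True)]) x" for x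
      proof -
        have "act y x = act w (act (rev (alternating q t s)) x)" using y_eq w(3) q(2) by simp
        also have "\<dots> = act w (act (rev (alternating q s t)) x)"
          using act_rev_alternating_braid[OF less.prems(2) v'(2) \<open>t \<noteq> s\<close>[symmetric] q(1)] by simp
        finally show ?thesis by (simp add: q')
      qed
      moreover have "w \<in> gwords S" using w(1) less.prems(2) v'(2) by (auto simp: gwords_def)
      moreover have "length (w @ rev (alternating q' t s)) < ?n" using w(2) q(2) q' by simp
      ultimately show False
        using not_s[of "w @ rev (alternating q' t s)"] alt by simp
    qed
    from dihedral_nonneg[OF less.prems(2) v'(2) \<open>t \<noteq> s\<close>[symmetric] this]
    obtain a b where ab: "0 \<le> a" "0 \<le> b"
      and ab_eq: "act (rev (alternating ?n t s)) (simple_root s) = span2 s t a b"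
      by (elim exE conjE) (rule that)
    have "act u (simple_root s) = act x (act y (simple_root s))"
      using fun_cong[OF y(2), of "simple_root s"] by simp
    also have "\<dots> = (\<lambda>r. a * act x (simple_root s) r + b * act x (simple_root t) r)"
      unfolding y_eq ab_eq span2_def act_comb by (rule refl)
    finally have eq: "act u (simple_root s) r = a * act x (simple_root s) r + b * act x (simple_root t) r"
      by (rule fun_cong)
    have "0 \<le> act x (simple_root s) r" "0 \<le> act x (simple_root t) r"
      by (rule pos; simp)+
    with ab show ?thesis
      unfolding eq by (intro add_nonneg_nonneg mult_nonneg_nonneg)
  qed
qed

text \<open>If s shortens u, then u followed by s is lengthened by s, and it sends
  \<open>simple_root s\<close> to the negative of the root in question.\<close>

lemma root_sign:
  assumes "u \<in> gwords S" "s \<in> S"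
  shows "(\<forall>r. 0 \<le> act u (simple_root s) r) \<or> (\<forall>r. act u (simple_root s) r \<le> 0)"
proof (cases "len u \<le> len (u @ [(s, True)])")
  case True
  then show ?thesis using root_nonneg[OF assms] by blast
next
  case False
  let ?u = "u @ [(s, True)]"
  have "len (?u @ [(s, True)]) = len u" using assms(2) by (intro len_cong ext) simp
  then have "0 \<le> act ?u (simple_root s) r" for r
    using False assms root_nonneg[of ?u s] by simp
  moreover have "act ?u (simple_root s) = (\<lambda>r. - act u (simple_root s) r)"
    using act_comb[of u "-1" "simple_root s" 0 "simple_root s"] assms(2) by (simp add: refl_simple)
  ultimately show ?thesis by (simp add: fun_eq_iff)
qed

end

section \<open>Retraction onto standard parabolic subgroups\<close>

context coxeter_system begin

section \<open>Positive roots under simple reflections\<close>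

lemma root_norm: "u \<in> gwords S \<Longrightarrow> y \<in> S \<Longrightarrow> B (act u (simple_root y)) (act u (simple_root y)) = 1"
  by (simp add: B_act B_simple_self)

lemma root_nonzero: "u \<in> gwords S \<Longrightarrow> y \<in> S \<Longrightarrow> act u (simple_root y) \<noteq> (\<lambda>_. 0)"
  using root_norm[of u y] by (auto simp: cox_form_def)

text \<open>All roots have norm 1, so a root on the line of \<open>simple_root s\<close> is plus or
  minus \<open>simple_root s\<close>.\<close>

lemma root_eq_simple:
  assumes u: "u \<in> gwords S" "y \<in> S" "s \<in> S"
    and supp: "\<And>r. r \<noteq> s \<Longrightarrow> act u (simple_root y) r = 0" and "0 \<le> act u (simple_root y) s"
  shows "act u (simple_root y) = simple_root s"
proof -
  define c where "c = act u (simple_root y) s"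
  have eq: "act u (simple_root y) = (\<lambda>r. c * simple_root s r + 0 * simple_root s r)"
    using supp by (auto simp: fun_eq_iff c_def simple_root_def)
  have "c * c = 1"
    using root_norm[OF u(1,2)] unfolding eq B_comb B_comb' by (simp add: B_simple_self u)
  then have "c = 1 \<or> c = -1" by (simp only: square_eq_1_iff)
  moreover have "0 \<le> c" using assms(5) by (simp add: c_def)
  ultimately have "c = 1" by auto
  then show ?thesis using eq by simp
qed

text \<open>The reflection changes only the coordinate s. A positive root with a negative image
  therefore has no other nonzero coordinate, and so it is \<open>simple_root s\<close>.\<close>

lemma refl_nonneg:
  assumes u: "u \<in> gwords S" "y \<in> S" "s \<in> S" and pos: "\<And>r. 0 \<le> act u (simple_root y) r"
    and "act u (simple_root y) \<noteq> simple_root s"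
  shows "0 \<le> refl_by s (act u (simple_root y)) r"
proof (rule ccontr)
  assume neg: "\<not> ?thesis"
  have "(\<forall>r. 0 \<le> act ((s, True) # u) (simple_root y) r) \<or> (\<forall>r. act ((s, True) # u) (simple_root y) r \<le> 0)"
    using u by (intro root_sign) auto
  with neg have "refl_by s (act u (simple_root y)) r \<le> 0" for r by auto
  then have "act u (simple_root y) r \<le> 0" if "r \<noteq> s" for r
    using refl_other[OF that, of "act u (simple_root y)"] by metis
  then have "act u (simple_root y) r = 0" if "r \<noteq> s" for r
    using pos[of r] that by (simp add: order_antisym)
  then show False using root_eq_simple[OF u _ pos] assms(5) by blast
qed

text \<open>For \<open>n = m s t\<close>, the positive roots in the plane of \<open>s\<close> and \<open>t\<close> are \<open>rho n i s t\<close> with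
  \<open>0 \<le> i < n\<close>, from \<open>e\<^sub>s\<close> to \<open>e\<^sub>t\<close>.\<close>

definition rho :: "nat \<Rightarrow> int \<Rightarrow> 's \<Rightarrow> 's \<Rightarrow> 's \<Rightarrow> real"
  where "rho n i s t = span2 s t (sin (real_of_int (i + 1) * (pi / real n)) / sin (pi / real n))
    (sin (real_of_int i * (pi / real n)) / sin (pi / real n))"

lemma sin_pi_pos: "2 \<le> n \<Longrightarrow> 0 < sin (pi / real n)"
  by (intro sin_gt_zero) (auto simp: field_simps)

lemma refl_rho:
  assumes "s \<in> S" "t \<in> S" "s \<noteq> t" "m s t = enat n"
  shows "refl_by s (rho n i s t) = rho n (i - 1) t s"
proof -
  have "sin (real_of_int (i - 1) * (pi / real n)) =
      2 * cos (pi / real n) * sin (real_of_int i * (pi / real n)) - sin (real_of_int (i + 1) * (pi / real n))"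
    using sin_rec[of i "pi / real n"] by simp
  then show ?thesis
    using assms unfolding rho_def refl_span2[OF assms(1-3)] assms(4) cox_coeff_def
    by (subst span2_swap[of t s]) (simp add: diff_divide_distrib)
qed

lemma rho_simple:
  assumes "2 \<le> n"
  shows "rho n 0 s t = simple_root s" "rho n (int n - 1) s t = simple_root t"
proof -
  have "real_of_int (int n - 1 + 1) * (pi / real n) = pi"
    "real_of_int (int n - 1) * (pi / real n) = pi - pi / real n"
    using assms by (auto simp: field_simps)
  then show "rho n 0 s t = simple_root s" "rho n (int n - 1) s t = simple_root t"
    using sin_pi_pos[OF assms] unfolding rho_def span2_def by simp_all
qed

lemma rho_swap:
  assumes "2 \<le> n" shows "rho n (int n - 1 - i) t s = rho n i s t"
proof -
  have "real_of_int (int n - 1 - i + 1) * (pi / real n) = pi - real_of_int i * (pi / real n)"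
    "real_of_int (int n - 1 - i) * (pi / real n) = pi - real_of_int (i + 1) * (pi / real n)"
    using assms by (auto simp: field_simps)
  then show ?thesis unfolding rho_def by (subst span2_swap) (simp only: sin_pi_minus)
qed

lemma rho_nonsimple:
  assumes "2 \<le> n" "s \<noteq> t" "0 < i" "i < int n" shows "rho n i s t \<noteq> simple_root s"
proof -
  have "0 < sin (real_of_int i * (pi / real n))"
    using assms by (intro sin_gt_zero) (auto simp: field_simps)
  then have "rho n i s t t > 0"
    using sin_pi_pos[OF assms(1)] assms(2) by (simp add: rho_def span2_def simple_root_def)
  then show ?thesis using assms(2) by (auto simp: simple_root_def)
qed

lemma act_rev_alternating_rho:
  assumes "s \<in> S" "t \<in> S" "s \<noteq> t" "m s t = enat n"
  shows "act (rev (alternating k s t)) (rho n i s t) =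
    (if even k then rho n (i - int k) s t else rho n (i - int k) t s)"
  using assms
proof (induction k arbitrary: s t i)
  case (Suc k)
  have "act (rev (alternating (Suc k) s t)) (rho n i s t) = act (rev (alternating k t s)) (rho n (i - 1) t s)"
    using refl_rho[OF Suc.prems] by simp
  then show ?case
    using Suc.IH[of t s "i - 1"] Suc.prems m_sym[of s t] by (simp add: algebra_simps)
qed simp

text \<open>The root changes sign at one of the N letters, and just before that it is the simple
  root of that letter. Undoing the earlier reflections, each of which shifts the index by one,
  locates it among the \<open>rho\<close>.\<close>

lemma plane_root_aux:
  assumes "s \<in> S" "t \<in> S" "s \<noteq> t" "m s t = enat n" "u \<in> gwords S" "y \<in> S"
    and "\<And>r. 0 \<le> act u (simple_root y) r" "\<And>r. act (rev (alternating N s t)) (act u (simple_root y)) r \<le> 0"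
  shows "\<exists>i<N. act u (simple_root y) = rho n (int i) s t"
  using assms
proof (induction N arbitrary: s t u)
  case 0
  have "act u (simple_root y) = (\<lambda>_. 0)"
  proof
    fix r show "act u (simple_root y) r = 0"
      using 0(7)[of r] 0(8)[of r] by simp
  qed
  then show ?case using root_nonzero 0 by blast
next
  case (Suc N)
  have n2: "2 \<le> n" using m_ge_2 Suc.prems by blast
  show ?case
  proof (cases "act u (simple_root y) = simple_root s")
    case True
    then show ?thesis by (intro exI[of _ 0]) (simp add: rho_simple n2)
  next
    case False
    have pos: "0 \<le> act ((s, True) # u) (simple_root y) r" for r
      using refl_nonneg[OF Suc.prems(5,6,1,7) False] by simp
    have neg: "act (rev (alternating N t s)) (act ((s, True) # u) (simple_root y)) r \<le> 0" for r
      using Suc.prems(8)[of r] by simp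
    have "\<exists>i<N. act ((s, True) # u) (simple_root y) = rho n (int i) t s"
      using Suc.prems m_sym[of s t] by (intro Suc.IH pos neg) auto
    then obtain i where i: "i < N" "refl_by s (act u (simple_root y)) = rho n (int i) t s" by auto
    have "rho n (int i) t s = refl_by s (rho n (int (Suc i)) s t)"
      using refl_rho[OF Suc.prems(1-4), of "int (Suc i)"] by simp
    then have "act u (simple_root y) = rho n (int (Suc i)) s t"
      using i(2) refl_refl[OF Suc.prems(1)] by metis
    then show ?thesis using i(1) by blast
  qed
qed

text \<open>The alternating word of length n sends both simple roots of the plane to negatives of
  simple roots, hence every nonnegative combination of them to a nonpositive vector.\<close>

lemma plane_root:
  assumes st: "s \<in> S" "t \<in> S" "s \<noteq> t" "m s t = enat n" and u: "u \<in> gwords S" "y \<in> S"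
    and pos: "\<And>r. 0 \<le> act u (simple_root y) r"
    and plane: "\<And>r. r \<noteq> s \<Longrightarrow> r \<noteq> t \<Longrightarrow> act u (simple_root y) r = 0"
  shows "\<exists>i<n. act u (simple_root y) = rho n (int i) s t"
proof (rule plane_root_aux[OF st u pos])
  have n2: "2 \<le> n" using m_ge_2 st by blast
  define a b where "a = act u (simple_root y) s" and "b = act u (simple_root y) t"
  have ab: "0 \<le> a" "0 \<le> b" by (simp_all add: a_def b_def pos)
  have "act u (simple_root y) = (\<lambda>r. a * rho n 0 s t r + b * rho n (int n - 1) s t r)"
    unfolding rho_simple[OF n2] using plane st(3) by (auto simp: fun_eq_iff a_def b_def simple_root_def)
  then have eq: "act (rev (alternating n s t)) (act u (simple_root y)) =
      (\<lambda>r. a * act (rev (alternating n s t)) (rho n 0 s t) r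
        + b * act (rev (alternating n s t)) (rho n (int n - 1) s t) r)"
    by (simp only: act_comb)
  have m1: "rho n (- 1) p q = (\<lambda>r. - simple_root q r)" for p q
    using sin_pi_pos[OF n2] by (simp add: rho_def span2_def)
  have "real_of_int (- int n + 1) * (pi / real n) = - (pi - pi / real n)"
    "real_of_int (- int n) * (pi / real n) = - pi" using n2 by (auto simp: field_simps)
  then have m2: "rho n (- int n) p q = (\<lambda>r. - simple_root p r)" for p q
    using sin_pi_pos[OF n2] unfolding rho_def span2_def by (simp only: sin_minus sin_pi_minus) simp
  show "act (rev (alternating n s t)) (act u (simple_root y)) r \<le> 0" for r
    unfolding eq act_rev_alternating_rho[OF st]
    using ab by (cases "even n") (auto simp: m1 m2 simple_root_def)
qed


text \<open>The state \<open>g\<close> is a word for the element \<open>w\<^sup>-\<^sup>1\<close> of the proof idea.\<close>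

definition hits :: "'s set \<Rightarrow> 's gword \<Rightarrow> 's \<Rightarrow> 's \<Rightarrow> bool"
  where "hits Y g s y \<longleftrightarrow> y \<in> Y \<and> act g (simple_root y) = simple_root s"

primrec run_state :: "'s set \<Rightarrow> 's gword \<Rightarrow> 's gword \<Rightarrow> 's gword"
where
  "run_state Y g [] = g"
| "run_state Y g (p # w) =
    (if \<exists>y. hits Y g (fst p) y then run_state Y g w else run_state Y ((fst p, True) # g) w)"

primrec run_out :: "'s set \<Rightarrow> 's gword \<Rightarrow> 's gword \<Rightarrow> 's gword"
where
  "run_out Y g [] = []"
| "run_out Y g (p # w) =
    (if \<exists>y. hits Y g (fst p) y then (THE y. hits Y g (fst p) y, snd p) # run_out Y g w
     else run_out Y ((fst p, True) # g) w)"

definition nonneg_state :: "'s set \<Rightarrow> 's gword \<Rightarrow> bool"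
  where "nonneg_state Y g \<longleftrightarrow> g \<in> gwords S \<and> (\<forall>y\<in>Y. \<forall>r. 0 \<le> act g (simple_root y) r)"

text \<open>Many words describe the same vectors, and the machine consults only the vectors.\<close>

definition state_eq :: "'s set \<Rightarrow> 's gword \<Rightarrow> 's gword \<Rightarrow> bool"
  where "state_eq Y g g' \<longleftrightarrow> (\<forall>y\<in>Y. act g (simple_root y) = act g' (simple_root y))"

lemma simple_root_inj: "simple_root y = simple_root z \<Longrightarrow> y = z"
  by (metis simple_root_def zero_neq_one)

lemma hits_unique: "g \<in> gwords S \<Longrightarrow> hits Y g s y \<Longrightarrow> hits Y g s z \<Longrightarrow> y = z"
  unfolding hits_def using act_inj simple_root_inj by metis

lemma hits_the: "g \<in> gwords S \<Longrightarrow> hits Y g s y \<Longrightarrow> (THE y. hits Y g s y) = y"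
  using hits_unique by blast

lemma run_state_append: "run_state Y g (u @ v) = run_state Y (run_state Y g u) v"
  by (induction u arbitrary: g) auto

lemma run_out_append: "run_out Y g (u @ v) = run_out Y g u @ run_out Y (run_state Y g u) v"
  by (induction u arbitrary: g) auto

lemma hits_cong: "state_eq Y g g' \<Longrightarrow> hits Y g s = hits Y g' s"
  by (auto simp: hits_def state_eq_def fun_eq_iff)

lemma run_cong:
  assumes "state_eq Y g g'"
  shows "run_out Y g w = run_out Y g' w \<and> state_eq Y (run_state Y g w) (run_state Y g' w)"
  using assms
proof (induction w arbitrary: g g')
  case (Cons p w)
  have "state_eq Y ((fst p, True) # g) ((fst p, True) # g')"
    using Cons.prems by (auto simp: state_eq_def)
  with Cons.IH Cons.prems show ?case by (simp add: hits_cong[OF Cons.prems])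
qed simp

lemma nonneg_state_step:
  assumes "nonneg_state Y g" "Y \<subseteq> S" "s \<in> S" "\<nexists>y. hits Y g s y"
  shows "nonneg_state Y ((s, True) # g)"
  using assms refl_nonneg[of g _ s] unfolding nonneg_state_def hits_def by (auto simp: subset_iff)

lemma nonneg_state_run: "nonneg_state Y g \<Longrightarrow> Y \<subseteq> S \<Longrightarrow> w \<in> gwords S \<Longrightarrow> nonneg_state Y (run_state Y g w)"
  by (induction w arbitrary: g) (auto intro: nonneg_state_step)

lemma run_out_gwords: "nonneg_state Y g \<Longrightarrow> Y \<subseteq> S \<Longrightarrow> w \<in> gwords S \<Longrightarrow> run_out Y g w \<in> gwords Y"
proof (induction w arbitrary: g)
  case (Cons p w)
  show ?case
  proof (cases "\<exists>y. hits Y g (fst p) y")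
    case True
    then obtain y where y: "hits Y g (fst p) y" by blast
    then have "(THE y. hits Y g (fst p) y) \<in> Y"
      using hits_the[OF _ y] Cons.prems(1) by (auto simp: nonneg_state_def hits_def)
    with Cons True show ?thesis by simp
  next
    case False
    with Cons nonneg_state_step show ?thesis by simp
  qed
qed simp

section \<open>The output on the two sides of a braid relation\<close>

definition off_plane :: "'s \<Rightarrow> 's \<Rightarrow> ('s \<Rightarrow> real) \<Rightarrow> bool"
  where "off_plane s t x \<longleftrightarrow> (\<exists>r. r \<noteq> s \<and> r \<noteq> t \<and> x r \<noteq> 0)"

lemma off_plane_refl: "off_plane s t x \<Longrightarrow> off_plane t s (refl_by s x)"
  by (auto simp: off_plane_def refl_other)

lemma off_plane_not_simple: "off_plane s t x \<Longrightarrow> x \<noteq> simple_root s"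
  by (auto simp: off_plane_def simple_root_def)

text \<open>The letters s and t never change the remaining coordinates, so a vector outside their
  plane does not become simple while they are read.\<close>

lemma run_off_plane:
  assumes "\<And>y. y \<in> Y \<Longrightarrow> off_plane s t (act g (simple_root y))"
  shows "run_out Y g (alternating k s t) = [] \<and>
    run_state Y g (alternating k s t) = rev (alternating k s t) @ g"
  using assms
proof (induction k arbitrary: s t g)
  case (Suc k)
  have "\<nexists>y. hits Y g s y" using Suc.prems off_plane_not_simple by (auto simp: hits_def)
  moreover have "off_plane t s (act ((s, True) # g) (simple_root y))" if "y \<in> Y" for y
    using Suc.prems[OF that] by (simp add: off_plane_refl)
  ultimately show ?case using Suc.IH[of t s "(s, True) # g"] by simp
qed simp

definition reflect :: "('s \<Rightarrow> real) \<Rightarrow> ('s \<Rightarrow> real) \<Rightarrow> 's \<Rightarrow> real"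
  where "reflect b x = (\<lambda>r. 1 * x r + (- 2 * B x b) * b r)"

lemma reflect_simple: "reflect (simple_root s) x = refl_by s x"
  by (simp add: reflect_def refl_alt)

text \<open>Conjugation by s turns the reflection in b into the reflection in the image of b,
  because s preserves the form.\<close>

lemma reflect_refl: "s \<in> S \<Longrightarrow> reflect (refl_by s b) (refl_by s x) = refl_by s (reflect b x)"
  unfolding reflect_def refl_comb by (simp add: B_refl)

text \<open>Each letter lowers the position \<open>i\<close> of the root by one and exchanges the roles of \<open>s\<close> and \<open>t\<close>;
  at position \<open>0\<close> there is an output, after which the position is \<open>n - 1\<close>. Skipping the letter that
  is output amounts to applying first the reflection in the root.\<close>

lemma run_one_in_plane:
  assumes "s \<in> S" "t \<in> S" "s \<noteq> t" "m s t = enat n" "g \<in> gwords S" "y \<in> Y"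
    and "\<And>z. z \<in> Y \<Longrightarrow> z \<noteq> y \<Longrightarrow> off_plane s t (act g (simple_root z))"
    and "act g (simple_root y) = rho n (int i) s t" "i < n" "k \<le> n"
  shows "run_out Y g (alternating k s t) = (if k \<le> i then [] else [(y, True)]) \<and>
    (\<forall>z\<in>Y. act (run_state Y g (alternating k s t)) (simple_root z) = act (rev (alternating k s t))
      (if k \<le> i then act g (simple_root z) else reflect (act g (simple_root y)) (act g (simple_root z))))"
  using assms
proof (induction k arbitrary: s t g i)
  case (Suc k)
  have n2: "2 \<le> n" using m_ge_2 Suc.prems by blast
  have ts: "m t s = enat n" using m_sym Suc.prems by simp
  show ?case
  proof (cases i)
    case 0
    have y: "act g (simple_root y) = simple_root s" using Suc.prems 0 by (simp add: rho_simple n2)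
    then have hit: "hits Y g s y" using Suc.prems by (simp add: hits_def)
    have "run_out Y g (alternating k t s) = (if k \<le> n - 1 then [] else [(y, True)]) \<and>
      (\<forall>z\<in>Y. act (run_state Y g (alternating k t s)) (simple_root z) = act (rev (alternating k t s))
        (if k \<le> n - 1 then act g (simple_root z) else reflect (act g (simple_root y)) (act g (simple_root z))))"
    proof (rule Suc.IH)
      show "act g (simple_root y) = rho n (int (n - 1)) t s"
        using rho_simple(2)[OF n2, of t s] n2 by (simp add: y of_nat_diff)
      show "off_plane t s (act g (simple_root z))" if "z \<in> Y" "z \<noteq> y" for z
        using Suc.prems(7)[OF that] by (auto simp: off_plane_def)
    qed (use Suc.prems ts n2 in auto)
    \<comment> \<open>At most n letters are read in all, too few for the root to descend from
      position n - 1 to a second output.\<close>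
    moreover have "k \<le> n - 1" using Suc.prems n2 by simp
    moreover have "\<exists>y. hits Y g s y" using hit by blast
    ultimately show ?thesis
      using hits_the[OF Suc.prems(5) hit] 0 Suc.prems(1) by (simp add: y reflect_simple)
  next
    case (Suc j)
    have "\<not> hits Y g s z" for z
    proof (cases "z = y")
      case True
      then show ?thesis using rho_nonsimple[OF n2 \<open>s \<noteq> t\<close>, of "int i"] Suc.prems(8,9) Suc
        by (simp add: hits_def)
    next
      case False
      then show ?thesis using Suc.prems(7)[of z] off_plane_not_simple by (auto simp: hits_def)
    qed
    then have no: "\<nexists>z. hits Y g s z" by blast
    let ?g = "(s, True) # g"
    have "run_out Y ?g (alternating k t s) = (if k \<le> j then [] else [(y, True)]) \<and>
      (\<forall>z\<in>Y. act (run_state Y ?g (alternating k t s)) (simple_root z) = act (rev (alternating k t s))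
        (if k \<le> j then act ?g (simple_root z) else reflect (act ?g (simple_root y)) (act ?g (simple_root z))))"
    proof (rule Suc.IH)
      show "act ?g (simple_root y) = rho n (int j) t s"
        using refl_rho[OF Suc.prems(1-4), of "int i"] Suc by (simp add: Suc.prems(8))
      show "off_plane t s (act ?g (simple_root z))" if "z \<in> Y" "z \<noteq> y" for z
        using Suc.prems(7)[OF that] by (simp add: off_plane_refl)
    qed (use Suc.prems ts Suc in auto)
    then show ?thesis using no Suc Suc.prems(1) by (simp add: reflect_refl)
  qed
qed simp

lemma run_two_in_plane:
  assumes "g \<in> gwords S" "hits Y g s y" "hits Y g t z"
  shows "run_out Y g (alternating k s t) = alternating k y z \<and> run_state Y g (alternating k s t) = g"
  using assms
proof (induction k arbitrary: s t y z)
  case (Suc k)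
  moreover have "\<exists>y. hits Y g s y" using Suc.prems by blast
  ultimately show ?case using hits_the[OF Suc.prems(1,2)] by simp
qed simp

text \<open>If two vectors of the state lie in the plane of \<open>s\<close> and \<open>t\<close>, then \<open>e\<^sub>s\<close> and \<open>e\<^sub>t\<close> are nonnegative
  combinations of them and conversely, so they are \<open>e\<^sub>s\<close> and \<open>e\<^sub>t\<close> themselves.\<close>

lemma two_in_plane:
  assumes g: "nonneg_state Y g" "Y \<subseteq> S" and st: "s \<in> S" "t \<in> S" "s \<noteq> t"
    and yz: "y \<in> Y" "z \<in> Y" "y \<noteq> z"
    and pl: "\<not> off_plane s t (act g (simple_root y))" "\<not> off_plane s t (act g (simple_root z))"
  shows "hits Y g s y \<or> hits Y g s z"
proof -
  define p where "p = act g (simple_root y)"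
  define q where "q = act g (simple_root z)"
  have gS: "g \<in> gwords S" and yzS: "y \<in> S" "z \<in> S" using g yz by (auto simp: nonneg_state_def)
  have pos: "0 \<le> p r" "0 \<le> q r" for r using g(1) yz by (auto simp: nonneg_state_def p_def q_def)
  have supp: "p r = 0" "q r = 0" if "r \<noteq> s" "r \<noteq> t" for r
    using pl that by (auto simp: off_plane_def p_def q_def)
  have indep: "a = 0 \<and> b = 0" if "\<And>r. a * p r + b * q r = 0" for a b
  proof -
    have "act g (\<lambda>r. a * simple_root y r + b * simple_root z r) = act g (\<lambda>r. 0 * simple_root y r + 0 * simple_root y r)"
      unfolding act_comb using that by (simp add: p_def q_def)
    from act_inj[OF gS this] have "a * simple_root y r + b * simple_root z r = 0" for r
      by (metis add.right_neutral mult_zero_left)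
    from this[of y] this[of z] show ?thesis using yz by (simp add: simple_root_def split: if_splits)
  qed
  define d where "d = p s * q t - q s * p t"
  have d0: "d \<noteq> 0"
  proof
    assume d: "d = 0"
    have "q t * p r + (- p t) * q r = 0" for r
      using d supp[of r] by (cases "r = s"; cases "r = t") (auto simp: d_def algebra_simps)
    from indep[OF this] have 1: "q t = 0" "p t = 0" by auto
    have "q s * p r + (- p s) * q r = 0" for r
      using 1 supp[of r] by (cases "r = s"; cases "r = t") (auto simp: algebra_simps)
    from indep[OF this] have "p s = 0" by auto
    with 1 supp have "p r = 0" for r by (cases "r = s"; cases "r = t") auto
    then have "p = (\<lambda>_. 0)" by (simp add: fun_eq_iff)
    then show False using root_nonzero[OF gS yzS(1)] by (simp add: p_def)
  qed
  \<comment> \<open>Cramer's rule for expressing \<open>simple_root s\<close> through p and q, with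
    determinant d.\<close>
  define a where "a = q t / d"
  define b where "b = - p t / d"
  have es: "simple_root s = (\<lambda>r. a * p r + b * q r)"
  proof
    fix r
    have "a * p s + b * q s = (p s * q t - q s * p t) / d"
      by (simp add: a_def b_def diff_divide_distrib mult.commute)
    then have "a * p s + b * q s = 1" using d0 by (simp add: d_def[symmetric])
    moreover have "a * p t + b * q t = 0" by (simp add: a_def b_def)
    ultimately show "simple_root s r = a * p r + b * q r"
      using supp[of r] by (cases "r = s"; cases "r = t") (auto simp: simple_root_def st)
  qed
  have "act g (\<lambda>r. a * simple_root y r + b * simple_root z r) = simple_root s"
    unfolding act_comb es by (simp add: p_def q_def)
  then have inv: "act (rev g) (simple_root s) = (\<lambda>r. a * simple_root y r + b * simple_root z r)"
    using act_rev_act[OF gS] by metis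
  \<comment> \<open>Pulled back by g, the simple root of s is again a root, and its coordinates at y
    and z are a and b.\<close>
  have "(0 \<le> a \<and> 0 \<le> b) \<or> (a \<le> 0 \<and> b \<le> 0)"
    using root_sign[of "rev g" s] gS st(1) yz(3) unfolding inv
    by (auto simp: simple_root_def dest: spec[of _ y] spec[of _ z])
  moreover have "a * p s + b * q s = 1" using fun_cong[OF es, of s] by (simp add: simple_root_def)
  ultimately have ab: "0 \<le> a" "0 \<le> b"
    using pos[of s] mult_nonpos_nonneg[of a "p s"] mult_nonpos_nonneg[of b "q s"] by linarith+
  have "a \<noteq> 0 \<or> b \<noteq> 0" using \<open>a * p s + b * q s = 1\<close> by auto
  moreover have "a * p t + b * q t = 0" using fun_cong[OF es, of t] st by (simp add: simple_root_def)
  then have "a * p t = 0 \<and> b * q t = 0"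
    using ab pos[of t] by (simp add: add_nonneg_eq_0_iff)
  ultimately have "p t = 0 \<or> q t = 0" by auto
  then show ?thesis
  proof
    assume "p t = 0"
    then have "act g (simple_root y) = simple_root s"
      using supp pos[of s] by (intro root_eq_simple gS yzS st) (auto simp flip: p_def)
    then show ?thesis using yz by (simp add: hits_def)
  next
    assume "q t = 0"
    then have "act g (simple_root z) = simple_root s"
      using supp pos[of s] by (intro root_eq_simple gS yzS st) (auto simp flip: q_def)
    then show ?thesis using yz by (simp add: hits_def)
  qed
qed

text \<open>Cosine is injective on the interval from 0 to \<pi>, and infinity corresponds to the
  angle 0. An entry of the Coxeter matrix can thus be recovered from the form.\<close>

lemma cox_coeff_inj:
  assumes "2 \<le> n" "cox_coeff a = cox_coeff (enat n)" "2 \<le> a"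
  shows "a = enat n"
proof -
  have bounds: "0 < pi / real j" "pi / real j \<le> pi" if "2 \<le> j" for j :: nat
    using that by (auto simp: field_simps)
  note n = bounds[OF assms(1)]
  show ?thesis
  proof (cases a)
    case (enat k)
    then have k: "2 \<le> k" using assms(3) by (simp add: numeral_eq_enat)
    have "cos (pi / real k) = cos (pi / real n)"
      using assms(2) by (simp add: enat cox_coeff_def)
    from cos_inj_pi[OF _ _ _ _ this] have "pi / real k = pi / real n"
      using bounds[OF k] n by simp
    then show ?thesis by (simp add: enat)
  next
    case infinity
    then have "cos (pi / real n) = cos 0"
      using assms(2) by (simp add: cox_coeff_def)
    from cos_inj_pi[OF _ _ _ _ this] have "pi / real n = 0" using n by simp
    then show ?thesis using n(1) by linarith
  qed
qed

text \<open>The cases count the vectors of the state in the plane of s and t. With none there is no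
  output; with exactly one, both words output the same single letter. With more, the simple roots of
  s and t come from some p and q in Y. Since g preserves the form, m p q = m s t, and the two
  outputs are the sides of a braid relation of Y.\<close>

lemma run_alternating_swap:
  assumes g: "nonneg_state Y g" "Y \<subseteq> S" and st: "s \<in> S" "t \<in> S" "s \<noteq> t" "m s t = enat n"
  shows "state_eq Y (run_state Y g (alternating n s t)) (run_state Y g (alternating n t s)) \<and>
    pres_eq Y (artin_rels Y m) (run_out Y g (alternating n s t)) (run_out Y g (alternating n t s))"
proof -
  have gS: "g \<in> gwords S" using g by (simp add: nonneg_state_def)
  have ts: "m t s = enat n" using m_sym st by simp
  have n2: "2 \<le> n" using m_ge_2 st by blast
  have off_swap: "off_plane s t x \<longleftrightarrow> off_plane t s x" for x by (auto simp: off_plane_def)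
  have nil: "pres_eq Y (artin_rels Y m) [] []" by (rule pres_refl) simp
  show ?thesis
  proof (cases "\<exists>y\<in>Y. \<not> off_plane s t (act g (simple_root y))")
    case False
    then show ?thesis
      using run_off_plane[of Y s t g n] run_off_plane[of Y t s g n] off_swap nil
        act_rev_alternating_braid[OF st] by (simp add: state_eq_def)
  next
    case True
    then obtain y where y: "y \<in> Y" "\<not> off_plane s t (act g (simple_root y))" by blast
    show ?thesis
    proof (cases "\<exists>z\<in>Y. z \<noteq> y \<and> \<not> off_plane s t (act g (simple_root z))")
      case False
      have yS: "y \<in> S" using y g by auto
      have "\<exists>i<n. act g (simple_root y) = rho n (int i) s t"
        using y g by (intro plane_root[OF st gS yS]) (auto simp: nonneg_state_def off_plane_def)
      then obtain i where i: "i < n" "act g (simple_root y) = rho n (int i) s t" by blast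
      have i': "act g (simple_root y) = rho n (int (n - 1 - i)) t s"
      proof -
        have "int (n - 1 - i) = int n - 1 - int i" using i(1) by simp
        then show ?thesis using rho_swap[OF n2, of "int i" t s] i(2) by (simp only:)
      qed
      have off: "off_plane s t (act g (simple_root z))" "off_plane t s (act g (simple_root z))"
        if "z \<in> Y" "z \<noteq> y" for z
        using False that off_swap by blast+
      have 1: "run_out Y g (alternating n s t) = [(y, True)] \<and>
          (\<forall>z\<in>Y. act (run_state Y g (alternating n s t)) (simple_root z) =
            act (rev (alternating n s t)) (reflect (act g (simple_root y)) (act g (simple_root z))))"
        using run_one_in_plane[OF st gS y(1) off(1) i(2,1) le_refl] i(1) by simp
      have 2: "run_out Y g (alternating n t s) = [(y, True)] \<and>
          (\<forall>z\<in>Y. act (run_state Y g (alternating n t s)) (simple_root z) =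
            act (rev (alternating n t s)) (reflect (act g (simple_root y)) (act g (simple_root z))))"
        using run_one_in_plane[OF st(2,1) st(3)[symmetric] ts gS y(1) off(2) i' _ le_refl] i(1) by simp
      show ?thesis
        using 1 2 y(1) act_rev_alternating_braid[OF st] by (auto simp: state_eq_def intro!: pres_refl)
    next
      case True
      then obtain z where z: "z \<in> Y" "z \<noteq> y" "\<not> off_plane s t (act g (simple_root z))" by blast
      have "hits Y g s y \<or> hits Y g s z"
        using two_in_plane[OF g st(1-3) y(1) z(1) _ y(2) z(3)] z(2) by blast
      moreover have "hits Y g t y \<or> hits Y g t z"
        using two_in_plane[OF g st(2,1) st(3)[symmetric] y(1) z(1), unfolded off_swap[symmetric], OF _ y(2) z(3)] z(2)
        by blast
      moreover have st_eq: "s = t" if "hits Y g s w" "hits Y g t w" for w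
      proof (rule simple_root_inj)
        show "simple_root s = simple_root t"
          by (rule trans[OF sym[OF conjunct2[OF that(1)[unfolded hits_def]]] conjunct2[OF that(2)[unfolded hits_def]]])
      qed
      ultimately obtain p q where pq: "hits Y g s p" "hits Y g t q" using st(3) by blast
      have pqY: "p \<in> Y" "q \<in> Y" using pq by (auto simp: hits_def)
      then have pqS: "p \<in> S" "q \<in> S" using g by auto
      have "p \<noteq> q" using pq st_eq st(3) by blast
      have "B (simple_root p) (simple_root q) = B (simple_root s) (simple_root t)"
        using B_act[OF gS, of "simple_root p" "simple_root q"] pq by (simp add: hits_def)
      then have "cox_coeff (m p q) = cox_coeff (enat n)" using pqS st by (simp add: B_simple)
      moreover have "2 \<le> m p q" using coxeter pqS \<open>p \<noteq> q\<close> by (simp add: coxeter_matrix_def)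
      ultimately have "m p q = enat n" using cox_coeff_inj n2 by blast
      then have "(alternating n p q, alternating n q p) \<in> artin_rels Y m"
        using pqY \<open>p \<noteq> q\<close> by (auto simp: artin_rels_def)
      then have "pres_eq Y (artin_rels Y m) (alternating n p q) (alternating n q p)"
        using pqY by (intro pres_rel) auto
      then show ?thesis
        using run_two_in_plane[OF gS pq, of n] run_two_in_plane[OF gS pq(2,1), of n]
        by (simp add: state_eq_def)
    qed
  qed
qed

lemma run_pres_eq:
  assumes "pres_eq S (artin_rels S m) u v" "nonneg_state Y g" "Y \<subseteq> S"
  shows "state_eq Y (run_state Y g u) (run_state Y g v) \<and>
    pres_eq Y (artin_rels Y m) (run_out Y g u) (run_out Y g v)"
  using assms(1,2)
proof (induction arbitrary: g rule: pres_eq.induct)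
  case (pres_refl u)
  then show ?case using assms(3) run_out_gwords by (auto simp: state_eq_def intro: pres_eq.pres_refl)
next
  case (pres_sym u v)
  then show ?case by (auto simp: state_eq_def intro: pres_eq.pres_sym)
next
  case (pres_trans u v w)
  then show ?case unfolding state_eq_def by (metis pres_eq.pres_trans)
next
  case (pres_append u u' v v')
  have u: "state_eq Y (run_state Y g u) (run_state Y g u')"
    "pres_eq Y (artin_rels Y m) (run_out Y g u) (run_out Y g u')" using pres_append by auto
  have "nonneg_state Y (run_state Y g u)"
    using pres_append assms(3) pres_eq_gwords nonneg_state_run by blast
  then have v: "state_eq Y (run_state Y (run_state Y g u) v) (run_state Y (run_state Y g u) v')"
    "pres_eq Y (artin_rels Y m) (run_out Y (run_state Y g u) v) (run_out Y (run_state Y g u) v')"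
    using pres_append by auto
  from run_cong[OF u(1), of v'] v u(2) show ?case
    unfolding run_out_append run_state_append state_eq_def by (auto intro: pres_eq.pres_append)
next
  case (pres_cancel s b)
  have gS: "g \<in> gwords S" using pres_cancel by (simp add: nonneg_state_def)
  show ?case
  proof (cases "\<exists>y. hits Y g s y")
    case True
    then obtain y where y: "hits Y g s y" by blast
    then have "y \<in> Y" by (simp add: hits_def)
    then show ?thesis
      using True hits_the[OF gS y] by (auto simp: state_eq_def intro: pres_eq.pres_cancel)
  next
    case False
    \<comment> \<open>An output at the second letter would mean that the vector was the negative of
      \<open>simple_root s\<close> before the first letter, whereas all vectors of the state are
      nonnegative. So the second letter undoes the first.\<close>
    have "\<not> hits Y ((s, True) # g) s y" for y
    proof
      assume y: "hits Y ((s, True) # g) s y"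
      then have "refl_by s (act g (simple_root y)) = simple_root s" by (simp add: hits_def)
      then have "act g (simple_root y) = refl_by s (simple_root s)"
        using refl_refl[OF pres_cancel(1)] by metis
      then have "act g (simple_root y) s = - simple_root s s"
        unfolding refl_simple[OF pres_cancel(1)] by (rule fun_cong)
      then have "act g (simple_root y) s = -1"
        by (simp only: simple_root_def if_True simp_thms)
      moreover have "0 \<le> act g (simple_root y) s"
        using y pres_cancel(2) by (simp add: nonneg_state_def hits_def)
      ultimately show False by simp
    qed
    then show ?thesis using False pres_cancel(1) by (auto simp: state_eq_def intro: pres_eq.pres_refl)
  qed
next
  case (pres_rel u v)
  then obtain s t n where "u = alternating n s t" "v = alternating n t s" "s \<in> S" "t \<in> S" "s \<noteq> t" "m s t = enat n"
    by (auto simp: artin_rels_def)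
  then show ?case using run_alternating_swap[OF pres_rel.prems assms(3)] by simp
qed


section \<open>The retraction and injectivity of parabolic inclusions\<close>

definition retract :: "'s set \<Rightarrow> 's gword \<Rightarrow> 's gword"
  where "retract Y w = run_out Y [] w"

lemma nonneg_state_Nil: "nonneg_state Y []"
  by (simp add: nonneg_state_def simple_root_def)

lemma retract_cong:
  assumes "Y \<subseteq> S" "pres_eq S (artin_rels S m) u v"
  shows "pres_eq Y (artin_rels Y m) (retract Y u) (retract Y v)"
  using run_pres_eq[OF assms(2) nonneg_state_Nil assms(1)] by (simp add: retract_def)

lemma retract_gwords: "Y \<subseteq> S \<Longrightarrow> w \<in> gwords S \<Longrightarrow> retract Y w \<in> gwords Y"
  unfolding retract_def using nonneg_state_Nil run_out_gwords by blast

text \<open>In the initial state the vectors are the simple roots themselves, so a letter from Y is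
  copied to the output and leaves the state unchanged.\<close>

lemma retract_append_left:
  assumes "Y \<subseteq> S" "y \<in> gwords Y" shows "retract Y (y @ w) = y @ retract Y w"
proof -
  have "run_out Y [] y = y \<and> run_state Y [] y = []" using assms(2)
  proof (induction y)
    case (Cons p y)
    then have "hits Y [] (fst p) (fst p)" by (simp add: hits_def)
    with Cons hits_the[OF _ this] show ?case by (auto intro: exI[of _ "fst p"])
  qed simp
  then show ?thesis by (simp add: retract_def run_out_append)
qed

lemma retract_id: "Y \<subseteq> S \<Longrightarrow> y \<in> gwords Y \<Longrightarrow> retract Y y = y"
  using retract_append_left[of Y y "[]"] by (simp add: retract_def)

lemma artin_pres_eq_mono:
  assumes "X \<subseteq> Z" "pres_eq X (artin_rels X m) u v"
  shows "pres_eq Z (artin_rels Z m) u v"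
  using assms(2)
proof induction
  case (pres_refl u)
  then have "u \<in> gwords Z" using assms(1) by (auto simp: gwords_def)
  then show ?case by (rule pres_eq.pres_refl)
next
  case (pres_rel u v)
  then have "(u, v) \<in> artin_rels Z m" "u \<in> gwords Z" "v \<in> gwords Z"
    using assms(1) by (auto simp: artin_rels_def gwords_def)
  then show ?case by (rule pres_eq.pres_rel)
qed (use assms(1) in \<open>auto simp: gwords_def intro: pres_eq.intros\<close>)

text \<open>The retraction turns a derivation over S into one over X and fixes the words over X.
  This is van der Lek's theorem for standard parabolic subgroups.\<close>

lemma artin_pres_eq_restrict:
  assumes "X \<subseteq> S" "u \<in> gwords X" "v \<in> gwords X" "pres_eq S (artin_rels S m) u v"
  shows "pres_eq X (artin_rels X m) u v"
  using retract_cong[OF assms(1,4)] retract_id[OF assms(1)] assms(2,3) by simp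

end

section \<open>Computability of the retractions\<close>

text \<open>Induction on I. If some nonzero multiple d of c a is an integer combination of the
  others, multiplying by d eliminates c a, and the equations for I are substituted accordingly.
  Otherwise every relation has v a = 0, which becomes one more equation.\<close>

lemma integer_relations:
  fixes c :: "'i \<Rightarrow> real"
  assumes "finite I"
  shows "\<exists>K. finite K \<and> (\<forall>v :: 'i \<Rightarrow> int. (\<Sum>i\<in>I. of_int (v i) * c i) = 0 \<longleftrightarrow> (\<forall>f\<in>K. (\<Sum>i\<in>I. f i * v i) = 0))"
  using assms
proof (induction I rule: finite_induct)
  case empty
  then show ?case by (intro exI[of _ "{}"]) simp
next
  case (insert a I)
  then obtain K where K: "finite K"
    "\<And>v. (\<Sum>i\<in>I. of_int (v i) * c i) = 0 \<longleftrightarrow> (\<forall>f\<in>K. (\<Sum>i\<in>I. f i * v i) = 0)" by blast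
  show ?case
  proof (cases "\<exists>d n. d \<noteq> 0 \<and> of_int d * c a = (\<Sum>i\<in>I. of_int (n i) * c i)")
    case True
    then obtain d n where dn: "d \<noteq> 0" "of_int d * c a = (\<Sum>i\<in>I. of_int (n i) * c i)" by blast
    let ?g = "\<lambda>f i. if i = a then (\<Sum>i\<in>I. f i * n i) else d * f i"
    have "(\<Sum>i\<in>insert a I. of_int (v i) * c i) = 0 \<longleftrightarrow> (\<forall>f\<in>?g ` K. (\<Sum>i\<in>insert a I. f i * v i) = 0)"
      for v :: "'i \<Rightarrow> int"
    proof -
      have "of_int d * (\<Sum>i\<in>insert a I. of_int (v i) * c i) = (\<Sum>i\<in>I. of_int (d * v i + n i * v a) * c i)"
      proof -
        have "of_int d * (\<Sum>i\<in>insert a I. of_int (v i) * c i)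
            = of_int (v a) * (of_int d * c a) + of_int d * (\<Sum>i\<in>I. of_int (v i) * c i)"
          using insert by (simp add: algebra_simps)
        then show ?thesis
          unfolding dn(2) by (simp add: sum_distrib_left sum.distrib algebra_simps)
      qed
      moreover have "x = 0 \<longleftrightarrow> y = 0" if "of_int d * x = y" for x y :: real
        using that dn(1) by auto
      ultimately have "(\<Sum>i\<in>insert a I. of_int (v i) * c i) = 0 \<longleftrightarrow> (\<Sum>i\<in>I. of_int (d * v i + n i * v a) * c i) = 0"
        by blast
      also have "\<dots> \<longleftrightarrow> (\<forall>f\<in>K. (\<Sum>i\<in>I. f i * (d * v i + n i * v a)) = 0)"
        by (rule K(2))
      also have "\<dots> \<longleftrightarrow> (\<forall>f\<in>K. (\<Sum>i\<in>insert a I. ?g f i * v i) = 0)"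
      proof -
        have "(\<Sum>i\<in>insert a I. ?g f i * v i) = (\<Sum>i\<in>I. f i * (d * v i + n i * v a))" for f :: "'i \<Rightarrow> int"
        proof -
          have "(\<Sum>i\<in>I. ?g f i * v i) = (\<Sum>i\<in>I. d * f i * v i)"
            using insert(2) by (intro sum.cong) auto
          then have "(\<Sum>i\<in>insert a I. ?g f i * v i) = (\<Sum>i\<in>I. f i * n i) * v a + (\<Sum>i\<in>I. d * f i * v i)"
            using insert(1,2) by simp
          also have "\<dots> = (\<Sum>i\<in>I. f i * (d * v i + n i * v a))"
            unfolding sum_distrib_right sum.distrib[symmetric] by (intro sum.cong) (auto simp: algebra_simps)
          finally show ?thesis .
        qed
        then show ?thesis by (simp only:)
      qed
      finally show ?thesis by (simp only: ball_simps)
    qed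
    then show ?thesis using K(1) by (intro exI[of _ "?g ` K"] conjI finite_imageI allI)
  next
    case False
    let ?g = "\<lambda>f i. if i = a then 0 else f i :: int"
    let ?e = "\<lambda>i. if i = a then 1 else 0 :: int"
    have "(\<Sum>i\<in>insert a I. of_int (v i) * c i) = 0 \<longleftrightarrow> (\<forall>f\<in>insert ?e (?g ` K). (\<Sum>i\<in>insert a I. f i * v i) = 0)"
      for v :: "'i \<Rightarrow> int"
    proof -
      have e: "(\<Sum>i\<in>insert a I. ?e i * v i) = v a"
        using insert(1) by (simp add: if_distrib if_distribR sum.delta cong: if_cong)
      have g: "(\<Sum>i\<in>insert a I. ?g f i * v i) = (\<Sum>i\<in>I. f i * v i)" for f
        using insert(1,2) by (simp, intro sum.cong) auto
      have 1: "v a = 0" if "(\<Sum>i\<in>insert a I. of_int (v i) * c i) = 0"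
      proof (rule ccontr)
        assume "v a \<noteq> 0"
        moreover have "of_int (v a) * c a = (\<Sum>i\<in>I. of_int (- v i) * c i)"
          using that insert(1,2) by (simp add: sum_negf)
        ultimately have "\<exists>d n. d \<noteq> 0 \<and> of_int d * c a = (\<Sum>i\<in>I. of_int (n i) * c i)"
          by (intro exI[of _ "v a"] exI[of _ "\<lambda>i. - v i"] conjI)
        with False show False by (rule notE)
      qed
      have 2: "(\<Sum>i\<in>insert a I. of_int (v i) * c i) = (\<Sum>i\<in>I. of_int (v i) * c i)" if "v a = 0"
        unfolding sum.insert[OF insert(1,2)] that by simp
      have "(\<Sum>i\<in>insert a I. of_int (v i) * c i) = 0 \<longleftrightarrow> v a = 0 \<and> (\<Sum>i\<in>I. of_int (v i) * c i) = 0"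
      proof (intro iffI conjI)
        assume A: "(\<Sum>i\<in>insert a I. of_int (v i) * c i) = 0"
        show "v a = 0" by (rule 1[OF A])
        show "(\<Sum>i\<in>I. of_int (v i) * c i) = 0" using A unfolding 2[OF 1[OF A]] .
      next
        assume A: "v a = 0 \<and> (\<Sum>i\<in>I. of_int (v i) * c i) = 0"
        show "(\<Sum>i\<in>insert a I. of_int (v i) * c i) = 0"
          unfolding 2[OF conjunct1[OF A]] by (rule conjunct2[OF A])
      qed
      then show ?thesis unfolding K(2) ball_simps e g .
    qed
    then show ?thesis using K(1) by (intro exI[of _ "insert ?e (?g ` K)"] conjI finite_insert[THEN iffD2] finite_imageI allI)
  qed
qed

text \<open>The finite set K is part of the program, so the reals c need not be given effectively.
  Moving negative coefficients to the other side leaves equalities of natural numbers to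
  test.\<close>

lemma computable_relation:
  fixes c :: "'i \<Rightarrow> real"
  assumes "finite I" "\<And>i. i \<in> I \<Longrightarrow> computable E nat_code (f i)"
  shows "computable E bool_code (\<lambda>x. (\<Sum>i\<in>I. real (f i x) * c i) = 0)"
proof -
  obtain K where K: "finite K"
    "\<And>v. (\<Sum>i\<in>I. of_int (v i) * c i) = 0 \<longleftrightarrow> (\<forall>f\<in>K. (\<Sum>i\<in>I. f i * v i) = 0)"
    using integer_relations[OF assms(1), of c] by blast
  have split: "(\<Sum>i\<in>I. g i * int (f i x)) = 0 \<longleftrightarrow>
      (\<Sum>i\<in>I. nat (g i) * f i x) = (\<Sum>i\<in>I. nat (- g i) * f i x)" for g x
  proof -
    have "int (nat (g i)) - int (nat (- g i)) = g i" for i by simp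
    then have "(\<Sum>i\<in>I. g i * int (f i x)) = (\<Sum>i\<in>I. (int (nat (g i)) - int (nat (- g i))) * int (f i x))"
      by (simp only:)
    also have "\<dots> = int (\<Sum>i\<in>I. nat (g i) * f i x) - int (\<Sum>i\<in>I. nat (- g i) * f i x)"
      by (simp only: left_diff_distrib sum_subtractf of_nat_sum of_nat_mult)
    finally show ?thesis by linarith
  qed
  have "(\<Sum>i\<in>I. real (f i x) * c i) = 0 \<longleftrightarrow>
      (\<forall>g\<in>K. (\<Sum>i\<in>I. nat (g i) * f i x) = (\<Sum>i\<in>I. nat (- g i) * f i x))" for x
    using K(2)[of "\<lambda>i. int (f i x)"] split by simp
  moreover have "computable E bool_code (\<lambda>x. \<forall>g\<in>K. (\<Sum>i\<in>I. nat (g i) * f i x) = (\<Sum>i\<in>I. nat (- g i) * f i x))"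
    by (intro computable_Ball[OF K(1)] computable_nat_eq computable_sum computable_mult_const assms(2))
  ultimately show ?thesis by simp
qed

definition vec_code :: "'i list \<Rightarrow> ('i \<Rightarrow> nat) coding"
  where "vec_code ixs n v \<longleftrightarrow> list_code nat_code n (map v ixs)"

lemma computable_vec:
  assumes "\<And>i. i \<in> set ixs \<Longrightarrow> computable E nat_code (\<lambda>x. f x i)"
  shows "computable E (vec_code ixs) f"
proof -
  have "computable E (list_code nat_code) (\<lambda>x. map (f x) ixs)"
    using assms by (induction ixs) (auto intro: computable_Nil computable_Cons)
  then show ?thesis by (simp add: computable_def vec_code_def)
qed

lemma computable_vec_nth:
  assumes "i \<in> set ixs" shows "computable (vec_code ixs) nat_code (\<lambda>v. v i)"
proof -
  let ?L = "list_code nat_code"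
  have "computable ?L ?L (\<lambda>xs. case xs of [] \<Rightarrow> [] | y # ys \<Rightarrow> ys)"
    by (rule computable_case_list[OF computable_id computable_Nil])
      (rule computable_snd[OF computable_snd[OF computable_id]])
  moreover have "(\<lambda>xs. case xs of [] \<Rightarrow> [] | y # ys \<Rightarrow> ys) = (tl :: nat list \<Rightarrow> nat list)"
    by (auto simp: fun_eq_iff split: list.split)
  ultimately have tl: "computable ?L ?L tl" by simp
  have drop: "computable ?L ?L (drop k)" for k
  proof (induction k)
    case (Suc k)
    from computable_comp[OF Suc tl] show ?case by (simp add: drop_Suc[abs_def])
  next
    case 0
    then show ?case using computable_id[of ?L] by (simp add: drop_0[abs_def])
  qed
  have "computable ?L nat_code (\<lambda>xs. case xs of [] \<Rightarrow> 0 | y # ys \<Rightarrow> y)"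
    by (rule computable_case_list[OF computable_id computable_nat_const])
      (rule computable_fst[OF computable_snd[OF computable_id]])
  from computable_comp[OF this drop]
  have nth: "computable ?L nat_code (\<lambda>xs. case drop k xs of [] \<Rightarrow> 0 | y # ys \<Rightarrow> y)" for k .
  have vec: "computable (vec_code ixs) ?L (\<lambda>v. map v ixs)"
    unfolding computable_def vec_code_def using rec1_id by blast
  obtain k where k: "k < length ixs" "ixs ! k = i" using assms by (metis in_set_conv_nth)
  have "(case drop k (map v ixs) of [] \<Rightarrow> 0 | y # ys \<Rightarrow> y) = v i" for v :: "_ \<Rightarrow> nat"
    using k Cons_nth_drop_Suc[of k "map v ixs", symmetric] by (simp del: drop_map)
  with computable_comp[OF nth[of k] vec] show ?thesis by (simp only:)
qed

locale coded_coxeter_system = coxeter_system S m for S :: "'s set" and m +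
  fixes c :: "'s \<times> bool \<Rightarrow> nat"
  assumes inj_c: "inj_on c (S \<times> UNIV)"
begin

abbreviation letter_code :: "('s \<times> bool) coding"
  where "letter_code \<equiv> fin_code c (S \<times> UNIV)"

abbreviation word_code :: "'s gword coding"
  where "word_code \<equiv> list_code letter_code"

lemma word_code_gwords: "word_code n w \<Longrightarrow> w \<in> gwords S"
proof -
  assume "word_code n w"
  then obtain ns where "list_all2 letter_code ns w" by (auto simp: list_code_def)
  then show "w \<in> gwords S" by (induction rule: list_all2_induct) (auto simp: fin_code_def)
qed

lemma finite_letters: "finite (S \<times> (UNIV :: bool set))"
  using finite_S by simp

lemma computable_letter_case:
  assumes "\<And>a. a \<in> S \<times> UNIV \<Longrightarrow> computable E C (f a)"
  shows "computable (letter_code \<otimes>\<^sub>c E) C (\<lambda>p. f (fst p) (snd p))"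
  by (rule computable_finite_case[OF finite_letters inj_c assms])

text \<open>With \<open>N = period\<close>, twice the coordinates of a root are combinations of the numbers
  \<open>2 cos (j \<pi> / N)\<close>, \<open>0 \<le> j < 2 N\<close>, with natural coefficients: the product of two such numbers is
  a sum of two such numbers, and \<open>j = N\<close> provides the negative numbers. Equality of such
  combinations is tested by finitely many rational linear equations.\<close>

definition period :: nat
  where "period = (\<Prod>p\<in>S \<times> S. case m (fst p) (snd p) of enat k \<Rightarrow> k | \<infinity> \<Rightarrow> 1)"

text \<open>The value 0 at infinity makes \<open>cos2\<close> equal to 2, which is -2 times the
  coefficient -1 of the form.\<close>

definition angle :: "'s \<Rightarrow> 's \<Rightarrow> nat"
  where "angle s t = (case m s t of enat k \<Rightarrow> period div k | \<infinity> \<Rightarrow> 0)"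

definition cos2 :: "nat \<Rightarrow> real"
  where "cos2 j = 2 * cos (real j * pi / real period)"

lemma m_pos: "s \<in> S \<Longrightarrow> t \<in> S \<Longrightarrow> m s t = enat k \<Longrightarrow> 0 < k"
  using m_ge_2[of s t k] m_self[of s] by (cases "s = t") (auto simp: one_enat_def)

lemma period_pos: "0 < period"
  unfolding period_def by (intro prod_pos) (auto split: enat.split dest: m_pos)

lemma dvd_period: "s \<in> S \<Longrightarrow> t \<in> S \<Longrightarrow> m s t = enat k \<Longrightarrow> k dvd period"
  unfolding period_def
  using dvd_prodI[of "S \<times> S" "(s, t)" "\<lambda>p. case m (fst p) (snd p) of enat k \<Rightarrow> k | \<infinity> \<Rightarrow> 1"] finite_S
  by simp

lemma angle_le: "angle s t \<le> period"
  by (auto simp: angle_def split: enat.split)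

lemma cos2_angle:
  assumes "s \<in> S" "t \<in> S" shows "- 2 * cox_coeff (m s t) = cos2 (angle s t)"
proof (cases "m s t")
  case (enat k)
  obtain q where q: "period = k * q" using dvd_period[OF assms enat] by (elim dvdE)
  have "0 < k" "0 < q" using m_pos[OF assms enat] period_pos q by auto
  then show ?thesis by (simp add: enat cox_coeff_def angle_def cos2_def q)
next
  case infinity
  then show ?thesis by (simp add: cox_coeff_def angle_def cos2_def)
qed

lemma cos2_0: "cos2 0 = 2" and cos2_period: "cos2 period = - 2"
  using period_pos by (simp_all add: cos2_def)

lemma cos2_mod: "cos2 (j mod (2 * period)) = cos2 j"
proof -
  have "real j * pi / real period =
      real (j mod (2 * period)) * pi / real period + real_of_int (int (j div (2 * period))) * (2 * pi)"
  proof -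
    have "real j = real (j div (2 * period)) * real (2 * period) + real (j mod (2 * period))"
      by (metis div_mult_mod_eq of_nat_add of_nat_mult)
    then show ?thesis using period_pos by (simp add: field_simps)
  qed
  then show ?thesis
    using cos.plus_of_nat[of "real (j mod (2 * period)) * pi / real period" "j div (2 * period)"]
    unfolding cos2_def by simp
qed

text \<open>The product-to-sum formula for cosines, with 2 * period - a in place of -a so that
  indices remain natural numbers.\<close>

lemma cos2_mult:
  assumes "a \<le> period"
  shows "cos2 j * cos2 a = cos2 ((j + a) mod (2 * period)) + cos2 ((j + (2 * period - a)) mod (2 * period))"
proof -
  have "cos2 (j + (2 * period - a)) = 2 * cos (real j * pi / real period - real a * pi / real period)"
  proof -
    have "real (j + (2 * period - a)) * pi / real period =
        (real j * pi / real period - real a * pi / real period) + 2 * pi"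
      using assms period_pos by (simp add: of_nat_diff field_simps)
    then show ?thesis unfolding cos2_def by (simp only: cos_periodic)
  qed
  moreover have "cos2 (j + a) = 2 * cos (real j * pi / real period + real a * pi / real period)"
    unfolding cos2_def by (simp add: distrib_right add_divide_distrib)
  ultimately show ?thesis
    unfolding cos2_mod by (simp add: cos2_def cos_add cos_diff)
qed

definition coord :: "('s \<times> nat \<Rightarrow> nat) \<Rightarrow> 's \<Rightarrow> real"
  where "coord v t = (\<Sum>j<2 * period. real (v (t, j)) * cos2 j)"

text \<open>The reflection adds to coordinate s the sum of all coordinates t multiplied by
  \<open>cos2 (angle t s)\<close>. The two indicators move a coefficient at index j to the two
  indices given by \<open>cos2_mult\<close>, so natural coefficients stay natural.\<close>

definition lin_refl :: "'s \<times> bool \<Rightarrow> ('s \<times> nat \<Rightarrow> nat) \<Rightarrow> 's \<times> nat \<Rightarrow> nat"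
  where "lin_refl p v ti = v ti + (if fst ti = fst p then
     (\<Sum>t\<in>S. \<Sum>j<2 * period. (of_bool ((j + angle t (fst p)) mod (2 * period) = snd ti)
       + of_bool ((j + (2 * period - angle t (fst p))) mod (2 * period) = snd ti)) * v (t, j)) else 0)"

lemma simple_root_self: "simple_root s s = 1"
  by (simp add: simple_root_def)

lemma coord_lin_refl:
  assumes "s \<in> S" "t \<in> S"
  shows "coord (lin_refl (s, b) v) t = refl_by s (\<lambda>u. if u \<in> S then coord v u else 0) t"
proof (cases "t = s")
  case False
  then show ?thesis using assms by (simp add: refl_other) (simp add: coord_def lin_refl_def)
next
  case True
  let ?n = "2 * period"
  have ind: "(\<Sum>i<?n. real (of_bool (a mod ?n = i) * k) * cos2 i) = real k * cos2 (a mod ?n)" for a k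
  proof -
    have "(\<Sum>i<?n. real (of_bool (a mod ?n = i) * k) * cos2 i) = (\<Sum>i<?n. if a mod ?n = i then real k * cos2 i else 0)"
      by (intro sum.cong) auto
    also have "\<dots> = real k * cos2 (a mod ?n)" using period_pos by simp
    finally show ?thesis .
  qed
  have "coord (lin_refl (s, b) v) s = coord v s + (\<Sum>i<?n. (\<Sum>u\<in>S. \<Sum>j<?n.
      real (of_bool ((j + angle u s) mod ?n = i) * v (u, j)) * cos2 i
      + real (of_bool ((j + (?n - angle u s)) mod ?n = i) * v (u, j)) * cos2 i))"
  proof -
    have "real (lin_refl (s, b) v (s, i)) * cos2 i = real (v (s, i)) * cos2 i + (\<Sum>u\<in>S. \<Sum>j<?n.
        real (of_bool ((j + angle u s) mod ?n = i) * v (u, j)) * cos2 i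
        + real (of_bool ((j + (?n - angle u s)) mod ?n = i) * v (u, j)) * cos2 i)" for i
      by (simp only: lin_refl_def fst_conv snd_conv if_True simp_thms of_nat_add distrib_right
          of_nat_sum sum_distrib_right)
    then show ?thesis unfolding coord_def by (simp only: sum.distrib)
  qed
  also have "(\<Sum>i<?n. (\<Sum>u\<in>S. \<Sum>j<?n.
      real (of_bool ((j + angle u s) mod ?n = i) * v (u, j)) * cos2 i
      + real (of_bool ((j + (?n - angle u s)) mod ?n = i) * v (u, j)) * cos2 i))
    = (\<Sum>u\<in>S. \<Sum>j<?n. (\<Sum>i<?n. 
      real (of_bool ((j + angle u s) mod ?n = i) * v (u, j)) * cos2 i
      + real (of_bool ((j + (?n - angle u s)) mod ?n = i) * v (u, j)) * cos2 i))"
    by (rule trans[OF sum.swap], rule sum.cong[OF refl], rule sum.swap)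
  also have "\<dots> = (\<Sum>u\<in>S. \<Sum>j<?n. real (v (u, j)) * (cos2 j * cos2 (angle u s)))"
    unfolding sum.distrib ind cos2_mult[OF angle_le] by (simp add: algebra_simps sum.distrib)
  also have "\<dots> = (\<Sum>u\<in>S. coord v u * cos2 (angle u s))"
    unfolding coord_def by (simp add: sum_distrib_right mult.assoc)
  also have "\<dots> = (\<Sum>u\<in>S. coord v u * (- 2 * cox_coeff (m u s)))"
    using cos2_angle assms by (intro sum.cong) auto
  also have "coord v s + \<dots> = refl_by s (\<lambda>u. if u \<in> S then coord v u else 0) s"
    using assms cox_form_root[OF finite_S assms(1), of m "\<lambda>u. if u \<in> S then coord v u else 0"]
    by (simp add: cox_refl_def simple_root_self sum_distrib_left sum_negf mult.left_commute cong: sum.cong)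
  finally show ?thesis using True by simp
qed

lemma act_off_S: "g \<in> gwords S \<Longrightarrow> t \<notin> S \<Longrightarrow> act g x t = x t"
proof (induction g)
  case (Cons p g)
  then have "t \<noteq> fst p" by auto
  with Cons show ?case by (simp add: refl_other)
qed simp

text \<open>The initial coefficient 1 at index 0 contributes \<open>cos2 0\<close> = 2, whence the
  factor 2.\<close>

lemma coord_foldr_lin_refl:
  assumes "y \<in> S" "g \<in> gwords S"
  shows "(\<lambda>t. if t \<in> S then coord (foldr lin_refl g (\<lambda>ti. of_bool (ti = (y, 0)))) t else 0)
    = (\<lambda>t. 2 * act g (simple_root y) t)"
  using assms(2)
proof (induction g)
  case Nil
  have "coord (\<lambda>ti. of_bool (ti = (y, 0))) t = (if t = y then 2 else 0)" for t
  proof -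
    have "coord (\<lambda>ti. of_bool (ti = (y, 0))) t = (\<Sum>j<2 * period. if j = 0 then (if t = y then cos2 0 else 0) else 0)"
      unfolding coord_def by (intro sum.cong) auto
    then show ?thesis using period_pos by (simp add: cos2_0)
  qed
  then show ?case using assms(1) by (auto simp: fun_eq_iff simple_root_def)
next
  case (Cons p g)
  obtain s b where p: "p = (s, b)" by force
  have s: "s \<in> S" using Cons.prems p by simp
  let ?v = "foldr lin_refl g (\<lambda>ti. of_bool (ti = (y, 0)))"
  have IH: "(\<lambda>t. if t \<in> S then coord ?v t else 0) = (\<lambda>t. 2 * act g (simple_root y) t + 0 * simple_root y t)"
    using Cons by simp
  show ?case
  proof
    fix t
    show "(if t \<in> S then coord (foldr lin_refl (p # g) (\<lambda>ti. of_bool (ti = (y, 0)))) t else 0)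
      = 2 * act (p # g) (simple_root y) t"
    proof (cases "t \<in> S")
      case True
      then show ?thesis
        using coord_lin_refl[OF s True, of b ?v] unfolding IH refl_comb by (simp add: p)
    next
      case False
      have "act (p # g) (simple_root y) t = 0"
        using act_off_S[OF Cons.prems False] False assms(1) by (auto simp: simple_root_def)
      then show ?thesis using False by simp
    qed
  qed
qed

lemma computable_act_eq_simple:
  assumes "y \<in> S" "s \<in> S"
  shows "computable word_code bool_code (\<lambda>g. act g (simple_root y) = simple_root s)"
proof -
  obtain ixs where ixs: "set ixs = S \<times> {..<2 * period}"
    using finite_list[of "S \<times> {..<2 * period}"] finite_S by auto
  let ?V = "vec_code ixs"
  have nth: "computable ?V nat_code (\<lambda>v. v (t, j))" if "t \<in> S" "j < 2 * period" for t j
    using that ixs by (intro computable_vec_nth) auto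
  have lin: "computable ?V ?V (lin_refl p)" if "p \<in> S \<times> UNIV" for p
  proof (rule computable_vec)
    fix ti assume "ti \<in> set ixs"
    then have ti: "fst ti \<in> S" "snd ti < 2 * period"
      unfolding ixs mem_Times_iff by simp_all
    then have ti_val: "computable ?V nat_code (\<lambda>v. v ti)" using nth[of "fst ti" "snd ti"] by simp
    have sum: "computable ?V nat_code (\<lambda>v. \<Sum>t\<in>S. \<Sum>j<2 * period. k t j * v (t, j))" for k
      by (intro computable_sum computable_mult_const nth) simp_all
    show "computable ?V nat_code (\<lambda>v. lin_refl p v ti)"
    proof (cases "fst ti = fst p")
      case True
      show ?thesis
        unfolding lin_refl_def if_P[OF True] by (rule computable_add[OF ti_val sum])
    next
      case False
      show ?thesis
        unfolding lin_refl_def if_not_P[OF False] add_0_right by (rule ti_val)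
    qed
  qed
  let ?E = "word_code"
  have "computable (?E \<otimes>\<^sub>c (letter_code \<otimes>\<^sub>c ?V)) ?V (\<lambda>p. lin_refl (fst (snd p)) (snd (snd p)))"
    by (rule computable_comp[OF computable_letter_case[where f = lin_refl] computable_snd[OF computable_id]])
      (rule lin)
  then have "computable ?E ?V (\<lambda>g. foldr lin_refl g (\<lambda>ti. of_bool (ti = (y, 0))))"
    by (intro computable_foldr[OF computable_id, where g = "\<lambda>_. lin_refl"])
      (auto intro!: computable_vec computable_nat_const)
  from computable_comp[OF nth this]
  have v: "computable ?E nat_code (\<lambda>g. foldr lin_refl g (\<lambda>ti. of_bool (ti = (y, 0))) (t, j))"
    if "t \<in> S" "j < 2 * period" for t j using that by simp
  \<comment> \<open>The additional 1 at index \<open>period\<close> contributes -2, so the sums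
    vanish when twice the root equals twice \<open>simple_root s\<close>.\<close>
  let ?w = "\<lambda>g t j. foldr lin_refl g (\<lambda>ti. of_bool (ti = (y, 0))) (t, j) + of_bool (t = s \<and> j = period)"
  have "computable ?E bool_code (\<lambda>g. \<forall>t\<in>S. (\<Sum>j<2 * period. real (?w g t j) * cos2 j) = 0)"
    by (intro computable_Ball finite_S computable_relation computable_add v computable_nat_const) auto
  then show ?thesis
  proof (rule computable_cong)
    fix n g assume "?E n g"
    then have g: "g \<in> gwords S" by (rule word_code_gwords)
    have "(\<Sum>j<2 * period. real (?w g t j) * cos2 j) = 2 * act g (simple_root y) t - 2 * simple_root s t"
      if "t \<in> S" for t
    proof -
      have "(\<Sum>j<2 * period. real (of_bool (t = s \<and> j = period)) * cos2 j)
          = (\<Sum>j<2 * period. if j = period then (if t = s then cos2 period else 0) else 0)"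
        by (intro sum.cong) auto
      also have "\<dots> = - 2 * simple_root s t" using period_pos by (simp add: cos2_period simple_root_def)
      finally show ?thesis
        using fun_cong[OF coord_foldr_lin_refl[OF assms(1) g], of t] that
        by (simp add: coord_def distrib_right sum.distrib)
    qed
    then have "(\<forall>t\<in>S. (\<Sum>j<2 * period. real (?w g t j) * cos2 j) = 0) \<longleftrightarrow>
        (\<forall>t\<in>S. act g (simple_root y) t = simple_root s t)" by simp
    also have "\<dots> \<longleftrightarrow> act g (simple_root y) = simple_root s"
    proof -
      have "act g (simple_root y) t = simple_root s t" if "t \<notin> S" for t
        using act_off_S[OF g that, of "simple_root y"] assms that by (auto simp: simple_root_def)
      then show ?thesis unfolding fun_eq_iff by blast
    qed
    finally show "(\<forall>t\<in>S. (\<Sum>j<2 * period. real (?w g t j) * cos2 j) = 0) = (act g (simple_root y) = simple_root s)" .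
  qed
qed

text \<open>Running through a list of the elements of Y replaces the existential quantifier and the
  description operator of the machine by finitely many tests. The output accumulates in reverse
  order.\<close>

primrec ret_step :: "'s list \<Rightarrow> 's \<times> bool \<Rightarrow> 's gword \<times> 's gword \<Rightarrow> 's gword \<times> 's gword"
where
  "ret_step [] p st = ((fst p, True) # fst st, snd st)"
| "ret_step (y # ys) p st = (if act (fst st) (simple_root y) = simple_root (fst p)
     then (fst st, (y, snd p) # snd st) else ret_step ys p st)"

lemma ret_step:
  assumes "fst st \<in> gwords S"
  shows "ret_step ys p st = (if \<exists>y. hits (set ys) (fst st) (fst p) y
    then (fst st, (THE y. hits (set ys) (fst st) (fst p) y, snd p) # snd st)
    else ((fst p, True) # fst st, snd st))"
proof (induction ys)
  case (Cons y ys)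
  show ?case
  proof (cases "hits (set (y # ys)) (fst st) (fst p) y")
    case True
    then show ?thesis using hits_the[OF assms True] by (auto simp: hits_def)
  next
    case False
    then have "hits (set (y # ys)) (fst st) (fst p) = hits (set ys) (fst st) (fst p)"
      by (auto simp: hits_def fun_eq_iff[where 'b = bool])
    moreover have "act (fst st) (simple_root y) \<noteq> simple_root (fst p)"
      using False by (simp add: hits_def)
    ultimately show ?thesis using Cons by simp
  qed
qed (simp add: hits_def)

lemma fold_ret_step:
  assumes "g \<in> gwords S" "w \<in> gwords S"
  shows "fold (ret_step ys) w (g, out) = (run_state (set ys) g w, rev (run_out (set ys) g w) @ out)"
  using assms
proof (induction w arbitrary: g out)
  case (Cons p w)
  then show ?case using ret_step[of "(g, out)" ys p] by auto
qed simp

lemma computable_retract: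
  assumes "Y \<subseteq> S"
  shows "computable word_code word_code (retract Y)"
proof -
  obtain ys where ys: "set ys = Y" using finite_list finite_subset[OF assms finite_S] by blast
  let ?P = "word_code \<otimes>\<^sub>c word_code"
  have fst: "computable ?P word_code fst" and snd: "computable ?P word_code snd"
    using computable_fst[OF computable_id] computable_snd[OF computable_id] by auto
  have letter: "computable ?P letter_code (\<lambda>_. q)" if "q \<in> S \<times> UNIV" for q
    using that by (intro computable_const[of _ "c q"]) (auto simp: fin_code_def)
  have "computable ?P ?P (ret_step zs p)" if "p \<in> S \<times> UNIV" "set zs \<subseteq> S" for zs p
    using that(2)
  proof (induction zs)
    case Nil
    have "computable ?P ?P (\<lambda>st. ((fst p, True) # fst st, snd st))"
      using that by (intro computable_pair computable_Cons fst snd letter) auto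
    then show ?case by simp
  next
    case (Cons y zs)
    have "computable ?P bool_code (\<lambda>st. act (fst st) (simple_root y) = simple_root (fst p))"
      using computable_comp[OF computable_act_eq_simple fst, of y "fst p"] that Cons by auto
    moreover have "computable ?P ?P (\<lambda>st. (fst st, (y, snd p) # snd st))"
      using Cons by (intro computable_pair computable_Cons fst snd letter) auto
    moreover have "computable ?P ?P (ret_step zs p)" using Cons by simp
    ultimately have "computable ?P ?P (\<lambda>st. if act (fst st) (simple_root y) = simple_root (fst p)
       then (fst st, (y, snd p) # snd st) else ret_step zs p st)" by (rule computable_If)
    then show ?case by simp
  qed
  then have step: "computable (letter_code \<otimes>\<^sub>c ?P) ?P (\<lambda>p. ret_step ys (fst p) (snd p))"
    using ys assms by (intro computable_letter_case) auto
  have "computable (word_code \<otimes>\<^sub>c (letter_code \<otimes>\<^sub>c ?P)) ?P (\<lambda>p. ret_step ys (fst (snd p)) (snd (snd p)))"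
    by (rule computable_comp[OF step computable_snd[OF computable_id]])
  from computable_fold[OF computable_id computable_pair[OF computable_Nil computable_Nil] this]
  have "computable word_code ?P (\<lambda>w. fold (ret_step ys) w ([], []))" .
  from computable_rev[OF computable_comp[OF snd this]]
  show ?thesis
  proof (rule computable_cong)
    fix n w assume "word_code n w"
    then have "w \<in> gwords S" by (rule word_code_gwords)
    then show "rev (snd (fold (ret_step ys) w ([], []))) = retract Y w"
      by (simp add: fold_ret_step ys retract_def)
  qed
qed

end

section \<open>Normal forms in amalgamated products\<close>

definition winv :: "'s gword \<Rightarrow> 's gword"
  where "winv w = rev (map (\<lambda>p. (fst p, \<not> snd p)) w)"

lemma winv_Cons: "winv (p # w) = winv w @ [(fst p, \<not> snd p)]"
  by (simp add: winv_def)

context coxeter_system begin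

lemma winv_gwords [simp]: "winv w \<in> gwords X \<longleftrightarrow> w \<in> gwords X"
  by (induction w) (auto simp: winv_def)

abbreviation G :: "'s gword set monoid"
  where "G \<equiv> artin_group S m"

definition word_class :: "'s gword \<Rightarrow> 's gword set"
  where "word_class w = pres_rel_of S (artin_rels S m) `` {w}"

abbreviation eqv :: "'s gword \<Rightarrow> 's gword \<Rightarrow> bool"
  where "eqv \<equiv> pres_eq S (artin_rels S m)"

lemma group_G: "group G"
  unfolding artin_group_def by (rule group_presented_group)

lemma word_class_carrier [simp]: "w \<in> gwords S \<Longrightarrow> word_class w \<in> carrier G"
  by (auto simp: word_class_def artin_group_def presented_group_def intro: quotientI)

lemma carrier_word_class: "x \<in> carrier G \<Longrightarrow> \<exists>w\<in>gwords S. x = word_class w"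
  by (auto simp: word_class_def artin_group_def presented_group_def quotient_def)

lemma word_class_append: "u \<in> gwords S \<Longrightarrow> v \<in> gwords S \<Longrightarrow> word_class (u @ v) = word_class u \<otimes>\<^bsub>G\<^esub> word_class v"
  unfolding word_class_def artin_group_def by (rule presented_group_mult[symmetric])

lemma word_class_Nil: "word_class [] = \<one>\<^bsub>G\<^esub>"
  by (simp add: word_class_def artin_group_def presented_group_def)

lemma eqv_iff: "u \<in> gwords S \<Longrightarrow> v \<in> gwords S \<Longrightarrow> eqv u v \<longleftrightarrow> word_class u = word_class v"
  using eq_equiv_class_iff[OF equiv_pres_rel_of, of u S v "artin_rels S m"]
  by (simp add: word_class_def pres_rel_of_def)

lemma eqv_gwords: "eqv u v \<Longrightarrow> u \<in> gwords S" "eqv u v \<Longrightarrow> v \<in> gwords S"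
  using pres_eq_gwords by blast+

lemma word_class_eqI: "eqv u v \<Longrightarrow> word_class u = word_class v"
  using eqv_iff eqv_gwords by blast

lemma word_class_inverse_letter:
  assumes "s \<in> S" shows "word_class [(s, \<not> b)] = inv\<^bsub>G\<^esub> (word_class [(s, b)])"
proof -
  interpret group G by (rule group_G)
  have "word_class ([(s, \<not> b)] @ [(s, b)]) = \<one>\<^bsub>G\<^esub>"
    using pres_cancel[OF assms, of "artin_rels S m" "\<not> b"] word_class_eqI word_class_Nil by fastforce
  then have "word_class [(s, \<not> b)] \<otimes>\<^bsub>G\<^esub> word_class [(s, b)] = \<one>\<^bsub>G\<^esub>"
    using assms word_class_append[of "[(s, \<not> b)]" "[(s, b)]"] by simp
  then show ?thesis using assms inv_equality by (metis word_class_carrier fst_conv gwords_simps(1,2))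
qed

lemma word_class_winv: "w \<in> gwords S \<Longrightarrow> word_class (winv w) = inv\<^bsub>G\<^esub> (word_class w)"
proof (induction w)
  case Nil
  interpret group G by (rule group_G)
  show ?case by (simp add: winv_def word_class_Nil)
next
  case (Cons p w)
  interpret group G by (rule group_G)
  obtain s b where p: "p = (s, b)" by force
  have "word_class (p # w) = word_class [p] \<otimes>\<^bsub>G\<^esub> word_class w" using Cons.prems word_class_append[of "[p]" w] by simp
  moreover have "word_class (winv (p # w)) = word_class (winv w) \<otimes>\<^bsub>G\<^esub> word_class [(s, \<not> b)]"
    using Cons.prems word_class_append[of "winv w" "[(s, \<not> b)]"] by (simp add: winv_Cons p)
  ultimately show ?case
    using Cons word_class_inverse_letter[of s b] by (simp add: p inv_mult_group)
qed

lemma eqv_refl [simp]: "eqv u u \<longleftrightarrow> u \<in> gwords S"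
  using eqv_gwords pres_refl by blast

lemma eqv_sym: "eqv u v \<Longrightarrow> eqv v u"
  by (rule pres_sym)

lemma eqv_trans: "eqv u v \<Longrightarrow> eqv v w \<Longrightarrow> eqv u w"
  by (rule pres_trans)

lemma eqv_append: "eqv u u' \<Longrightarrow> eqv v v' \<Longrightarrow> eqv (u @ v) (u' @ v')"
  by (rule pres_append)

lemma eqv_winv:
  assumes "eqv u v" shows "eqv (winv u) (winv v)"
  using assms eqv_gwords[OF assms] by (simp add: eqv_iff word_class_winv)

lemma eqv_winv_cancel:
  assumes "u \<in> gwords S" "v \<in> gwords S" shows "eqv (winv u @ u @ v) v" "eqv (u @ winv u @ v) v"
proof -
  interpret group G by (rule group_G)
  have "word_class u \<in> carrier G" "word_class v \<in> carrier G" using assms by simp_all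
  then show "eqv (winv u @ u @ v) v" "eqv (u @ winv u @ v) v"
    using assms by (simp_all add: eqv_iff word_class_append word_class_winv m_assoc[symmetric])
qed

lemma eqv_winv_self: "u \<in> gwords S \<Longrightarrow> eqv (winv u @ u) []"
  using eqv_winv_cancel(1)[of u "[]"] by simp

lemma eqv_of_quotient:
  assumes "r \<in> gwords S" "g \<in> gwords S" "eqv (winv r @ g) []" shows "eqv r g"
proof -
  have "eqv (r @ winv r @ g) (r @ [])" using assms by (intro eqv_append) simp_all
  then have "eqv r (r @ winv r @ g)" by (simp add: eqv_sym)
  then show ?thesis by (rule eqv_trans[OF _ eqv_winv_cancel(2)[OF assms(1,2)]])
qed

lemma eqv_retract: "Y \<subseteq> S \<Longrightarrow> eqv u v \<Longrightarrow> eqv (retract Y u) (retract Y v)"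
  using retract_cong artin_pres_eq_mono by blast

lemma retract_Nil: "retract Y [] = []"
  by (simp add: retract_def)

lemma gwords_mono: "X \<subseteq> Z \<Longrightarrow> w \<in> gwords X \<Longrightarrow> w \<in> gwords Z"
  by (auto simp: gwords_def)

end

text \<open>D stands for decision procedures of the two factors, correct only on words of the
  respective factor. It is used in the normal forms in place of \<open>eqv\<close> so that the same
  functions can be shown computable.\<close>

locale amalgam = coxeter_system S m for S :: "'s set" and m +
  fixes X :: "'s set" and a b :: 's and D :: "bool \<Rightarrow> 's gword \<Rightarrow> bool"
  assumes X: "X \<subseteq> S" and ab: "a \<in> X" "b \<in> X" "a \<noteq> b" "m a b = \<infinity>"
    and D: "\<And>w. w \<in> gwords (X - {b}) \<Longrightarrow> D True w \<longleftrightarrow> eqv w []"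
      "\<And>w. w \<in> gwords (X - {a}) \<Longrightarrow> D False w \<longleftrightarrow> eqv w []"
begin

definition factor :: "bool \<Rightarrow> 's set"
  where "factor i = X - {if i then b else a}"

definition edge :: "'s set"
  where "edge = X - {a, b}"

lemma edge_S: "edge \<subseteq> S" and factor_S: "factor i \<subseteq> S" and edge_factor: "edge \<subseteq> factor i"
  using X by (auto simp: edge_def factor_def)

lemma D_iff: "w \<in> gwords (factor i) \<Longrightarrow> D i w \<longleftrightarrow> eqv w []"
  using D by (cases i) (auto simp: factor_def)

lemma factor_gwords_S: "w \<in> gwords (factor i) \<Longrightarrow> w \<in> gwords S"
  and edge_gwords_S: "w \<in> gwords edge \<Longrightarrow> w \<in> gwords S"
  and edge_gwords_factor: "w \<in> gwords edge \<Longrightarrow> w \<in> gwords (factor i)"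
  by (erule gwords_mono[OF factor_S] gwords_mono[OF edge_S] gwords_mono[OF edge_factor])+

abbreviation head :: "'s gword \<Rightarrow> 's gword"
  where "head \<equiv> retract edge"

definition rep :: "'s gword \<Rightarrow> 's gword"
  where "rep g = winv (head g) @ g"

lemma head_edge: "g \<in> gwords S \<Longrightarrow> head g \<in> gwords edge"
  by (rule retract_gwords[OF edge_S])

lemma rep_factor: "g \<in> gwords (factor i) \<Longrightarrow> rep g \<in> gwords (factor i)"
  unfolding rep_def using head_edge[OF factor_gwords_S] edge_gwords_factor by simp

lemma head_cong: "eqv g h \<Longrightarrow> eqv (head g) (head h)"
  by (rule eqv_retract[OF edge_S])

lemma rep_cong: "eqv g h \<Longrightarrow> eqv (rep g) (rep h)"
  unfolding rep_def by (intro eqv_append eqv_winv head_cong)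

lemma head_rep: "g \<in> gwords S \<Longrightarrow> eqv (head (rep g)) []"
  unfolding rep_def using head_edge[of g] edge_gwords_S retract_append_left[OF edge_S]
  by (simp add: eqv_winv_self)

lemma head_append: "y \<in> gwords edge \<Longrightarrow> head (y @ w) = y @ head w"
  by (rule retract_append_left[OF edge_S])

lemma head_rep_eqv: "g \<in> gwords S \<Longrightarrow> eqv (head g @ rep g) g"
  unfolding rep_def using eqv_winv_cancel(2) head_edge edge_gwords_S by blast

type_synonym 'b state = "'b gword \<times> (bool \<times> 'b gword) list"

text \<open>A state \<open>(y, [(i\<^sub>1, r\<^sub>1), (i\<^sub>2, r\<^sub>2), \<dots>])\<close> stands for the normal form \<open>y r\<^sub>1 r\<^sub>2 \<dots>\<close>, where
  \<open>r\<^sub>k\<close> is a coset representative in the factor \<open>i\<^sub>k\<close>. By van der Waerden's trick, uniqueness follows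
  from an action of the group on states.\<close>

definition norm_form :: "bool \<Rightarrow> 's gword \<Rightarrow> (bool \<times> 's gword) list \<Rightarrow> 's state"
  where "norm_form i g rest = (head g, if D i (rep g) then rest else (i, rep g) # rest)"

definition absorb :: "bool \<Rightarrow> (bool \<times> 's gword) list \<Rightarrow> 's gword \<times> (bool \<times> 's gword) list"
  where "absorb i st = (case st of [] \<Rightarrow> ([], []) | q # rest \<Rightarrow> if fst q = i then (snd q, rest) else ([], st))"

definition factor_act :: "bool \<Rightarrow> 's gword \<Rightarrow> 's state \<Rightarrow> 's state"
  where "factor_act i u \<sigma> = norm_form i (u @ fst \<sigma> @ fst (absorb i (snd \<sigma>))) (snd (absorb i (snd \<sigma>)))"

definition top_differs :: "bool \<Rightarrow> (bool \<times> 's gword) list \<Rightarrow> bool"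
  where "top_differs i st \<longleftrightarrow> (case st of [] \<Rightarrow> True | q # rest \<Rightarrow> fst q \<noteq> i)"

lemma top_differs_simps: "top_differs i []" "top_differs i (q # rest) \<longleftrightarrow> fst q \<noteq> i"
  by (simp_all add: top_differs_def)

text \<open>A trivial head says that the word equals, in A, the chosen representative of its
  coset.\<close>

primrec valid_stack :: "(bool \<times> 's gword) list \<Rightarrow> bool"
where
  "valid_stack [] \<longleftrightarrow> True"
| "valid_stack (q # rest) \<longleftrightarrow> snd q \<in> gwords (factor (fst q)) \<and> eqv (head (snd q)) [] \<and>
     \<not> eqv (snd q) [] \<and> top_differs (fst q) rest \<and> valid_stack rest"

definition valid :: "'s state \<Rightarrow> bool"
  where "valid \<sigma> \<longleftrightarrow> fst \<sigma> \<in> gwords edge \<and> valid_stack (snd \<sigma>)"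

definition stack_eq :: "(bool \<times> 's gword) list \<Rightarrow> (bool \<times> 's gword) list \<Rightarrow> bool"
  where "stack_eq = list_all2 (\<lambda>q q'. fst q = fst q' \<and> eqv (snd q) (snd q'))"

definition sim :: "'s state \<Rightarrow> 's state \<Rightarrow> bool"
  where "sim \<sigma> \<tau> \<longleftrightarrow> eqv (fst \<sigma>) (fst \<tau>) \<and> stack_eq (snd \<sigma>) (snd \<tau>)"

lemma stack_eq_refl: "valid_stack st \<Longrightarrow> stack_eq st st"
  by (induction st) (auto simp: stack_eq_def factor_gwords_S)

lemma sim_refl: "valid \<sigma> \<Longrightarrow> sim \<sigma> \<sigma>"
  by (simp add: sim_def valid_def stack_eq_refl edge_gwords_S)

lemma sim_sym: "sim \<sigma> \<tau> \<Longrightarrow> sim \<tau> \<sigma>"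
  unfolding sim_def stack_eq_def by (auto simp: list_all2_conv_all_nth intro: eqv_sym)

lemma sim_trans: "sim \<rho> \<sigma> \<Longrightarrow> sim \<sigma> \<tau> \<Longrightarrow> sim \<rho> \<tau>"
proof -
  assume *: "sim \<rho> \<sigma>" "sim \<sigma> \<tau>"
  let ?R = "\<lambda>q q'. fst q = fst q' \<and> eqv (snd q) (snd q')"
  have "list_all2 ?R (snd \<rho>) (snd \<tau>)"
  proof (rule list_all2_trans)
    show "list_all2 ?R (snd \<rho>) (snd \<sigma>)" "list_all2 ?R (snd \<sigma>) (snd \<tau>)"
      using * by (auto simp: sim_def stack_eq_def)
  qed (use eqv_trans in auto)
  moreover have "eqv (fst \<rho>) (fst \<tau>)" using * eqv_trans by (auto simp: sim_def)
  ultimately show "sim \<rho> \<tau>" by (simp add: sim_def stack_eq_def)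
qed

lemma absorb:
  assumes "valid_stack st"
  shows "fst (absorb i st) \<in> gwords (factor i)" "eqv (head (fst (absorb i st))) []"
    "top_differs i (snd (absorb i st))" "valid_stack (snd (absorb i st))"
proof -
  have "fst (absorb i st) \<in> gwords (factor i) \<and> eqv (head (fst (absorb i st))) [] \<and>
      top_differs i (snd (absorb i st)) \<and> valid_stack (snd (absorb i st))"
  proof (cases st)
    case (Cons q rest)
    then show ?thesis
      using assms by (cases "fst q = i") (simp_all add: absorb_def top_differs_simps retract_Nil)
  qed (simp add: absorb_def top_differs_simps retract_Nil)
  then show "fst (absorb i st) \<in> gwords (factor i)" "eqv (head (fst (absorb i st))) []"
    "top_differs i (snd (absorb i st))" "valid_stack (snd (absorb i st))" by simp_all
qed

lemma absorb_cong:
  assumes "stack_eq st st'"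
  shows "eqv (fst (absorb i st)) (fst (absorb i st'))" "stack_eq (snd (absorb i st)) (snd (absorb i st'))"
  using assms by (auto simp: absorb_def stack_eq_def split: list.split)

lemma absorb_top_differs: "top_differs i st \<Longrightarrow> absorb i st = ([], st)"
  by (auto simp: absorb_def top_differs_def split: list.splits)

lemma norm_form_valid:
  assumes "g \<in> gwords (factor i)" "valid_stack rest" "top_differs i rest"
  shows "valid (norm_form i g rest)"
  using assms D_iff[OF rep_factor[OF assms(1)]] rep_factor[OF assms(1)]
    head_edge[OF factor_gwords_S[OF assms(1)]] head_rep[OF factor_gwords_S[OF assms(1)]]
  by (simp add: valid_def norm_form_def)

lemma norm_form_cong:
  assumes "g \<in> gwords (factor i)" "h \<in> gwords (factor i)" "eqv g h" "stack_eq rest rest'"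
  shows "sim (norm_form i g rest) (norm_form i h rest')"
proof -
  have "eqv (rep g) [] \<longleftrightarrow> eqv (rep h) []"
    using rep_cong[OF assms(3)] eqv_trans eqv_sym by blast
  then show ?thesis
    using assms D_iff[OF rep_factor[OF assms(1)]] D_iff[OF rep_factor[OF assms(2)]]
      rep_cong[OF assms(3)] head_cong[OF assms(3)]
    by (simp add: sim_def norm_form_def stack_eq_def)
qed

lemma factor_act_arg:
  assumes "u \<in> gwords (factor i)" "valid \<sigma>"
  shows "u @ fst \<sigma> @ fst (absorb i (snd \<sigma>)) \<in> gwords (factor i)"
  using assms absorb(1)[of "snd \<sigma>" i] edge_gwords_factor by (simp add: valid_def)

lemma factor_act_valid:
  assumes "u \<in> gwords (factor i)" "valid \<sigma>" shows "valid (factor_act i u \<sigma>)"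
  unfolding factor_act_def using assms absorb[of "snd \<sigma>" i]
  by (intro norm_form_valid factor_act_arg) (auto simp: valid_def)

lemma factor_act_cong:
  assumes "u \<in> gwords (factor i)" "v \<in> gwords (factor i)" "eqv u v" "valid \<sigma>" "valid \<tau>" "sim \<sigma> \<tau>"
  shows "sim (factor_act i u \<sigma>) (factor_act i v \<tau>)"
  unfolding factor_act_def using assms absorb_cong[of "snd \<sigma>" "snd \<tau>" i]
  by (intro norm_form_cong factor_act_arg eqv_append) (auto simp: sim_def)

text \<open>After the action of v, the head and the syllable on top multiply back to g, whether or
  not that syllable was dropped as trivial. Both sides therefore normalize words for the same
  element.\<close>

lemma factor_act_append:
  assumes u: "u \<in> gwords (factor i)" and v: "v \<in> gwords (factor i)" and \<sigma>: "valid \<sigma>"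
  shows "sim (factor_act i u (factor_act i v \<sigma>)) (factor_act i (u @ v) \<sigma>)"
proof -
  define r where "r = fst (absorb i (snd \<sigma>))"
  define rest where "rest = snd (absorb i (snd \<sigma>))"
  define g where "g = v @ fst \<sigma> @ r"
  have rest: "top_differs i rest" "valid_stack rest" using \<sigma> absorb by (auto simp: valid_def rest_def)
  have g: "g \<in> gwords (factor i)" unfolding g_def r_def by (rule factor_act_arg[OF v \<sigma>])
  note gS = factor_gwords_S[OF g]
  have hg: "head g \<in> gwords edge" using head_edge[OF gS] .
  have u_eqv: "eqv u u" using factor_gwords_S[OF u] by simp
  have R: "factor_act i (u @ v) \<sigma> = norm_form i (u @ g) rest"
    by (simp add: factor_act_def g_def r_def rest_def)
  have L: "factor_act i v \<sigma> = norm_form i g rest"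
    by (simp add: factor_act_def g_def r_def rest_def)
  show ?thesis
  proof (cases "D i (rep g)")
    case True
    then have "eqv (rep g) []" using D_iff rep_factor[OF g] by blast
    then have "eqv (head g) g"
      unfolding rep_def using eqv_of_quotient[OF edge_gwords_S[OF hg] gS] by blast
    then have "eqv (u @ head g) (u @ g)" by (intro eqv_append u_eqv)
    moreover have "factor_act i u (factor_act i v \<sigma>) = norm_form i (u @ head g) rest"
    proof -
      have "norm_form i g rest = (head g, rest)" using True by (simp add: norm_form_def)
      then show ?thesis unfolding L by (simp add: factor_act_def absorb_top_differs[OF rest(1)])
    qed
    ultimately show ?thesis
      unfolding R using u g edge_gwords_factor[OF hg] rest by (auto intro!: norm_form_cong stack_eq_refl)
  next
    case False
    have "eqv (u @ head g @ rep g) (u @ g)" by (intro eqv_append u_eqv head_rep_eqv gS)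
    moreover have "factor_act i u (factor_act i v \<sigma>) = norm_form i (u @ head g @ rep g) rest"
    proof -
      have "norm_form i g rest = (head g, (i, rep g) # rest)" using False by (simp add: norm_form_def)
      then show ?thesis unfolding L by (simp add: factor_act_def absorb_def)
    qed
    ultimately show ?thesis
      unfolding R using u g rep_factor[OF g] edge_gwords_factor[OF hg] rest
      by (auto intro!: norm_form_cong stack_eq_refl)
  qed
qed

text \<open>Normalizing y r gives back y and r: by equivariance the head of y r is y times the head
  of r, and the latter is trivial in a valid state.\<close>

lemma factor_act_Nil:
  assumes "valid \<sigma>" shows "sim (factor_act i [] \<sigma>) \<sigma>"
proof -
  obtain y st where \<sigma>: "\<sigma> = (y, st)" by force
  have y: "y \<in> gwords edge" and st: "valid_stack st" using assms by (auto simp: valid_def \<sigma>)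
  note yS = edge_gwords_S[OF y]
  show ?thesis
  proof (cases "top_differs i st")
    case True
    have "head y = y" using head_append[OF y, of "[]"] by (simp add: retract_def)
    then have "D i (rep y)"
      using D_iff[OF rep_factor[OF edge_gwords_factor[OF y]]] eqv_winv_self[OF yS] by (simp add: rep_def)
    then have "factor_act i [] \<sigma> = \<sigma>"
      using \<open>head y = y\<close> by (simp add: \<sigma> factor_act_def absorb_top_differs[OF True] norm_form_def)
    then show ?thesis using sim_refl[OF assms] by simp
  next
    case False
    then obtain r rest where st_eq: "st = (i, r) # rest"
      by (cases st) (auto simp: top_differs_def)
    have r: "r \<in> gwords (factor i)" "eqv (head r) []" "\<not> eqv r []" and rest: "valid_stack rest"
      using st by (auto simp: st_eq)
    note rS = factor_gwords_S[OF r(1)]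
    have yr: "y @ r \<in> gwords (factor i)" using edge_gwords_factor[OF y] r by simp
    have h: "eqv (head (y @ r)) y"
      using eqv_append[OF _ r(2), of y y] yS by (simp add: head_append[OF y])
    have "eqv (winv (head (y @ r)) @ y @ r) (winv y @ y @ r)"
      using yS rS by (intro eqv_append eqv_winv h) simp_all
    then have rep: "eqv (rep (y @ r)) r"
      unfolding rep_def using eqv_winv_cancel(1)[OF yS rS] eqv_trans by blast
    then have "\<not> D i (rep (y @ r))"
      using D_iff[OF rep_factor[OF yr]] r(3) eqv_trans eqv_sym by blast
    then have "factor_act i [] \<sigma> = (head (y @ r), (i, rep (y @ r)) # rest)"
      by (simp add: \<sigma> st_eq factor_act_def absorb_def norm_form_def)
    then show ?thesis
      using h rep stack_eq_refl[OF rest] by (simp add: \<sigma> st_eq sim_def stack_eq_def)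
  qed
qed

text \<open>A word over \<open>edge\<close> can be merged into the head of the state first; what
  remains is the action of the empty word, which is trivial for either factor.\<close>

lemma factor_act_edge:
  assumes "u \<in> gwords edge" "valid \<sigma>"
  shows "sim (factor_act i u \<sigma>) (factor_act j u \<sigma>)"
proof -
  have v: "valid (u @ fst \<sigma>, snd \<sigma>)" using assms by (simp add: valid_def)
  have "factor_act k u \<sigma> = factor_act k [] (u @ fst \<sigma>, snd \<sigma>)" for k by (simp add: factor_act_def)
  then show ?thesis using factor_act_Nil[OF v] sim_trans sim_sym by metis
qed

text \<open>Letters of the amalgamated subgroup act through the factor \<open>True\<close>; by \<open>factor_act_edge\<close> the
  choice does not matter.\<close>

definition letter_step :: "'s \<times> bool \<Rightarrow> 's state \<Rightarrow> 's state"
  where "letter_step p = factor_act (fst p \<noteq> b) [p]"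

lemma letter_factor: "fst p \<in> X \<Longrightarrow> [p] \<in> gwords (factor (fst p \<noteq> b))"
  using ab by (auto simp: factor_def)

lemma foldr_valid: "w \<in> gwords X \<Longrightarrow> valid \<sigma> \<Longrightarrow> valid (foldr letter_step w \<sigma>)"
  by (induction w) (auto simp: letter_step_def intro!: factor_act_valid letter_factor[unfolded])

lemma letter_step_cong:
  assumes "fst p \<in> X" "valid \<sigma>" "valid \<tau>" "sim \<sigma> \<tau>"
  shows "sim (letter_step p \<sigma>) (letter_step p \<tau>)"
  unfolding letter_step_def
  by (rule factor_act_cong[OF letter_factor letter_factor]) (use assms X in auto)

lemma foldr_cong:
  assumes "w \<in> gwords X" "valid \<sigma>" "valid \<tau>" "sim \<sigma> \<tau>"
  shows "sim (foldr letter_step w \<sigma>) (foldr letter_step w \<tau>)"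
  using assms by (induction w) (auto intro!: letter_step_cong foldr_valid)

lemma foldr_factor:
  assumes "w \<in> gwords (factor i)" "valid \<sigma>"
  shows "sim (foldr letter_step w \<sigma>) (factor_act i w \<sigma>)"
  using assms(1)
proof (induction w)
  case Nil
  show ?case using factor_act_Nil[OF assms(2)] sim_sym by simp
next
  case (Cons p w)
  have p: "[p] \<in> gwords (factor i)" "fst p \<in> X" and w: "w \<in> gwords (factor i)"
    using Cons.prems by (auto simp: factor_def)
  have wX: "w \<in> gwords X" using w by (rule gwords_mono[rotated]) (auto simp: factor_def)
  have v: "valid (factor_act i w \<sigma>)" using factor_act_valid[OF w assms(2)] .
  have 1: "sim (letter_step p (foldr letter_step w \<sigma>)) (letter_step p (factor_act i w \<sigma>))"
    using Cons.IH[OF w] by (intro letter_step_cong p foldr_valid wX assms v)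
  have 2: "sim (letter_step p (factor_act i w \<sigma>)) (factor_act i [p] (factor_act i w \<sigma>))"
  proof (cases "(fst p \<noteq> b) = i")
    case True
    then have "letter_step p = factor_act i [p]" by (simp add: letter_step_def)
    then show ?thesis using sim_refl[OF factor_act_valid[OF p(1) v]] by simp
  next
    case False
    then have "[p] \<in> gwords edge" using p by (cases i) (auto simp: factor_def edge_def)
    then show ?thesis unfolding letter_step_def by (rule factor_act_edge[OF _ v])
  qed
  have 3: "sim (factor_act i [p] (factor_act i w \<sigma>)) (factor_act i (p # w) \<sigma>)"
    using factor_act_append[OF p(1) w assms(2)] by simp
  show ?case using sim_trans[OF 1 sim_trans[OF 2 3]] by simp
qed

lemma foldr_factor_eqv:
  assumes "u \<in> gwords (factor i)" "v \<in> gwords (factor i)" "eqv u v" "valid \<sigma>"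
  shows "sim (foldr letter_step u \<sigma>) (foldr letter_step v \<sigma>)"
proof -
  have "sim (factor_act i u \<sigma>) (factor_act i v \<sigma>)"
    using factor_act_cong assms sim_refl by blast
  then show ?thesis
    by (rule sim_trans[OF foldr_factor[OF assms(1,4)] sim_trans[OF _ sim_sym[OF foldr_factor[OF assms(2,4)]]]])
qed

text \<open>As m a b is infinite, no defining relation involves both a and b. Each relation thus
  lies in one factor, whose action respects equality in A.\<close>

lemma foldr_pres_eq:
  assumes "pres_eq X (artin_rels X m) u v" "valid \<sigma>"
  shows "sim (foldr letter_step u \<sigma>) (foldr letter_step v \<sigma>)"
  using assms
proof (induction arbitrary: \<sigma> rule: pres_eq.induct)
  case (pres_refl u)
  then show ?case by (intro sim_refl foldr_valid)
next
  case (pres_sym u v)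
  then show ?case using sim_sym by blast
next
  case (pres_trans u v w)
  then show ?case using sim_trans by blast
next
  case (pres_append u u' v v')
  have X: "u \<in> gwords X" "v \<in> gwords X" "v' \<in> gwords X"
    using pres_append.hyps pres_eq_gwords by blast+
  have "sim (foldr letter_step u (foldr letter_step v \<sigma>)) (foldr letter_step u (foldr letter_step v' \<sigma>))"
    using pres_append X by (intro foldr_cong foldr_valid) auto
  moreover have "sim (foldr letter_step u (foldr letter_step v' \<sigma>)) (foldr letter_step u' (foldr letter_step v' \<sigma>))"
    using pres_append X by (intro pres_append.IH foldr_valid) auto
  ultimately show ?case using sim_trans by auto
next
  case (pres_cancel s c)
  then have eq: "eqv [(s, c), (s, \<not> c)] []" using X by (intro pres_eq.pres_cancel) auto
  have mem: "[(s, c), (s, \<not> c)] \<in> gwords (factor (s \<noteq> b))"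
    using pres_cancel(1) ab by (auto simp: factor_def)
  show ?case by (rule foldr_factor_eqv[OF mem _ eq pres_cancel.prems]) simp
next
  case (pres_rel u v)
  have eq: "eqv u v"
    using artin_pres_eq_mono[OF X pres_eq.pres_rel[OF pres_rel.hyps]] .
  obtain s t k where st: "u = alternating k s t" "v = alternating k t s" "s \<in> X" "t \<in> X"
    "s \<noteq> t" "m s t = enat k"
    using pres_rel.hyps(1) by (auto simp: artin_rels_def)
  have ts: "m t s = enat k"
    using m_sym[OF subsetD[OF X st(3)] subsetD[OF X st(4)]] st(6) by simp
  have "\<not> (a \<in> {s, t} \<and> b \<in> {s, t})"
    using st ab ts by auto
  then have "{s, t} \<subseteq> factor (b \<notin> {s, t})" using st by (auto simp: factor_def)
  then have mem: "u \<in> gwords (factor (b \<notin> {s, t}))" "v \<in> gwords (factor (b \<notin> {s, t}))"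
    using st(1,2) by (auto simp del: insert_iff)
  show ?case by (rule foldr_factor_eqv[OF mem eq pres_rel.prems])
qed

section \<open>Evaluation of normal forms\<close>

definition prod_state :: "'s state \<Rightarrow> 's gword"
  where "prod_state \<sigma> = fst \<sigma> @ concat (map snd (snd \<sigma>))"

lemma valid_stack_gwords: "valid_stack st \<Longrightarrow> concat (map snd st) \<in> gwords S"
  by (induction st) (auto simp: factor_gwords_S)

lemma prod_norm_form:
  assumes "g \<in> gwords (factor i)" "valid_stack rest"
  shows "eqv (prod_state (norm_form i g rest)) (g @ concat (map snd rest))"
proof -
  note gS = factor_gwords_S[OF assms(1)]
  have refl: "eqv (concat (map snd rest)) (concat (map snd rest))"
    using valid_stack_gwords[OF assms(2)] by simp
  show ?thesis
  proof (cases "D i (rep g)")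
    case True
    then have "eqv (winv (head g) @ g) []" using D_iff[OF rep_factor[OF assms(1)]] by (simp add: rep_def)
    then have "eqv (head g) g"
      using eqv_of_quotient gS head_edge[OF gS] edge_gwords_S by blast
    then show ?thesis using True eqv_append[OF _ refl] by (simp add: prod_state_def norm_form_def)
  next
    case False
    then show ?thesis
      using eqv_append[OF head_rep_eqv[OF gS] refl] by (simp add: prod_state_def norm_form_def)
  qed
qed

lemma prod_big:
  assumes "u \<in> gwords (factor i)" "valid \<sigma>"
  shows "eqv (prod_state (factor_act i u \<sigma>)) (u @ prod_state \<sigma>)"
proof -
  have "concat (map snd (snd \<sigma>)) = fst (absorb i (snd \<sigma>)) @ concat (map snd (snd (absorb i (snd \<sigma>))))"
    by (auto simp: absorb_def split: list.split)
  then show ?thesis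
    using prod_norm_form[OF factor_act_arg[OF assms] absorb(4)[of "snd \<sigma>" i]] assms(2)
    by (simp add: factor_act_def prod_state_def valid_def)
qed

lemma prod_foldr:
  assumes "w \<in> gwords X" shows "eqv (prod_state (foldr letter_step w ([], []))) w"
  using assms
proof (induction w)
  case Nil
  then show ?case by (simp add: prod_state_def)
next
  case (Cons p w)
  have v: "valid (foldr letter_step w ([], []))"
    using Cons.prems by (intro foldr_valid) (auto simp: valid_def)
  have p: "fst p \<in> X" "[p] \<in> gwords S" using Cons.prems X by auto
  have "eqv (prod_state (foldr letter_step (p # w) ([], []))) ([p] @ prod_state (foldr letter_step w ([], [])))"
    using prod_big[OF letter_factor[OF p(1)] v] by (simp add: letter_step_def)
  moreover have "eqv ([p] @ prod_state (foldr letter_step w ([], []))) ([p] @ w)"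
    using Cons p by (intro eqv_append) auto
  ultimately have "eqv (prod_state (foldr letter_step (p # w) ([], []))) ([p] @ w)"
    by (rule eqv_trans)
  then show ?case by simp
qed

text \<open>The state reached by w evaluates to w, and equal words reach equivalent states. The head
  is a word over \<open>edge\<close>, so either factor could judge its triviality.\<close>

lemma trivial_iff:
  assumes "w \<in> gwords X"
  shows "eqv w [] \<longleftrightarrow> snd (foldr letter_step w ([], [])) = [] \<and> D True (fst (foldr letter_step w ([], [])))"
proof -
  let ?\<sigma> = "foldr letter_step w ([], [])"
  have v0: "valid ([], [])" by (simp add: valid_def)
  have "fst ?\<sigma> \<in> gwords (factor True)"
    using foldr_valid[OF assms v0] edge_gwords_factor by (simp add: valid_def)
  then have D: "D True (fst ?\<sigma>) \<longleftrightarrow> eqv (fst ?\<sigma>) []" by (rule D_iff)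
  show ?thesis
  proof
    assume "eqv w []"
    \<comment> \<open>The action respects derivations over X, so a derivation over S has to be
      brought back to X.\<close>
    then have "pres_eq X (artin_rels X m) w []"
      using artin_pres_eq_restrict[OF X assms] by simp
    from foldr_pres_eq[OF this v0]
    show "snd ?\<sigma> = [] \<and> D True (fst ?\<sigma>)"
      unfolding D by (simp add: sim_def stack_eq_def)
  next
    assume *: "snd ?\<sigma> = [] \<and> D True (fst ?\<sigma>)"
    then have "eqv (prod_state ?\<sigma>) []" unfolding D by (simp add: prod_state_def)
    then show "eqv w []" by (rule eqv_trans[OF eqv_sym[OF prod_foldr[OF assms]]])
  qed
qed

end

section \<open>The word problem\<close>

context coded_coxeter_system begin

text \<open>All subsets X share the coding of words over S and equality in A, so decision procedures
  for different X can be combined; D need be correct only on words over X.\<close>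

definition decidable_triviality :: "'s set \<Rightarrow> bool"
  where "decidable_triviality X \<longleftrightarrow>
    (\<exists>D. computable word_code bool_code D \<and> (\<forall>w\<in>gwords X. D w \<longleftrightarrow> eqv w []))"

lemma computable_letter: "q \<in> S \<times> UNIV \<Longrightarrow> computable E letter_code (\<lambda>_. q)"
  by (rule computable_const[of _ "c q"]) (simp add: fin_code_def)

lemma computable_winv: "computable word_code word_code winv"
proof -
  have "computable letter_code letter_code (\<lambda>p. (fst p, \<not> snd p))"
  proof (rule computable_fin_code[OF finite_letters inj_c])
    fix p assume "p \<in> S \<times> (UNIV :: bool set)"
    then show "\<exists>n. letter_code n (fst p, \<not> snd p)" by (auto simp: fin_code_def)
  qed
  from computable_rev[OF computable_map[OF computable_id this]]
  show ?thesis by (simp add: winv_def[abs_def])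
qed

end

lemma computable_bool_const: "computable A bool_code (\<lambda>_. b)"
  by (cases b) (simp_all add: computable_True computable_False)

lemma list_code_nat_code: "list_code nat_code n ns \<longleftrightarrow> n = list_encode ns"
proof -
  have "nat_code = (=)" by (simp add: nat_code_def fun_eq_iff)
  then show ?thesis by (simp add: list_code_def list.rel_eq)
qed

lemma computable_eq_bool:
  assumes "computable A bool_code p"
  shows "computable A bool_code (\<lambda>x. p x = b)"
proof (cases b)
  case False
  have "computable A bool_code (\<lambda>x. if p x then False else True)"
    by (rule computable_If[OF assms computable_False computable_True])
  then show ?thesis using False by (simp add: if_bool_eq_conj)
qed (simp add: assms)

locale coded_amalgam = amalgam S m X a b D + coded_coxeter_system S m c
  for S :: "'s set" and m X a b D c +
  assumes computable_D: "computable word_code bool_code (D i)"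
begin

abbreviation stack_code :: "(bool \<times> 's gword) list coding"
  where "stack_code \<equiv> list_code (bool_code \<otimes>\<^sub>c word_code)"

abbreviation state_code :: "('s gword \<times> (bool \<times> 's gword) list) coding"
  where "state_code \<equiv> word_code \<otimes>\<^sub>c stack_code"

lemma computable_norm_form:
  assumes g: "computable E word_code g" and rest: "computable E stack_code rest"
  shows "computable E state_code (\<lambda>x. norm_form i (g x) (rest x))"
proof -
  have head: "computable E word_code (\<lambda>x. head (g x))"
    by (rule computable_comp[OF computable_retract[OF edge_S] g])
  have rep: "computable E word_code (\<lambda>x. rep (g x))"
    unfolding rep_def by (rule computable_append[OF computable_comp[OF computable_winv head] g])
  have "computable E stack_code (\<lambda>x. if D i (rep (g x)) then rest x else (i, rep (g x)) # rest x)"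
    by (rule computable_If[OF computable_comp[OF computable_D rep] rest
        computable_Cons[OF computable_pair[OF computable_bool_const rep] rest]])
  from computable_pair[OF head this] show ?thesis by (simp only: norm_form_def)
qed

lemma computable_absorb: "computable stack_code (word_code \<otimes>\<^sub>c stack_code) (absorb i)"
  unfolding absorb_def
proof (rule computable_case_list[OF computable_id computable_pair[OF computable_Nil computable_Nil]])
  let ?Q = "bool_code \<otimes>\<^sub>c word_code"
  let ?E = "stack_code \<otimes>\<^sub>c (?Q \<otimes>\<^sub>c stack_code)"
  have st: "computable ?E stack_code (\<lambda>p. fst p)"
    by (rule computable_fst[OF computable_id])
  have q: "computable ?E ?Q (\<lambda>p. fst (snd p))"
    by (rule computable_fst[OF computable_snd[OF computable_id]])
  have rest: "computable ?E stack_code (\<lambda>p. snd (snd p))"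
    by (rule computable_snd[OF computable_snd[OF computable_id]])
  show "computable ?E (word_code \<otimes>\<^sub>c stack_code) (\<lambda>p. if fst (fst (snd p)) = i
      then (snd (fst (snd p)), snd (snd p)) else ([], fst p))"
    by (rule computable_If[OF computable_eq_bool[OF computable_fst[OF q]]
        computable_pair[OF computable_snd[OF q] rest] computable_pair[OF computable_Nil st]])
qed

lemma computable_big:
  assumes "computable state_code word_code (\<lambda>_. u)"
  shows "computable state_code state_code (factor_act i u)"
proof -
  have y: "computable state_code word_code (\<lambda>\<sigma>. fst \<sigma>)"
    by (rule computable_fst[OF computable_id])
  have "computable state_code stack_code (\<lambda>\<sigma>. snd \<sigma>)"
    by (rule computable_snd[OF computable_id])
  note ab = computable_comp[OF computable_absorb this]
  show ?thesis
    unfolding factor_act_def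
    by (rule computable_norm_form[OF computable_append[OF assms
        computable_append[OF y computable_fst[OF ab]]] computable_snd[OF ab]])
qed

lemma decidable_triviality: "decidable_triviality X"
proof -
  have "computable (letter_code \<otimes>\<^sub>c state_code) state_code (\<lambda>p. letter_step (fst p) (snd p))"
    unfolding letter_step_def
    by (rule computable_letter_case, rule computable_big, rule computable_Cons[OF computable_letter computable_Nil])
  from computable_comp[OF this computable_snd[OF computable_id]]
  have "computable (word_code \<otimes>\<^sub>c (letter_code \<otimes>\<^sub>c state_code)) state_code
      (\<lambda>p. letter_step (fst (snd p)) (snd (snd p)))" .
  from computable_foldr[OF computable_id computable_pair[OF computable_Nil computable_Nil] this]
  have run: "computable word_code state_code (\<lambda>w. foldr letter_step w ([], []))" .
  have "computable word_code bool_code (\<lambda>w. case snd (foldr letter_step w ([], [])) of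
      [] \<Rightarrow> D True (fst (foldr letter_step w ([], []))) | _ # _ \<Rightarrow> False)"
    by (rule computable_case_list[OF computable_snd[OF run]
        computable_comp[OF computable_D computable_fst[OF run]] computable_False])
  moreover have "(case snd (foldr letter_step w ([], [])) of
      [] \<Rightarrow> D True (fst (foldr letter_step w ([], []))) | _ # _ \<Rightarrow> False) \<longleftrightarrow> eqv w []" if "w \<in> gwords X" for w
    unfolding trivial_iff[OF that] by (simp split: list.split)
  ultimately show ?thesis unfolding decidable_triviality_def by blast
qed

end

context coded_coxeter_system begin

lemma decidable_triviality_subsets:
  assumes base: "\<And>X. X \<in> free_of_infinity_subsets S m \<Longrightarrow> decidable_triviality X"
    and "X \<subseteq> S"
  shows "decidable_triviality X"
  using assms(2)
proof (induction "card X" arbitrary: X rule: less_induct)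
  case less
  show ?case
  proof (cases "X \<in> free_of_infinity_subsets S m")
    case True
    then show ?thesis by (rule base)
  next
    case False
    then obtain a b where ab: "a \<in> X" "b \<in> X" "m a b = \<infinity>"
      using less.prems by (auto simp: free_of_infinity_subsets_def)
    have "a \<noteq> b" using ab m_self less.prems by (auto simp: one_enat_def)
    have fin: "finite X" using less.prems finite_S finite_subset by blast
    have "decidable_triviality (X - {b})" "decidable_triviality (X - {a})"
      using ab fin less.prems by (auto intro!: less.hyps card_Diff1_less)
    then obtain D1 D2 where D1: "computable word_code bool_code D1" "\<forall>w\<in>gwords (X - {b}). D1 w \<longleftrightarrow> eqv w []"
      and D2: "computable word_code bool_code D2" "\<forall>w\<in>gwords (X - {a}). D2 w \<longleftrightarrow> eqv w []"
      unfolding decidable_triviality_def by blast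
    interpret coded_amalgam S m X a b "\<lambda>i. if i then D1 else D2" c
      by unfold_locales (use less.prems ab \<open>a \<noteq> b\<close> D1 D2 in auto)
    show ?thesis by (rule decidable_triviality)
  qed
qed

section \<open>From words over S to words over group elements\<close>

lemma artin_gen_word_class: "artin_gen S m s = word_class [(s, True)]"
  by (simp add: artin_gen_def pres_gen_def word_class_def)

text \<open>H is either G or a generated subgroup. The latter shares product and unit with G, while
  its inverse operation has to be compared on the generators.\<close>

lemma word_value_word_class:
  fixes H :: "'s gword set monoid"
  assumes "monoid.mult H = monoid.mult G" "\<one>\<^bsub>H\<^esub> = \<one>\<^bsub>G\<^esub>"
    and "\<And>s. s \<in> X \<Longrightarrow> inv\<^bsub>H\<^esub> (artin_gen S m s) = inv\<^bsub>G\<^esub> (artin_gen S m s)"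
    and "X \<subseteq> S" "w \<in> gwords X"
  shows "word_value H (map (\<lambda>p. (artin_gen S m (fst p), snd p)) w) = word_class w"
  using assms(5)
proof (induction w)
  case Nil
  then show ?case by (simp add: word_value_def assms(2) word_class_Nil)
next
  case (Cons p w)
  obtain s b where p: "p = (s, b)" by force
  have s: "s \<in> X" "s \<in> S" and w: "w \<in> gwords X" using Cons.prems assms(4) p by auto
  have wS: "w \<in> gwords S" using w assms(4) gwords_mono by blast
  have "(if b then artin_gen S m s else inv\<^bsub>H\<^esub> artin_gen S m s) = word_class [(s, b)]"
    using assms(3)[OF s(1)] word_class_inverse_letter[OF s(2), of True] by (simp add: artin_gen_word_class)
  moreover have "word_class (p # w) = word_class [p] \<otimes>\<^bsub>G\<^esub> word_class w"
    using word_class_append[of "[p]" w] s(2) wS by (simp add: p)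
  ultimately show ?case
    using Cons.IH[OF w] by (simp add: word_value_def assms(1) p)
qed

lemma word_value_trivial_iff:
  fixes H :: "'s gword set monoid"
  assumes "monoid.mult H = monoid.mult G" "\<one>\<^bsub>H\<^esub> = \<one>\<^bsub>G\<^esub>"
    and "\<And>s. s \<in> X \<Longrightarrow> inv\<^bsub>H\<^esub> (artin_gen S m s) = inv\<^bsub>G\<^esub> (artin_gen S m s)"
    and "X \<subseteq> S" "w \<in> gwords X"
  shows "word_value H (map (\<lambda>p. (artin_gen S m (fst p), snd p)) w) = \<one>\<^bsub>H\<^esub> \<longleftrightarrow> eqv w []"
  using word_value_word_class[OF assms] gwords_mono[OF assms(4,5)] assms(2) by (simp add: eqv_iff word_class_Nil)

text \<open>The given procedure reads words over the generators through its own numbering d. Passing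
  from c to d is a finite table, applied letter by letter.\<close>

lemma decidable_triviality_of_word_problem:
  assumes "X \<subseteq> S"
    and "solvable_word_problem (subgroup_generated G (artin_gen S m ` X)) (artin_gen S m ` X)"
  shows "decidable_triviality X"
proof -
  let ?T = "artin_gen S m ` X" and ?h = "\<lambda>p. (artin_gen S m (fst p), snd p)"
  let ?H = "subgroup_generated G ?T"
  interpret group G by (rule group_G)
  obtain d f where f: "recursive 1 f"
    and dec: "\<And>w. w \<in> lists (?T \<times> UNIV) \<Longrightarrow>
      f [list_encode (map d w)] = (if w \<in> {w \<in> gwords ?T. word_value ?H w = \<one>\<^bsub>?H\<^esub>} then 1 else 0)"
    using assms(2) unfolding solvable_word_problem_def decidable_language_def by blast
  let ?D = "\<lambda>w. f [list_encode (map (\<lambda>p. d (?h p)) w)] = 1"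
  have "computable letter_code nat_code (\<lambda>p. d (?h p))"
    by (rule computable_fin_code[OF finite_letters inj_c]) (simp add: nat_code_def)
  from computable_map[OF computable_id this]
  have "computable word_code (list_code nat_code) (\<lambda>w. map (\<lambda>p. d (?h p)) w)" .
  moreover have "computable (list_code nat_code) nat_code (\<lambda>ns. f [list_encode ns])"
    unfolding computable_def
    by (rule exI[of _ "\<lambda>n. f [n]"])
      (simp add: list_code_nat_code nat_code_def rec1_recursive[OF f])
  ultimately have "computable word_code nat_code (\<lambda>w. f [list_encode (map (\<lambda>p. d (?h p)) w)])"
    using computable_comp by blast
  then have "computable word_code bool_code ?D"
    by (rule computable_nat_eq[OF _ computable_nat_const])
  moreover have "?D w \<longleftrightarrow> eqv w []" if w: "w \<in> gwords X" for w
  proof -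
    have T: "map ?h w \<in> gwords ?T" using w by (induction w) auto
    have gen: "artin_gen S m s \<in> carrier ?H" if "s \<in> X" for s
    proof -
      have "artin_gen S m s \<in> carrier G" using that assms(1) by (simp add: artin_gen_word_class subsetD)
      then show ?thesis using that by (auto simp: carrier_subgroup_generated intro: generate.incl)
    qed
    have "word_value ?H (map ?h w) = \<one>\<^bsub>?H\<^esub> \<longleftrightarrow> eqv w []"
    proof (rule word_value_trivial_iff[OF _ _ _ assms(1) w])
      show "inv\<^bsub>?H\<^esub> artin_gen S m s = inv\<^bsub>G\<^esub> artin_gen S m s" if "s \<in> X" for s
        using inv_subgroup_generated[OF gen[OF that]] .
    qed simp_all
    moreover have "map (\<lambda>p. d (?h p)) w = map d (map ?h w)" by simp
    ultimately show ?thesis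
      using dec[of "map ?h w"] T by (simp add: gwords_def del: map_map)
  qed
  ultimately show ?thesis unfolding decidable_triviality_def by blast
qed

lemma generate_gens: "generate G (artin_gen S m ` S) = carrier G"
proof
  interpret group G by (rule group_G)
  have T: "artin_gen S m ` S \<subseteq> carrier G" by (auto simp: artin_gen_word_class)
  show "generate G (artin_gen S m ` S) \<subseteq> carrier G" by (rule generate_incl[OF T])
  show "carrier G \<subseteq> generate G (artin_gen S m ` S)"
  proof
    fix x assume "x \<in> carrier G"
    then obtain w where w: "w \<in> gwords S" "x = word_class w" using carrier_word_class by blast
    have "word_class w \<in> generate G (artin_gen S m ` S)" using w(1)
    proof (induction w)
      case Nil
      then show ?case by (simp add: word_class_Nil generate.one)
    next
      case (Cons p w)
      obtain s b where p: "p = (s, b)" by force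
      have s: "s \<in> S" using Cons.prems p by simp
      have "word_class [(s, b)] \<in> generate G (artin_gen S m ` S)"
      proof (cases b)
        case True
        then show ?thesis using s by (auto simp: artin_gen_word_class intro!: generate.incl)
      next
        case False
        have "word_class [(s, False)] = inv\<^bsub>G\<^esub> artin_gen S m s"
          using word_class_inverse_letter[OF s, of True] by (simp add: artin_gen_word_class)
        then show ?thesis using False s by (auto intro!: generate.inv)
      qed
      moreover have "word_class (p # w) = word_class [p] \<otimes>\<^bsub>G\<^esub> word_class w"
        using word_class_append[of "[p]" w] Cons.prems by (simp add: p)
      ultimately show ?case using Cons by (auto simp: p intro: generate.eng)
    qed
    then show "x \<in> generate G (artin_gen S m ` S)" by (simp add: w(2))
  qed
qed

lemma word_problem_of_decidable_triviality:
  assumes "decidable_triviality S"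
  shows "solvable_word_problem G (artin_gen S m ` S)"
proof -
  let ?T = "artin_gen S m ` S" and ?h = "\<lambda>p. (artin_gen S m (fst p), snd p)"
  obtain D F where F: "rec1 F" "\<And>n w. word_code n w \<Longrightarrow> bool_code (F n) (D w)"
    and D: "\<And>w. w \<in> gwords S \<Longrightarrow> D w \<longleftrightarrow> eqv w []"
    using assms unfolding decidable_triviality_def computable_def by blast
  \<comment> \<open>Words over the generators are lifted to words over S through a section, which
    yields an injective numbering of \<open>?T\<close> even if different s were to give the same
    generator.\<close>
  define sec where "sec = inv_into S (artin_gen S m)"
  have sec: "sec x \<in> S" "artin_gen S m (sec x) = x" if "x \<in> ?T" for x
    using that by (simp_all add: sec_def inv_into_into f_inv_into_f)
  let ?k = "\<lambda>p. (sec (fst p), snd p)"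
  define d where "d p = c (?k p)" for p :: "'s gword set \<times> bool"
  have "inj_on d (?T \<times> UNIV)"
  proof (rule inj_onI)
    fix p q :: "'s gword set \<times> bool" assume pq: "p \<in> ?T \<times> UNIV" "q \<in> ?T \<times> UNIV" "d p = d q"
    then have "fst p \<in> ?T" "fst q \<in> ?T" by auto
    note sec_p = sec[OF this(1)] and sec_q = sec[OF this(2)]
    have "?k p \<in> S \<times> UNIV" "?k q \<in> S \<times> UNIV"
      unfolding mem_Times_iff fst_conv using sec_p(1) sec_q(1) by blast+
    from inj_onD[OF inj_c pq(3)[unfolded d_def] this] have "?k p = ?k q" .
    then have eq: "sec (fst p) = sec (fst q)" "snd p = snd q" unfolding prod.inject by blast+
    have "fst p = fst q"
      using arg_cong[OF eq(1), of "artin_gen S m"] unfolding sec_p(2) sec_q(2) .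
    then show "p = q" using eq(2) by (rule prod_eqI)
  qed
  moreover have "recursive 1 (\<lambda>xs. F (xs ! 0))" using F(1) by (simp add: rec1_def)
  moreover have "F ([list_encode (map d w)] ! 0) =
      (if w \<in> {w \<in> gwords ?T. word_value G w = \<one>\<^bsub>G\<^esub>} then 1 else 0)" if w: "w \<in> lists (?T \<times> UNIV)" for w
  proof -
    define w' where "w' = map ?k w"
    have w': "w' \<in> gwords S" unfolding w'_def using w by (induction w) (auto simp: sec)
    have "map ?h w' = map (\<lambda>p. p) w"
      unfolding w'_def map_map using w by (intro map_cong) (auto simp: sec)
    then have w_eq: "map ?h w' = w" by simp
    have "list_all2 letter_code (map d w) w'"
      unfolding w'_def using w by (induction w) (auto simp: fin_code_def d_def sec)
    then have "word_code (list_encode (map d w)) w'" by (auto simp: list_code_def)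
    from F(2)[OF this] have "F (list_encode (map d w)) = (if eqv w' [] then 1 else 0)"
      using D[OF w'] by (simp add: bool_code_def)
    moreover have "word_value G w = \<one>\<^bsub>G\<^esub> \<longleftrightarrow> eqv w' []"
      using word_value_trivial_iff[OF refl refl refl subset_refl w'] by (simp only: w_eq)
    ultimately show ?thesis using w by (simp add: gwords_def)
  qed
  ultimately have "decidable_language (?T \<times> UNIV) {w \<in> gwords ?T. word_value G w = \<one>\<^bsub>G\<^esub>}"
    unfolding decidable_language_def by blast
  moreover have "?T \<subseteq> carrier G" by (auto simp: artin_gen_word_class)
  ultimately show ?thesis
    unfolding solvable_word_problem_def using generate_gens finite_S by simp
qed

end

theorem theorem5p6:
  fixes S :: "'s set" and m :: "'s \<Rightarrow> 's \<Rightarrow> enat"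
  assumes "finite S" and "coxeter_matrix S m"
    and "\<And>X. X \<in> free_of_infinity_subsets S m \<Longrightarrow> type_K_pi_1 X m"
    and "\<And>X. X \<in> free_of_infinity_subsets S m \<Longrightarrow>
      solvable_word_problem (subgroup_generated (artin_group S m) (artin_gen S m ` X))
        (artin_gen S m ` X)"
  shows "solvable_word_problem (artin_group S m) (artin_gen S m ` S)"
proof -
  have "finite (S \<times> (UNIV :: bool set))" using assms(1) by simp
  then obtain c :: "'s \<times> bool \<Rightarrow> nat" where c: "inj_on c (S \<times> UNIV)"
    using finite_imp_inj_to_nat_seg by blast
  interpret coded_coxeter_system S m c
    by unfold_locales (fact assms(1,2) c)+
  have "decidable_triviality X" if "X \<in> free_of_infinity_subsets S m" for X
    using that assms(4)[OF that]
    by (intro decidable_triviality_of_word_problem) (auto simp: free_of_infinity_subsets_def)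
  then have "decidable_triviality S"
    by (rule decidable_triviality_subsets[OF _ subset_refl])
  then show ?thesis by (rule word_problem_of_decidable_triviality)
qed

end
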